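(* Let $n,m\geq1$, $A,C\in\mathbb{R}^{n\times n}$, $B\in\mathbb{R}^{n\times m}$, and let $V_{n-1}=\mathrm{span}\{\mathrm{im}(MB): M\in\mathcal{W}_{n-1}(A,C)\}\subseteq\mathbb{R}^n$. Suppose that $0<k:=\dim V_{n-1}<n$. Let $P\in\mathbb{R}^{n\times n}$ be an orthogonal matrix satisfying $$P^\top AP=\begin{pmatrix}A_{11}&A_{12}\\0&A_{22}\end{pmatrix},\quad P^\top CP=\begin{pmatrix}C_{11}&C_{12}\\0&C_{22}\end{pmatrix},\quad P^\top B=\begin{pmatrix}B_1\\0\end{pmatrix},\quad \dim U_{n-1}=k,$$ where $A_{11},C_{11}\in\mathbb{R}^{k\times k}$, $A_{12},C_{12}\in\mathbb{R}^{k\times(n-k)}$, $A_{22},C_{22}\in\mathbb{R}^{(n-k)\times(n-k)}$, $B_1\in\mathbb{R}^{k\times m}$, and $U_{n-1}=\mathrm{span}\{\mathrm{im}(MB_1): M\in\mathcal{W}_{n-1}(A_{11},C_{11})\}$. Then the system $dX(t)=[AX(t)+Bu(t)+Cz(t)]\,dt+z(t)\,dW(t)$, $X(0)=x\in\mathbb{R}^n$ (with control $(u,z)$) is stabilizable if and only if the subsystem $dY_2(t)=[A_{22}Y_2(t)+C_{22}v_2(t)]\,dt+v_2(t)\,dW(t)$, $Y_2(0)=y_2\in\mathbb{R}^{n-k}$ (with control $v_2$) is stabilizable.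
   Context: For square matrices $A,C$ of the same size, $\mathcal{W}_j(A,C)$ is the set of all words of length at most $j$ over $\{A,C\}$, i.e. all products $X_1X_2\cdots X_i$ with $0\leq i\leq j$ and each factor in $\{A,C\}$ (the empty product being the identity matrix). $\mathrm{im}$ denotes the image of a matrix. $W$ is a standard one-dimensional Brownian motion. A linear SDE $dX=\mathsf{A}X\,dt+\mathsf{C}X\,dW$, $X(0)=x$, is $L^2$-stable if $\mathbb{E}\int_0^\infty|X(t;x)|^2dt<\infty$ for every initial state $x$ (equivalently, exponentially mean-square stable; equivalently, asymptotically mean-square stable, i.e. $\mathbb{E}|X(t;x)|^2\to0$ for all $x$). The system with control $(u,z)$ is stabilizable if there exist $F\in\mathbb{R}^{m\times n}$, $K\in\mathbb{R}^{n\times n}$ such that the closed-loop system $dX=(A+BF+CK)X\,dt+KX\,dW$ is $L^2$-stable. The subsystem with control $v_2$ is stabilizable if there exists $K_2\in\mathbb{R}^{(n-k)\times(n-k)}$ such that $dY_2=(A_{22}+C_{22}K_2)Y_2\,dt+K_2Y_2\,dW$ is $L^2$-stable. *)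

theory Defs
  imports "HOL-Probability.Probability"
begin

section \<open>Words in two matrices and the span of their images\<close>

definition words :: "nat \<Rightarrow> real^'n^'n \<Rightarrow> real^'n^'n \<Rightarrow> (real^'n^'n) set" where
  "words j A C = {foldr (**) Xs (mat 1) | Xs. set Xs \<subseteq> {A, C} \<and> length Xs \<le> j}"

definition word_span :: "nat \<Rightarrow> real^'n^'n \<Rightarrow> real^'n^'n \<Rightarrow> real^'m^'n \<Rightarrow> (real^'n) set" where
  "word_span j A C B = span (\<Union>M\<in>words j A C. range (\<lambda>u. (M ** B) *v u))"


section \<open>Block matrices\<close>

text \<open>
  Rows and columns of a matrix in block form are indexed by a sum type: the left summand plays
  the role of the first \<open>k\<close> indices, the right one that of the last \<open>n - k\<close>.
\<close>

definition block_matrix ::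
  "real^'k^'k \<Rightarrow> real^'l^'k \<Rightarrow> real^'k^'l \<Rightarrow> real^'l^'l \<Rightarrow> real^('k::finite + 'l::finite)^('k + 'l)" where
  "block_matrix M11 M12 M21 M22 = (\<chi> i j. case i of
       Inl a \<Rightarrow> (case j of Inl b \<Rightarrow> M11 $ a $ b | Inr b \<Rightarrow> M12 $ a $ b)
     | Inr a \<Rightarrow> (case j of Inl b \<Rightarrow> M21 $ a $ b | Inr b \<Rightarrow> M22 $ a $ b))"

definition block_column :: "real^'m^'k \<Rightarrow> real^'m^'l \<Rightarrow> real^'m^('k::finite + 'l::finite)" where
  "block_column N1 N2 = (\<chi> i j. case i of Inl a \<Rightarrow> N1 $ a $ j | Inr a \<Rightarrow> N2 $ a $ j)"


section \<open>Brownian motion and the Ito integral\<close>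

text \<open>
  Only times \<open>t \<ge> 0\<close> matter; a filtration given on \<open>[0, \<infinity>)\<close> is extended to negative times by
  its value at \<open>0\<close>.  Taking for \<open>F\<close> the (possibly augmented) filtration generated by \<open>W\<close> is
  one admissible choice.
\<close>

locale brownian_motion = prob_space M + filtration "space M" F
  for M :: "'w measure" and F :: "real \<Rightarrow> 'w measure" +
  fixes W :: "real \<Rightarrow> 'w \<Rightarrow> real"
  assumes subalgebra_F: "subalgebra M (F t)"
    and adapted: "0 \<le> t \<Longrightarrow> W t \<in> borel_measurable (F t)"
    and start: "AE \<omega> in M. W 0 \<omega> = 0"
    and continuous_paths: "AE \<omega> in M. continuous_on {0..} (\<lambda>t. W t \<omega>)"
    and normal_increments: "0 \<le> s \<Longrightarrow> s < t \<Longrightarrow>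
      distributed M lborel (\<lambda>\<omega>. W t \<omega> - W s \<omega>) (normal_density 0 (sqrt (t - s)))"
    and indep_increments: "0 \<le> s \<Longrightarrow> s < t \<Longrightarrow>
      indep_set (sets (F s)) {(\<lambda>\<omega>. W t \<omega> - W s \<omega>) -` S \<inter> space M | S. S \<in> sets borel}"

text \<open>
  Simple integrands on \<open>[0, T]\<close>: the triple \<open>N\<close>, \<open>t\<close>, \<open>\<xi>\<close> stands for the process with value
  \<open>\<xi> i\<close> on \<open>(t i, t (i + 1)]\<close>, \<open>i < N\<close>, where \<open>\<xi> i\<close> is square integrable and known at time \<open>t i\<close>.
\<close>

definition simple_integrand ::
  "'w measure \<Rightarrow> (real \<Rightarrow> 'w measure) \<Rightarrow> real \<Rightarrow> nat \<Rightarrow> (nat \<Rightarrow> real) \<Rightarrow> (nat \<Rightarrow> 'w \<Rightarrow> real^'n) \<Rightarrow> bool" where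
  "simple_integrand M F T N t \<xi> \<longleftrightarrow>
     t 0 = 0 \<and> t N = T \<and> (\<forall>i<N. t i \<le> t (Suc i)) \<and>
     (\<forall>i<N. \<xi> i \<in> borel_measurable (F (t i)) \<and> integrable M (\<lambda>\<omega>. (norm (\<xi> i \<omega>))\<^sup>2))"

definition simple_process :: "nat \<Rightarrow> (nat \<Rightarrow> real) \<Rightarrow> (nat \<Rightarrow> 'w \<Rightarrow> real^'n) \<Rightarrow> real \<Rightarrow> 'w \<Rightarrow> real^'n" where
  "simple_process N t \<xi> s \<omega> = (\<Sum>i<N. indicator {t i<..t (Suc i)} s *\<^sub>R \<xi> i \<omega>)"

definition simple_integral ::
  "(real \<Rightarrow> 'w \<Rightarrow> real) \<Rightarrow> nat \<Rightarrow> (nat \<Rightarrow> real) \<Rightarrow> (nat \<Rightarrow> 'w \<Rightarrow> real^'n) \<Rightarrow> 'w \<Rightarrow> real^'n" where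
  "simple_integral W N t \<xi> \<omega> = (\<Sum>i<N. (W (t (Suc i)) \<omega> - W (t i) \<omega>) *\<^sub>R \<xi> i \<omega>)"

definition adapted_measurable ::
  "'w measure \<Rightarrow> (real \<Rightarrow> 'w measure) \<Rightarrow> real set \<Rightarrow> (real \<Rightarrow> 'w \<Rightarrow> real^'n) \<Rightarrow> bool" where
  "adapted_measurable M F S \<phi> \<longleftrightarrow>
     (\<forall>s\<in>S. \<phi> s \<in> borel_measurable (F s)) \<and>
     (\<lambda>(s, \<omega>). \<phi> s \<omega>) \<in> borel_measurable (restrict_space borel S \<Otimes>\<^sub>M M)"

text \<open>
  \<open>I\<close> is (a version of) the Ito integral of \<open>\<phi>\<close> over \<open>[0, T]\<close>: the mean-square limit of the
  integrals of simple integrands that approximate \<open>\<phi>\<close> in mean square on \<open>[0, T] \<times> \<Omega>\<close>.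
\<close>

definition has_ito_integral ::
  "'w measure \<Rightarrow> (real \<Rightarrow> 'w measure) \<Rightarrow> (real \<Rightarrow> 'w \<Rightarrow> real) \<Rightarrow> (real \<Rightarrow> 'w \<Rightarrow> real^'n) \<Rightarrow> real \<Rightarrow>
   ('w \<Rightarrow> real^'n) \<Rightarrow> bool" where
  "has_ito_integral M F W \<phi> T I \<longleftrightarrow>
     adapted_measurable M F {0..T} \<phi> \<and> I \<in> borel_measurable M \<and>
     (\<exists>N t \<xi>. (\<forall>j. simple_integrand M F T (N j) (t j) (\<xi> j)) \<and>
       (\<lambda>j. \<integral>\<^sup>+\<omega>. (\<integral>\<^sup>+s\<in>{0..T}.
          ennreal ((norm (\<phi> s \<omega> - simple_process (N j) (t j) (\<xi> j) s \<omega>))\<^sup>2) \<partial>lborel) \<partial>M) \<longlonglongrightarrow> 0 \<and>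
       (\<lambda>j. \<integral>\<^sup>+\<omega>. ennreal ((norm (I \<omega> - simple_integral W (N j) (t j) (\<xi> j) \<omega>))\<^sup>2) \<partial>M) \<longlonglongrightarrow> 0)"


section \<open>Linear SDEs, stability and stabilizability\<close>

text \<open>
  \<open>X\<close> solves \<open>dX = D X dt + E X dW\<close>, \<open>X(0) = x\<close>, in the class of adapted processes with almost
  surely continuous paths that are square integrable on \<open>[0, T] \<times> \<Omega>\<close> for every \<open>T\<close>.
\<close>

definition sde_solution ::
  "'w measure \<Rightarrow> (real \<Rightarrow> 'w measure) \<Rightarrow> (real \<Rightarrow> 'w \<Rightarrow> real) \<Rightarrow> real^'n^'n \<Rightarrow> real^'n^'n \<Rightarrow> real^'n \<Rightarrow>
   (real \<Rightarrow> 'w \<Rightarrow> real^'n) \<Rightarrow> bool" where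
  "sde_solution M F W D E x X \<longleftrightarrow>
     adapted_measurable M F {0..} X \<and>
     (AE \<omega> in M. continuous_on {0..} (\<lambda>t. X t \<omega>)) \<and>
     (\<forall>T\<ge>0. (\<integral>\<^sup>+\<omega>. (\<integral>\<^sup>+t\<in>{0..T}. ennreal ((norm (X t \<omega>))\<^sup>2) \<partial>lborel) \<partial>M) < \<infinity>) \<and>
     (\<forall>t\<ge>0. \<exists>I. has_ito_integral M F W (\<lambda>s \<omega>. E *v X s \<omega>) t I \<and>
        (AE \<omega> in M. X t \<omega> = x + (LINT s:{0..t}|lborel. D *v X s \<omega>) + I \<omega>))"

text \<open>
  The solution for a given initial state exists and is unique up to indistinguishability.  To depend
  on neither fact, the definition asks for a solution and speaks about all of them.
\<close>

definition L2_stable ::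
  "'w measure \<Rightarrow> (real \<Rightarrow> 'w measure) \<Rightarrow> (real \<Rightarrow> 'w \<Rightarrow> real) \<Rightarrow> real^'n^'n \<Rightarrow> real^'n^'n \<Rightarrow> bool" where
  "L2_stable M F W D E \<longleftrightarrow> (\<forall>x.
     (\<exists>X. sde_solution M F W D E x X) \<and>
     (\<forall>X. sde_solution M F W D E x X \<longrightarrow>
        (\<integral>\<^sup>+\<omega>. (\<integral>\<^sup>+t\<in>{0..}. ennreal ((norm (X t \<omega>))\<^sup>2) \<partial>lborel) \<partial>M) < \<infinity>))"

text \<open>
  \<open>dX = (A X + B u + C z) dt + z dW\<close> with control \<open>(u, z)\<close>, closed by the feedback \<open>u = G X\<close>,
  \<open>z = K X\<close>.
\<close>

definition stabilizable ::
  "'w measure \<Rightarrow> (real \<Rightarrow> 'w measure) \<Rightarrow> (real \<Rightarrow> 'w \<Rightarrow> real) \<Rightarrow>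
   real^'n^'n \<Rightarrow> real^'m^'n \<Rightarrow> real^'n^'n \<Rightarrow> bool" where
  "stabilizable M F W A B C \<longleftrightarrow>
     (\<exists>(G :: real^'n^'m) (K :: real^'n^'n). L2_stable M F W (A + B ** G + C ** K) K)"

text \<open>\<open>dY = (A Y + C v) dt + v dW\<close> with control \<open>v\<close>, closed by the feedback \<open>v = K Y\<close>.\<close>

definition noise_stabilizable ::
  "'w measure \<Rightarrow> (real \<Rightarrow> 'w measure) \<Rightarrow> (real \<Rightarrow> 'w \<Rightarrow> real) \<Rightarrow> real^'n^'n \<Rightarrow> real^'n^'n \<Rightarrow> bool" where
  "noise_stabilizable M F W A C \<longleftrightarrow>
     (\<exists>K :: real^'n^'n. L2_stable M F W (A + C ** K) K)"

end

theory Submission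
  imports Defs "HOL-Real_Asymp.Real_Asymp"
begin

text \<open>
  Stabilizability is a property of the coefficient matrices alone, and the proof first makes this explicit.
  The equation \<open>dX = D X dt + E X dW\<close> is stable if and only if some positive definite \<open>Q\<close> makes the quadratic
  form \<open>2 (D x \<bullet> Q x) + E x \<bullet> Q E x\<close> negative definite (lemma \<open>L2_stable_iff_lyapunov\<close>). In the closed loop
  \<open>E = K\<close> is free. In terms of \<open>R = Q\<^sup>-\<^sup>1\<close> and \<open>Y = G R\<close> it enters only through a completed square, so the
  system is stabilizable if and only if
  \<open>A R + R A\<^sup>T + B Y + Y\<^sup>T B\<^sup>T - C R C\<^sup>T < 0\<close> for some \<open>R > 0\<close> and some \<open>Y\<close> (lemma \<open>lmi_feasible_iff\<close>).

  For this matrix inequality the equivalence is linear algebra. It is invariant under orthogonal changes of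
  basis. Restricted to vectors supported in the second block it becomes the inequality for the subsystem, because
  the transposed matrices are block triangular the other way and \<open>B\<^sup>T\<close> vanishes there. Conversely, solutions
  \<open>R\<^sub>1\<close> and \<open>R\<^sub>2\<close> for the two diagonal blocks combine to the block diagonal matrix with blocks \<open>c R\<^sub>1\<close> and \<open>R\<^sub>2\<close> for
  large \<open>c\<close>. For the first block a solution always exists: the equation
  \<open>2 \<nu> R + A R + R A\<^sup>T = C R C\<^sup>T + B B\<^sup>T\<close> has a positive semidefinite solution for large \<open>\<nu>\<close>, whose kernel is
  orthogonal to the span of the images of all words and therefore trivial (lemma \<open>lmi_feasible_controllable\<close>).

  The Lyapunov criterion rests on the identity
  \<open>E (X t \<bullet> Q X t) = x \<bullet> Q x + \<integral> E (X s \<bullet> L Q X s) ds\<close> with the generator \<open>L\<close> (lemma \<open>second_moment_identity\<close>). If \<open>L Q\<close>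
  is negative definite, it bounds the energy of every solution. If all solutions have finite energy, letting
  \<open>t\<close> tend to infinity shows that \<open>L\<close> is injective on symmetric matrices, so \<open>L Q = - 1\<close> is solvable, and \<open>x \<bullet> Q x\<close>
  is then the energy of the solution that starts in \<open>x\<close>.

  Stability also asks for a solution from every initial state. It is obtained as the limit of Euler schemes on dyadic
  grids. The fourth moment of the difference of consecutive schemes is of order \<open>1 / 4 ^ n\<close> at each of the
  \<open>O(2 ^ n)\<close> grid points, which is small enough to sum over the grid; so the schemes converge almost surely
  uniformly on compact intervals, with an integrable random constant (lemma \<open>euler_limit_bound\<close>). The limit
  is continuous and adapted, and the integrands of the schemes are simple integrands for it.
\<close>

section \<open>Positive definite matrices\<close>

declare transpose_matrix_vector [simp del]

lemma inner_transpose_left: "(transpose A *v x) \<bullet> y = x \<bullet> (A *v y)"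
  for A :: "real^'n^'m"
  by (simp add: dot_lmul_matrix transpose_matrix_vector)

lemma inner_transpose_right: "x \<bullet> (transpose A *v y) = (A *v x) \<bullet> y"
  for A :: "real^'n^'m"
  by (metis inner_commute inner_transpose_left)

lemma inner_symmetric_matrix:
  fixes Q :: "real^'n^'n"
  assumes "transpose Q = Q"
  shows "x \<bullet> (Q *v y) = y \<bullet> (Q *v x)"
  by (metis assms inner_commute inner_transpose_left)

definition posdef :: "real^'n^'n \<Rightarrow> bool" where
  "posdef Q \<longleftrightarrow> transpose Q = Q \<and> (\<forall>x. x \<noteq> 0 \<longrightarrow> 0 < x \<bullet> (Q *v x))"

lemma posdef_nonneg: "posdef Q \<Longrightarrow> 0 \<le> x \<bullet> (Q *v x)"
  unfolding posdef_def by (cases "x = 0") (auto intro: less_imp_le)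

text \<open>
  Along the line \<open>y + t z\<close> with \<open>z = R y\<close> the form is
  \<open>2 t (z \<bullet> z) + O(t\<^sup>2)\<close>, which is negative for some small negative
  \<open>t\<close> unless \<open>z = 0\<close>.
\<close>

lemma psd_kernel:
  fixes R :: "real^'n^'n"
  assumes sym: "transpose R = R" and psd: "\<And>x. 0 \<le> x \<bullet> (R *v x)"
    and y: "y \<bullet> (R *v y) = 0"
  shows "R *v y = 0"
proof -
  define z where "z = R *v y"
  define a where "a = z \<bullet> z"
  define b where "b = z \<bullet> (R *v z)"
  have b: "0 \<le> b" using psd by (simp add: b_def)
  have "0 \<le> 2 * t * a + t^2 * b" for t
  proof -
    have "0 \<le> (y + t *\<^sub>R z) \<bullet> (R *v (y + t *\<^sub>R z))" by (rule psd)
    also have "\<dots> = 2 * t * a + t^2 * b"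
      using y inner_symmetric_matrix[OF sym, of y z]
      by (simp add: matrix_vector_right_distrib matrix_vector_mult_scaleR inner_add_left inner_add_right
          a_def b_def power2_eq_square z_def[symmetric] algebra_simps)
    finally show ?thesis .
  qed
  from this[of "- a / (b + 1)"] have "0 \<le> 2 * (- a / (b + 1)) * a + (- a / (b + 1))\<^sup>2 * b" .
  also have "\<dots> = (- 2 * a\<^sup>2 * (b + 1) + a\<^sup>2 * b) / (b + 1)\<^sup>2"
    using b by (simp add: power2_eq_square divide_simps) (simp add: algebra_simps)?
  finally have "0 \<le> (- 2 * a\<^sup>2 * (b + 1) + a\<^sup>2 * b) / (b + 1)\<^sup>2" .
  then have "0 \<le> - 2 * a\<^sup>2 * (b + 1) + a\<^sup>2 * b"
    using b by (simp add: zero_le_divide_iff)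
  then have "a\<^sup>2 * (b + 2) \<le> 0" by (simp add: algebra_simps)
  then have "a\<^sup>2 \<le> 0" using b by (smt (verit) mult_nonneg_nonneg mult_le_0_iff zero_le_power2)
  then have "a = 0" by simp
  then show ?thesis by (simp add: a_def z_def)
qed

text \<open>
  By homogeneity the values on the unit sphere decide, and there the maximum is attained.
\<close>

lemma negative_form_uniform:
  fixes f :: "real^'n \<Rightarrow> real"
  assumes cont: "continuous_on UNIV f" and hom: "\<And>r x. f (r *\<^sub>R x) = r\<^sup>2 * f x"
    and neg: "\<And>x. x \<noteq> 0 \<Longrightarrow> f x < 0"
  obtains e where "e > 0" "\<And>x. f x \<le> - e * (norm x)\<^sup>2"
proof -
  have "compact (sphere (0::real^'n) 1)" by simp
  moreover have "sphere (0::real^'n) 1 \<noteq> {}" by simp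
  ultimately obtain u where u: "u \<in> sphere (0::real^'n) 1" "\<And>v. v \<in> sphere 0 1 \<Longrightarrow> f v \<le> f u"
    using continuous_attains_sup[of "sphere (0::real^'n) 1" f] cont continuous_on_subset by (metis subset_UNIV)
  have un: "u \<noteq> 0" using u(1) by auto
  show thesis
  proof
    show "- f u > 0" using neg[OF un] by simp
    fix x
    show "f x \<le> - (- f u) * (norm x)\<^sup>2"
    proof (cases "x = 0")
      case True
      then show ?thesis using hom[of 0 0] by simp
    next
      case False
      then have "f ((1 / norm x) *\<^sub>R x) \<le> f u" by (intro u(2)) simp
      then show ?thesis using False unfolding hom by (simp add: field_simps)
    qed
  qed
qed

lemma posdef_inverse:
  fixes R :: "real^'n^'n"
  assumes "posdef R"
  obtains Q where "posdef Q" "R ** Q = mat 1" "Q ** R = mat 1"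
proof -
  have "invertible R"
  proof (subst invertible_left_inverse, subst matrix_left_invertible_ker, intro allI impI)
    fix x assume "R *v x = 0"
    then show "x = 0" using assms unfolding posdef_def by (metis inner_zero_right less_irrefl)
  qed
  then obtain Q where Q: "R ** Q = mat 1" "Q ** R = mat 1"
    using invertible_def by blast
  have sR: "transpose R = R" using assms by (simp add: posdef_def)
  have "transpose Q ** R = mat 1" using Q(1) sR by (metis matrix_transpose_mul transpose_mat)
  then have sQ: "transpose Q = Q" by (metis Q(1) matrix_mul_assoc matrix_mul_lid matrix_mul_rid)
  have "posdef Q" unfolding posdef_def
  proof (intro conjI allI impI sQ)
    fix x :: "real^'n" assume "x \<noteq> 0"
    have x: "R *v (Q *v x) = x" by (simp add: matrix_vector_mul_assoc Q(1))
    then have "Q *v x \<noteq> 0" using \<open>x \<noteq> 0\<close> by auto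
    then have "0 < (Q *v x) \<bullet> (R *v (Q *v x))" using assms by (simp add: posdef_def)
    then show "0 < x \<bullet> (Q *v x)" by (simp add: x inner_commute)
  qed
  then show ?thesis using Q that by blast
qed

section \<open>A linear matrix inequality for stabilizability\<close>

definition lyapunov_stable :: "real^'n^'n \<Rightarrow> real^'n^'n \<Rightarrow> bool" where
  "lyapunov_stable D E \<longleftrightarrow>
     (\<exists>Q. posdef Q \<and> (\<forall>x. x \<noteq> 0 \<longrightarrow> 2 * ((D *v x) \<bullet> (Q *v x)) + (E *v x) \<bullet> (Q *v (E *v x)) < 0))"

definition lmi_form ::
  "real^'n^'n \<Rightarrow> real^'m^'n \<Rightarrow> real^'n^'n \<Rightarrow> real^'n^'n \<Rightarrow> real^'n^'m \<Rightarrow> real^'n \<Rightarrow> real" where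
  "lmi_form A B C R Y y = 2 * ((transpose A *v y) \<bullet> (R *v y)) + 2 * ((transpose B *v y) \<bullet> (Y *v y))
     - (transpose C *v y) \<bullet> (R *v (transpose C *v y))"

definition lmi_feasible :: "real^'n^'n \<Rightarrow> real^'m^'n \<Rightarrow> real^'n^'n \<Rightarrow> bool" where
  "lmi_feasible A B C \<longleftrightarrow> (\<exists>R Y. posdef R \<and> (\<forall>y. y \<noteq> 0 \<longrightarrow> lmi_form A B C R Y y < 0))"

text \<open>
  With \<open>x = R y\<close> the terms that contain \<open>K\<close> are
  \<open>2 w \<bullet> C\<^sup>T y + w \<bullet> Q w\<close> for \<open>w = K x\<close>; this is the
  square completed here.
\<close>

lemma lyapunov_form_substituted:
  fixes A C K Q R :: "real^'n^'n" and B :: "real^'m^'n" and G :: "real^'n^'m"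
  assumes Q: "posdef Q" "R ** Q = mat 1" "Q ** R = mat 1" and R: "transpose R = R"
  defines "D \<equiv> A + B ** G + C ** K"
  shows "2 * ((D *v (R *v y)) \<bullet> (Q *v (R *v y))) + (K *v (R *v y)) \<bullet> (Q *v (K *v (R *v y)))
     = lmi_form A B C R (G ** R) y
       + (K *v (R *v y) + R *v (transpose C *v y)) \<bullet> (Q *v (K *v (R *v y) + R *v (transpose C *v y)))"
proof -
  have QR: "Q *v (R *v v) = v" for v by (simp add: matrix_vector_mul_assoc Q)
  have sQ: "transpose Q = Q" using Q by (simp add: posdef_def)
  define w where "w = K *v (R *v y)"
  define c where "c = transpose C *v y"
  have D: "D *v (R *v y) = A *v (R *v y) + B *v (G *v (R *v y)) + C *v w"
    by (simp only: D_def matrix_vector_mult_add_rdistrib matrix_vector_mul_assoc[symmetric] w_def)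
  have cross: "w \<bullet> c = (C *v w) \<bullet> y" by (simp add: c_def inner_transpose_right)
  have "(R *v c) \<bullet> (Q *v w) = w \<bullet> c"
    by (metis QR inner_commute inner_symmetric_matrix sQ)
  then have "(w + R *v c) \<bullet> (Q *v (w + R *v c)) = w \<bullet> (Q *v w) + 2 * (w \<bullet> c) + c \<bullet> (R *v c)"
    by (simp add: matrix_vector_right_distrib inner_add_left inner_add_right QR inner_commute)
  then show ?thesis
    unfolding w_def[symmetric] c_def[symmetric]
    unfolding lmi_form_def c_def[symmetric] inner_transpose_left
    by (simp add: QR D inner_add_left cross inner_transpose_left matrix_vector_mul_assoc[symmetric]
        inner_add_right inner_commute[of _ y] del: matrix_vector_mul_assoc)
qed

text \<open>
  With \<open>Q\<close> the Lyapunov matrix and \<open>R\<close> its inverse, the feedback \<open>K\<close> occurs in the Lyapunov inequality only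
  through a completed square, so the best choice is \<open>K = - R C\<^sup>T Q\<close>; what is left is linear in
  \<open>R\<close> and \<open>Y = G R\<close>.
\<close>

lemma lmi_feasible_iff:
  fixes A C :: "real^'n^'n" and B :: "real^'m^'n"
  shows "lmi_feasible A B C \<longleftrightarrow> (\<exists>G K. lyapunov_stable (A + B ** G + C ** K) K)"
proof
  assume "lmi_feasible A B C"
  then obtain R Y where R: "posdef R" and Y: "\<And>y. y \<noteq> 0 \<Longrightarrow> lmi_form A B C R Y y < 0"
    unfolding lmi_feasible_def by blast
  obtain Q where Q: "posdef Q" "R ** Q = mat 1" "Q ** R = mat 1" using posdef_inverse[OF R] .
  have sR: "transpose R = R" using R by (simp add: posdef_def)
  define G where "G = Y ** Q"
  define K where "K = - (R ** transpose C ** Q)"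
  have GR: "G ** R = Y" by (simp add: G_def Q matrix_mul_assoc[symmetric])
  have K: "K *v (R *v y) = - (R *v (transpose C *v y))" for y
  proof -
    have "Q *v (R *v y) = y" by (simp add: matrix_vector_mul_assoc Q)
    then have "(R ** transpose C ** Q) *v (R *v y) = R *v (transpose C *v y)"
      by (simp only: matrix_vector_mul_assoc[symmetric])
    moreover have "(- M) *v v = - (M *v v)" for M :: "real^'n^'n" and v
      by (simp add: matrix_vector_mult_def vec_eq_iff sum_negf)
    ultimately show ?thesis by (simp only: K_def)
  qed
  have "lyapunov_stable (A + B ** G + C ** K) K" unfolding lyapunov_stable_def
  proof (intro exI[of _ Q] conjI Q allI impI)
    fix x :: "real^'n" assume "x \<noteq> 0"
    define y where "y = Q *v x"
    have x: "x = R *v y" by (simp add: y_def matrix_vector_mul_assoc Q)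
    then have "y \<noteq> 0" using \<open>x \<noteq> 0\<close> by auto
    then show "2 * (((A + B ** G + C ** K) *v x) \<bullet> (Q *v x)) + (K *v x) \<bullet> (Q *v (K *v x)) < 0"
      unfolding x lyapunov_form_substituted[OF Q sR] using Y[of y] by (simp add: GR K)
  qed
  then show "\<exists>G K. lyapunov_stable (A + B ** G + C ** K) K" by blast
next
  assume "\<exists>G K. lyapunov_stable (A + B ** G + C ** K) K"
  then obtain G K Q where P: "posdef Q" and neg: "\<And>x. x \<noteq> 0 \<Longrightarrow>
      2 * (((A + B ** G + C ** K) *v x) \<bullet> (Q *v x)) + (K *v x) \<bullet> (Q *v (K *v x)) < 0"
    unfolding lyapunov_stable_def by blast
  obtain R where R: "posdef R" "Q ** R = mat 1" "R ** Q = mat 1" using posdef_inverse[OF P] .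
  have sR: "transpose R = R" using R by (simp add: posdef_def)
  show "lmi_feasible A B C" unfolding lmi_feasible_def
  proof (intro exI[of _ R] exI[of _ "G ** R"] conjI R(1) allI impI)
    fix y :: "real^'n" assume "y \<noteq> 0"
    moreover have "Q *v (R *v y) = y" by (simp add: matrix_vector_mul_assoc R)
    ultimately have "R *v y \<noteq> 0" by (metis matrix_vector_mult_0_right)
    from neg[OF this] show "lmi_form A B C R (G ** R) y < 0"
      unfolding lyapunov_form_substituted[OF P R(3,2) sR]
      using posdef_nonneg[OF P, of "K *v (R *v y) + R *v (transpose C *v y)"] by linarith
  qed
qed

text \<open>
  A change of basis by \<open>P\<close> turns \<open>R\<close> into \<open>P\<^sup>T R P\<close> and
  \<open>Y\<close> into \<open>Y P\<close>.
\<close>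

lemma lmi_feasible_orthogonal:
  fixes A C P :: "real^'n^'n" and B :: "real^'m^'n"
  assumes P: "orthogonal_matrix P" and "lmi_feasible A B C"
  shows "lmi_feasible (transpose P ** A ** P) (transpose P ** B) (transpose P ** C ** P)"
proof -
  obtain R Y where R: "posdef R" and Y: "\<And>y. y \<noteq> 0 \<Longrightarrow> lmi_form A B C R Y y < 0"
    using assms(2) unfolding lmi_feasible_def by blast
  have PT: "transpose P ** P = mat 1" "P ** transpose P = mat 1"
    using P by (simp_all add: orthogonal_matrix_def)
  have P0: "P *v y \<noteq> 0" if "y \<noteq> 0" for y
    using that PT by (metis matrix_vector_mul_assoc matrix_vector_mul_lid matrix_vector_mult_0_right)
  have iso: "(transpose P *v u) \<bullet> (transpose P *v v) = u \<bullet> v" for u v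
    by (simp only: inner_transpose_left matrix_vector_mul_assoc PT matrix_vector_mul_lid)
  have PP: "P *v (transpose P *v v) = v" for v
    by (simp only: matrix_vector_mul_assoc PT matrix_vector_mul_lid)
  have "posdef (transpose P ** R ** P)" unfolding posdef_def
  proof (intro conjI allI impI)
    show "transpose (transpose P ** R ** P) = transpose P ** R ** P"
      using R by (simp add: posdef_def matrix_transpose_mul transpose_transpose matrix_mul_assoc)
    fix y :: "real^'n" assume "y \<noteq> 0"
    from P0[OF this] show "0 < y \<bullet> ((transpose P ** R ** P) *v y)"
      using R unfolding posdef_def
      by (simp add: matrix_vector_mul_assoc[symmetric] inner_transpose_right del: matrix_vector_mul_assoc)
  qed
  moreover have "lmi_form (transpose P ** A ** P) (transpose P ** B) (transpose P ** C ** P)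
      (transpose P ** R ** P) (Y ** P) y = lmi_form A B C R Y (P *v y)" for y
    unfolding lmi_form_def matrix_transpose_mul transpose_transpose
    by (simp only: matrix_vector_mul_assoc[symmetric] iso PP)
  ultimately show ?thesis unfolding lmi_feasible_def using Y P0 by metis
qed

lemma lmi_feasible_orthogonal_iff:
  fixes A C P :: "real^'n^'n" and B :: "real^'m^'n"
  assumes P: "orthogonal_matrix P"
  shows "lmi_feasible (transpose P ** A ** P) (transpose P ** B) (transpose P ** C ** P) \<longleftrightarrow> lmi_feasible A B C"
proof
  assume *: "lmi_feasible (transpose P ** A ** P) (transpose P ** B) (transpose P ** C ** P)"
  have PT: "P ** transpose P = mat 1" using P by (simp_all add: orthogonal_matrix_def)
  have PP: "P ** (transpose P ** M) = M" for M :: "real^'z^'n"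
    by (simp only: matrix_mul_assoc PT matrix_mul_lid)
  have "lmi_feasible (transpose (transpose P) ** (transpose P ** A ** P) ** transpose P)
      (transpose (transpose P) ** (transpose P ** B))
      (transpose (transpose P) ** (transpose P ** C ** P) ** transpose P)"
    using P by (intro lmi_feasible_orthogonal[OF _ *]) (simp add: orthogonal_matrix_def)
  then show "lmi_feasible A B C"
    by (simp only: transpose_transpose matrix_mul_assoc[symmetric] PP PT matrix_mul_rid)
qed (rule lmi_feasible_orthogonal[OF P])


section \<open>Block triangular systems\<close>

definition block_vec :: "real^'k \<Rightarrow> real^'l \<Rightarrow> real^('k::finite + 'l::finite)" where
  "block_vec y z = (\<chi> i. case i of Inl a \<Rightarrow> y $ a | Inr a \<Rightarrow> z $ a)"

lemma sum_UNIV_Plus: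
  fixes f :: "'k::finite + 'l::finite \<Rightarrow> real"
  shows "(\<Sum>i\<in>UNIV. f i) = (\<Sum>a\<in>UNIV. f (Inl a)) + (\<Sum>b\<in>UNIV. f (Inr b))"
  by (simp add: UNIV_Plus_UNIV[symmetric] sum.Plus del: UNIV_Plus_UNIV)

lemma inner_block_vec: "block_vec y z \<bullet> block_vec y' z' = y \<bullet> y' + z \<bullet> z'"
  by (simp add: inner_vec_def sum_UNIV_Plus block_vec_def)

lemma block_vec_cases: obtains y z where "x = block_vec y z"
proof
  show "x = block_vec (\<chi> a. x $ Inl a) (\<chi> b. x $ Inr b)"
    by (simp add: block_vec_def vec_eq_iff split: sum.split)
qed

lemma block_vec_eq_iff: "block_vec y z = block_vec y' z' \<longleftrightarrow> y = y' \<and> z = z'"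
  by (auto simp: block_vec_def vec_eq_iff split: sum.splits)

lemma block_vec_0 [simp]: "block_vec 0 0 = 0"
  by (auto simp: block_vec_def vec_eq_iff split: sum.splits)

lemma block_matrix_mult_vec:
  "block_matrix M11 M12 M21 M22 *v block_vec y z = block_vec (M11 *v y + M12 *v z) (M21 *v y + M22 *v z)"
  by (simp add: vec_eq_iff matrix_vector_mult_def sum_UNIV_Plus block_vec_def block_matrix_def split: sum.split)

lemma transpose_block_matrix:
  "transpose (block_matrix M11 M12 M21 M22)
   = block_matrix (transpose M11) (transpose M21) (transpose M12) (transpose M22)"
  by (simp add: vec_eq_iff transpose_def block_matrix_def split: sum.split)

lemma block_matrix_cases: obtains M11 M12 M21 M22 where "M = block_matrix M11 M12 M21 M22"
proof
  show "M = block_matrix (\<chi> a b. M $ Inl a $ Inl b) (\<chi> a b. M $ Inl a $ Inr b)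
      (\<chi> a b. M $ Inr a $ Inl b) (\<chi> a b. M $ Inr a $ Inr b)"
    by (simp add: block_matrix_def vec_eq_iff split: sum.split)
qed

lemma block_matrix_eq_iff:
  "block_matrix M11 M12 M21 M22 = block_matrix N11 N12 N21 N22
   \<longleftrightarrow> M11 = N11 \<and> M12 = N12 \<and> M21 = N21 \<and> M22 = N22"
  by (auto simp: block_matrix_def vec_eq_iff split: sum.splits)

lemma transpose_block_column_mult_vec:
  "transpose (block_column N1 N2) *v block_vec y z = transpose N1 *v y + transpose N2 *v z"
  by (simp add: vec_eq_iff matrix_vector_mult_def sum_UNIV_Plus block_vec_def block_column_def transpose_def)

lemma transpose_zero [simp]: "transpose (0::real^'n^'m) = 0"
  by (simp add: transpose_def vec_eq_iff)

text \<open>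
  On vectors \<open>(0, z)\<close> the transposed system matrices do not leave the second component and
  \<open>B\<^sup>T\<close> vanishes, so the inequality restricts to the lower right block of
  \<open>R\<close>.
\<close>

lemma lmi_feasible_lower_block:
  fixes A11 C11 :: "real^'k^'k" and A12 C12 :: "real^'l^'k" and A22 C22 :: "real^'l^'l"
    and B1 :: "real^'m^'k"
  assumes "lmi_feasible (block_matrix A11 A12 0 A22) (block_column B1 0) (block_matrix C11 C12 0 C22)"
  shows "lmi_feasible A22 (0::real^'m^'l) C22"
proof -
  obtain R Y where R: "posdef R" and Y: "\<And>y. y \<noteq> 0 \<Longrightarrow>
      lmi_form (block_matrix A11 A12 0 A22) (block_column B1 0) (block_matrix C11 C12 0 C22) R Y y < 0"
    using assms unfolding lmi_feasible_def by blast
  obtain R11 R12 R21 R22 where RR: "R = block_matrix R11 R12 R21 R22" by (rule block_matrix_cases)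
  have "posdef R22" unfolding posdef_def
  proof (intro conjI allI impI)
    show "transpose R22 = R22"
      using R by (simp add: posdef_def RR transpose_block_matrix block_matrix_eq_iff)
    fix z :: "real^'l" assume "z \<noteq> 0"
    then have "block_vec (0::real^'k) z \<noteq> 0" using block_vec_eq_iff[of 0 z 0 0] by auto
    then have "0 < block_vec 0 z \<bullet> (R *v block_vec 0 z)" using R by (simp add: posdef_def)
    then show "0 < z \<bullet> (R22 *v z)" by (simp add: RR block_matrix_mult_vec inner_block_vec)
  qed
  moreover have "lmi_form A22 0 C22 R22 0 z < 0" if "z \<noteq> 0" for z
  proof -
    have "block_vec (0::real^'k) z \<noteq> 0" using that block_vec_eq_iff[of 0 z 0 0] by auto
    from Y[OF this] show ?thesis
      by (simp add: lmi_form_def RR block_matrix_mult_vec inner_block_vec transpose_block_matrix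
          transpose_block_column_mult_vec)
  qed
  ultimately show ?thesis unfolding lmi_feasible_def by blast
qed

lemma lmi_form_uniform:
  assumes "\<And>y. y \<noteq> 0 \<Longrightarrow> lmi_form A B C R Y y < 0"
  obtains e where "e > 0" "\<And>y. lmi_form A B C R Y y \<le> - e * (norm y)\<^sup>2"
proof (rule negative_form_uniform[of "lmi_form A B C R Y"])
  show "continuous_on UNIV (lmi_form A B C R Y)"
    unfolding lmi_form_def
    by (intro continuous_intros bounded_linear.continuous_on[OF matrix_vector_mul_bounded_linear])
  show "lmi_form A B C R Y (r *\<^sub>R x) = r\<^sup>2 * lmi_form A B C R Y x" for r x
    by (simp add: lmi_form_def matrix_vector_mult_scaleR power2_eq_square algebra_simps)
qed (use assms that in auto)

text \<open>
  A block diagonal \<open>R\<close> works once its first block is heavy enough: the coupling terms are bilinear in the two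
  components, hence dominated by a large multiple of the first diagonal form plus the second one.
\<close>

lemma lmi_feasible_block_triangular:
  fixes A11 C11 :: "real^'k^'k" and A12 C12 :: "real^'l^'k" and A22 C22 :: "real^'l^'l"
    and B1 :: "real^'m^'k"
  assumes "lmi_feasible A11 B1 C11" "lmi_feasible A22 (0::real^'m^'l) C22"
  shows "lmi_feasible (block_matrix A11 A12 0 A22) (block_column B1 0) (block_matrix C11 C12 0 C22)"
proof -
  obtain R1 Y1 where R1: "posdef R1" and Y1: "\<And>y. y \<noteq> 0 \<Longrightarrow> lmi_form A11 B1 C11 R1 Y1 y < 0"
    using assms(1) unfolding lmi_feasible_def by blast
  obtain R2 Y2 where R2: "posdef R2" and Y2: "\<And>y. y \<noteq> 0 \<Longrightarrow> lmi_form A22 (0::real^'m^'l) C22 R2 Y2 y < 0"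
    using assms(2) unfolding lmi_feasible_def by blast
  obtain e1 where e1: "e1 > 0" "\<And>y. lmi_form A11 B1 C11 R1 Y1 y \<le> - e1 * (norm y)\<^sup>2"
    using lmi_form_uniform[OF Y1] by blast
  obtain e2 where e2: "e2 > 0" "\<And>y. lmi_form A22 (0::real^'m^'l) C22 R2 Y2 y \<le> - e2 * (norm y)\<^sup>2"
    using lmi_form_uniform[OF Y2] by blast
  define N where "N = A12 ** R2 - C12 ** R2 ** transpose C22"
  obtain \<beta> where \<beta>: "\<beta> > 0" "\<And>z. norm (N *v z) \<le> norm z * \<beta>"
    using bounded_linear.pos_bounded[OF matrix_vector_mul_bounded_linear[of N]] by blast
  define c where "c = \<beta>\<^sup>2 / (e1 * e2) + 1"
  have c: "c > 0" "c * e1 * e2 > \<beta>\<^sup>2"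
    using e1 e2 by (auto simp: c_def field_simps add_pos_nonneg)
  define R where "R = block_matrix (c *\<^sub>R R1) 0 0 R2"
  define Y :: "real^('k + 'l)^'m" where "Y = (\<chi> i j. case j of Inl a \<Rightarrow> (c *\<^sub>R Y1) $ i $ a | Inr b \<Rightarrow> 0)"
  have Yv: "Y *v block_vec y z = c *\<^sub>R (Y1 *v y)" for y z
    by (simp add: vec_eq_iff matrix_vector_mult_def sum_UNIV_Plus block_vec_def Y_def sum_distrib_left algebra_simps)
  have cv: "(c *\<^sub>R R1) *v y = c *\<^sub>R (R1 *v y)" for y
    by (rule scaleR_matrix_vector_assoc[symmetric])
  have pos: "c * a\<^sup>2 * e1 + b\<^sup>2 * e2 - 2 * a * b * \<beta> > 0" if "a \<ge> 0" "b \<ge> 0" "a \<noteq> 0 \<or> b \<noteq> 0" for a b :: real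
  proof (cases "a = 0")
    case True
    then show ?thesis using that e2 by simp
  next
    case False
    have "0 < (c * e1 * e2 - \<beta>\<^sup>2) * a\<^sup>2 + (b * e2 - a * \<beta>)\<^sup>2"
      using c False by (intro add_pos_nonneg mult_pos_pos) auto
    also have "\<dots> = e2 * (c * a\<^sup>2 * e1 + b\<^sup>2 * e2 - 2 * a * b * \<beta>)"
      by (simp add: power2_eq_square algebra_simps)
    finally show ?thesis using e2 by (simp add: zero_less_mult_iff)
  qed
  show ?thesis unfolding lmi_feasible_def
  proof (intro exI[of _ R] exI[of _ Y] conjI allI impI)
    show "posdef R" unfolding posdef_def
    proof (intro conjI allI impI)
      show "transpose R = R"
        using R1 R2 by (simp add: R_def posdef_def transpose_block_matrix transpose_scalar)
      fix x :: "real^('k + 'l)" assume x: "x \<noteq> 0"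
      obtain y z where yz: "x = block_vec y z" by (rule block_vec_cases)
      have "0 \<le> y \<bullet> (R1 *v y)" "0 \<le> z \<bullet> (R2 *v z)" "y \<noteq> 0 \<Longrightarrow> 0 < y \<bullet> (R1 *v y)" "z \<noteq> 0 \<Longrightarrow> 0 < z \<bullet> (R2 *v z)"
        using R1 R2 by (auto simp: posdef_nonneg) (auto simp: posdef_def)
      moreover have "y \<noteq> 0 \<or> z \<noteq> 0" using x yz by auto
      ultimately show "0 < x \<bullet> (R *v x)"
        using c(1) by (auto simp: R_def yz block_matrix_mult_vec inner_block_vec cv intro: add_pos_nonneg add_nonneg_pos)
    qed
    fix x :: "real^('k + 'l)" assume x: "x \<noteq> 0"
    obtain y z where yz: "x = block_vec y z" by (rule block_vec_cases)
    have nz: "norm y \<noteq> 0 \<or> norm z \<noteq> 0" using x yz by auto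
    have sym2: "u \<bullet> (R2 *v v) = v \<bullet> (R2 *v u)" for u v
      using inner_symmetric_matrix R2 by (auto simp: posdef_def)
    let ?p = "transpose C12 *v y"
    let ?q = "transpose C22 *v z"
    have Nz: "y \<bullet> (N *v z) = (transpose A12 *v y) \<bullet> (R2 *v z) - ?p \<bullet> (R2 *v ?q)"
      by (simp add: N_def matrix_vector_mult_diff_rdistrib inner_diff_right matrix_vector_mul_assoc[symmetric]
          inner_transpose_left del: matrix_vector_mul_assoc)
    have "lmi_form (block_matrix A11 A12 0 A22) (block_column B1 0) (block_matrix C11 C12 0 C22) R Y x
      = c * lmi_form A11 B1 C11 R1 Y1 y + lmi_form A22 (0::real^'m^'l) C22 R2 Y2 z
        + 2 * (y \<bullet> (N *v z)) - ?p \<bullet> (R2 *v ?p)"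
      unfolding Nz lmi_form_def yz R_def
      by (simp add: block_matrix_mult_vec inner_block_vec transpose_block_matrix cv
          transpose_block_column_mult_vec Yv inner_add_left inner_add_right matrix_vector_right_distrib
          sym2[of ?q ?p] algebra_simps)
    also have "\<dots> \<le> c * (- e1 * (norm y)\<^sup>2) + - e2 * (norm z)\<^sup>2 + 2 * (norm y * (norm z * \<beta>))"
    proof -
      have "y \<bullet> (N *v z) \<le> norm y * norm (N *v z)" by (rule norm_cauchy_schwarz)
      also have "\<dots> \<le> norm y * (norm z * \<beta>)" by (intro mult_left_mono \<beta>) auto
      finally have 1: "y \<bullet> (N *v z) \<le> norm y * (norm z * \<beta>)" .
      have 2: "c * lmi_form A11 B1 C11 R1 Y1 y \<le> c * (- e1 * (norm y)\<^sup>2)"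
        using c e1 by (intro mult_left_mono) auto
      show ?thesis using 1 2 e2(2)[of z] posdef_nonneg[OF R2, of ?p] by linarith
    qed
    also have "\<dots> < 0" using pos[of "norm y" "norm z"] nz by (simp add: algebra_simps)
    finally show "lmi_form (block_matrix A11 A12 0 A22) (block_column B1 0) (block_matrix C11 C12 0 C22) R Y x < 0" .
  qed
qed

section \<open>Controllable pairs are stabilizable\<close>

lemma matrix_mult_norm_bound:
  obtains K where "K > 0" "\<And>(X :: real^'n^'n) (Y :: real^'n^'n). norm (X ** Y) \<le> norm X * norm Y * K"
proof -
  have "bilinear (\<lambda>(X :: real^'n^'n) (Y :: real^'n^'n). X ** Y)"
    unfolding bilinear_def
    by (auto intro!: linearI simp: matrix_matrix_mult_def vec_eq_iff sum.distrib sum_distrib_left algebra_simps)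
  then have "bounded_bilinear (\<lambda>(X :: real^'n^'n) (Y :: real^'n^'n). X ** Y)" by (simp add: bilinear_conv_bounded_bilinear)
  from bounded_bilinear.pos_bounded[OF this] show thesis using that by blast
qed


lemma matrix_add_rdistrib: "(B + C) ** A = B ** A + (C :: real^'n^'n) ** A"
  by (simp add: matrix_matrix_mult_def vec_eq_iff sum.distrib algebra_simps)

lemma matrix_diff_ldistrib: "A ** (B - C) = A ** B - A ** (C :: real^'n^'n)"
  by (simp add: matrix_matrix_mult_def vec_eq_iff sum_subtractf algebra_simps)

lemma matrix_diff_rdistrib: "(B - C) ** A = B ** A - (C :: real^'n^'n) ** A"
  by (simp add: matrix_matrix_mult_def vec_eq_iff sum_subtractf algebra_simps)

lemma norm_transpose: "norm (transpose A) = norm (A :: real^'n^'n)"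
proof -
  have "(norm (transpose A))\<^sup>2 = (\<Sum>i\<in>UNIV. \<Sum>j\<in>UNIV. (A $ j $ i)\<^sup>2)"
    unfolding power2_norm_eq_inner by (simp add: inner_vec_def transpose_def power2_eq_square)
  also have "\<dots> = (\<Sum>j\<in>UNIV. \<Sum>i\<in>UNIV. (A $ j $ i)\<^sup>2)" by (rule sum.swap)
  also have "\<dots> = (norm A)\<^sup>2"
    unfolding power2_norm_eq_inner by (simp add: inner_vec_def power2_eq_square)
  finally show ?thesis by simp
qed

text \<open>
  Multiplied by \<open>2 \<nu>\<close> the equation reads
  \<open>(2 \<nu> + A) R (2 \<nu> + A)\<^sup>T = A R A\<^sup>T + 2 \<nu> (C R C\<^sup>T + S)\<close>. For
  large \<open>\<nu>\<close> the matrix \<open>2 \<nu> + A\<close> is invertible with an inverse of order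
  \<open>1 / \<nu>\<close>, and dividing by it on both sides gives a fixed point equation for a
  contraction that maps the closed cone of positive semidefinite matrices to itself. In this form (a
  Cayley transform) positivity is visible, which it is not in the equation itself.
\<close>

lemma shifted_lyapunov_equation:
  fixes A C S :: "real^'n^'n"
  assumes S: "transpose S = S" "\<And>x. 0 \<le> x \<bullet> (S *v x)"
  obtains \<nu> R where "\<nu> > 0" "transpose R = R" "\<And>x. 0 \<le> x \<bullet> (R *v x)"
    "(2 * \<nu>) *\<^sub>R R + A ** R + R ** transpose A = C ** R ** transpose C + S"
proof -
  obtain K where K: "K > 0" "\<And>(X :: real^'n^'n) (Y :: real^'n^'n). norm (X ** Y) \<le> norm X * norm Y * K"
    using matrix_mult_norm_bound by blast
  define a where "a = norm A"
  define c where "c = norm C"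
  define j where "j = norm (mat 1 :: real^'n^'n)"
  have nn: "a \<ge> 0" "c \<ge> 0" "j \<ge> 0" by (auto simp: a_def c_def j_def)
  have "((\<lambda>\<nu>. (j / (2 * \<nu> - K * a))\<^sup>2 * (a\<^sup>2 + 2 * \<nu> * c\<^sup>2) * K ^ 4) \<longlongrightarrow> 0) at_top"
  proof -
    have 1: "((\<lambda>\<nu>. 1 / (2 * \<nu> - K * a)\<^sup>2) \<longlongrightarrow> 0) at_top" by real_asymp
    have 2: "((\<lambda>\<nu>. \<nu> / (2 * \<nu> - K * a)\<^sup>2) \<longlongrightarrow> 0) at_top" by real_asymp
    have "((\<lambda>\<nu>. j\<^sup>2 * a\<^sup>2 * K ^ 4 * (1 / (2 * \<nu> - K * a)\<^sup>2) + 2 * j\<^sup>2 * c\<^sup>2 * K ^ 4 * (\<nu> / (2 * \<nu> - K * a)\<^sup>2))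
        \<longlongrightarrow> j\<^sup>2 * a\<^sup>2 * K ^ 4 * 0 + 2 * j\<^sup>2 * c\<^sup>2 * K ^ 4 * 0) at_top"
      by (intro tendsto_intros 1 2)
    then show ?thesis by (simp add: power_divide add_divide_distrib algebra_simps)
  qed
  then have "eventually (\<lambda>\<nu>. (j / (2 * \<nu> - K * a))\<^sup>2 * (a\<^sup>2 + 2 * \<nu> * c\<^sup>2) * K ^ 4 < 1/2) at_top"
    by (rule order_tendstoD) simp
  moreover have "eventually (\<lambda>\<nu>::real. \<nu> > max 0 (K * a)) at_top" by (rule eventually_gt_at_top)
  ultimately have "eventually (\<lambda>\<nu>. (j / (2 * \<nu> - K * a))\<^sup>2 * (a\<^sup>2 + 2 * \<nu> * c\<^sup>2) * K ^ 4 < 1/2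
      \<and> \<nu> > max 0 (K * a)) at_top" by (rule eventually_conj)
  from eventually_happens[OF this]
  obtain \<nu> where \<nu>: "(j / (2 * \<nu> - K * a))\<^sup>2 * (a\<^sup>2 + 2 * \<nu> * c\<^sup>2) * K ^ 4 < 1/2" "\<nu> > 0" "\<nu> > K * a"
    unfolding max_less_iff_conj by (auto simp only: trivial_limit_at_top_linorder)
  define L where "L = (2 * \<nu>) *\<^sub>R mat 1 + A"
  have "invertible L"
  proof (subst invertible_left_inverse, subst matrix_left_invertible_ker, intro allI impI)
    fix x assume "L *v x = 0"
    then have Ax: "(2 * \<nu>) *\<^sub>R x = - (A *v x)"
      by (simp add: L_def matrix_vector_mult_add_rdistrib scaleR_matrix_vector_assoc[symmetric] eq_neg_iff_add_eq_0)
    define X :: "real^'n^'n" where "X = (\<chi> i j. x $ i)"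
    have "(2 * \<nu>) *\<^sub>R X = - (A ** X)"
      using Ax by (simp add: vec_eq_iff matrix_matrix_mult_def matrix_vector_mult_def X_def)
    then have "(2 * \<nu>) * norm X = norm (A ** X)"
      by - (drule arg_cong[where f = norm], use \<nu>(2) in simp)
    also have "\<dots> \<le> a * norm X * K" using K(2)[of A X] by (simp add: a_def)
    finally have "(2 * \<nu> - a * K) * norm X \<le> 0" by (simp add: algebra_simps)
    moreover have "2 * \<nu> - a * K > 0" using \<nu> by (simp add: algebra_simps)
    ultimately have "norm X \<le> 0" by (simp add: mult_le_0_iff)
    then have "X = 0" by simp
    then show "x = 0" by (simp add: vec_eq_iff X_def)
  qed
  then obtain T where T: "L ** T = mat 1" "T ** L = mat 1" using invertible_def by blast
  have nT: "norm T \<le> j / (2 * \<nu> - K * a)"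
  proof -
    have "(2 * \<nu>) *\<^sub>R T = mat 1 - A ** T"
      using T(1) by (simp add: L_def matrix_add_rdistrib scalar_matrix_assoc[symmetric] eq_diff_eq)
    then have "(2 * \<nu>) * norm T = norm (mat 1 - A ** T)"
      by - (drule arg_cong[where f = norm], use \<nu>(2) in simp)
    also have "\<dots> \<le> j + a * norm T * K" using norm_triangle_ineq4[of "mat 1" "A ** T"] K(2)[of A T]
      by (simp add: a_def j_def)
    finally have "norm T * (2 * \<nu> - K * a) \<le> j" by (simp add: algebra_simps)
    moreover have "2 * \<nu> - K * a > 0" using \<nu> by (simp add: algebra_simps)
    ultimately show ?thesis by (simp add: pos_le_divide_eq)
  qed
  define G where "G X = A ** X ** transpose A + (2 * \<nu>) *\<^sub>R (C ** X ** transpose C)" for X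
  define \<Psi> where "\<Psi> X = T ** (G X + (2 * \<nu>) *\<^sub>R S) ** transpose T" for X
  define PSD where "PSD = {X :: real^'n^'n. transpose X = X \<and> (\<forall>x. 0 \<le> x \<bullet> (X *v x))}"
  have n3: "norm (Y ** X ** transpose Y) \<le> (norm Y)\<^sup>2 * norm X * K\<^sup>2" for X Y :: "real^'n^'n"
  proof -
    have "norm (Y ** X ** transpose Y) \<le> norm (Y ** X) * norm (transpose Y) * K" by (rule K)
    also have "\<dots> \<le> (norm Y * norm X * K) * norm Y * K"
      using K unfolding norm_transpose by (intro mult_right_mono) auto
    finally show ?thesis by (simp add: power2_eq_square algebra_simps)
  qed
  have lin: "\<Psi> X - \<Psi> Y = T ** G (X - Y) ** transpose T" for X Y
    by (simp add: \<Psi>_def G_def matrix_diff_ldistrib matrix_diff_rdistrib matrix_add_ldistrib matrix_add_rdistrib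
        algebra_simps)
  have nG: "norm (G X) \<le> (a\<^sup>2 + 2 * \<nu> * c\<^sup>2) * norm X * K\<^sup>2" for X
  proof -
    have "norm (G X) \<le> norm (A ** X ** transpose A) + (2 * \<nu>) * norm (C ** X ** transpose C)"
      unfolding G_def using \<nu> norm_triangle_ineq[of "A ** X ** transpose A" "(2 * \<nu>) *\<^sub>R (C ** X ** transpose C)"] by simp
    also have "\<dots> \<le> a\<^sup>2 * norm X * K\<^sup>2 + (2 * \<nu>) * (c\<^sup>2 * norm X * K\<^sup>2)"
      using \<nu> unfolding a_def c_def by (intro add_mono mult_left_mono n3) auto
    finally show ?thesis by (simp add: algebra_simps)
  qed
  have contr: "dist (\<Psi> X) (\<Psi> Y) \<le> 1/2 * dist X Y" for X Y
  proof -
    have "dist (\<Psi> X) (\<Psi> Y) = norm (T ** G (X - Y) ** transpose T)" by (simp add: dist_norm lin)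
    also have "\<dots> \<le> (norm T)\<^sup>2 * norm (G (X - Y)) * K\<^sup>2" by (rule n3)
    also have "\<dots> \<le> (j / (2 * \<nu> - K * a))\<^sup>2 * ((a\<^sup>2 + 2 * \<nu> * c\<^sup>2) * norm (X - Y) * K\<^sup>2) * K\<^sup>2"
      using nT by (intro mult_right_mono mult_mono nG power_mono) auto
    also have "\<dots> = ((j / (2 * \<nu> - K * a))\<^sup>2 * (a\<^sup>2 + 2 * \<nu> * c\<^sup>2) * K ^ 4) * dist X Y"
      by (simp add: dist_norm power2_eq_square power4_eq_xxxx algebra_simps)
    also have "\<dots> \<le> 1/2 * dist X Y" using \<nu> by (intro mult_right_mono) auto
    finally show ?thesis .
  qed
  have conj_psd: "Y ** X ** transpose Y \<in> PSD" if "X \<in> PSD" for X Y :: "real^'n^'n"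
  proof -
    have "x \<bullet> (Y ** X ** transpose Y *v x) = (transpose Y *v x) \<bullet> (X *v (transpose Y *v x))" for x
      by (simp add: matrix_vector_mul_assoc[symmetric] inner_transpose_left del: matrix_vector_mul_assoc)
    then show ?thesis
      using that by (simp add: PSD_def matrix_transpose_mul transpose_transpose matrix_mul_assoc)
  qed
  have add_psd: "X + Y \<in> PSD" if "X \<in> PSD" "Y \<in> PSD" for X Y
    using that unfolding PSD_def
    by (auto simp: matrix_vector_mult_add_rdistrib inner_add_right transpose_def vec_eq_iff)
  have scale_psd: "r *\<^sub>R X \<in> PSD" if "X \<in> PSD" "r \<ge> 0" for X r
    using that unfolding PSD_def
    by (auto simp: scaleR_matrix_vector_assoc[symmetric] transpose_scalar)
  have SP: "S \<in> PSD" using S by (simp add: PSD_def)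
  have sub: "\<Psi> ` PSD \<subseteq> PSD"
    unfolding \<Psi>_def G_def using \<nu> SP by (auto intro!: conj_psd add_psd scale_psd)
  have "closed PSD"
  proof -
    have ct: "continuous_on UNIV (\<lambda>X::real^'n^'n. transpose X)"
      unfolding transpose_def by (intro continuous_intros)
    have cq: "continuous_on UNIV (\<lambda>X::real^'n^'n. x \<bullet> (X *v x))" for x
      unfolding matrix_vector_mult_def inner_vec_def by (intro continuous_intros)
    have eq: "PSD = {X. transpose X = X} \<inter> (\<Inter>x. {X. 0 \<le> x \<bullet> (X *v x)})" by (auto simp: PSD_def)
    show ?thesis unfolding eq
      by (intro closed_Int closed_INT ballI closed_Collect_eq closed_Collect_le ct cq continuous_intros)
  qed
  note cPSD = \<open>closed PSD\<close>[folded complete_eq_closed]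
  then have "\<exists>!R. R \<in> PSD \<and> \<Psi> R = R"
    using SP sub contr cPSD by (intro Banach_fix[of PSD "1/2"]) auto
  then obtain R where R: "R \<in> PSD" "\<Psi> R = R" by blast
  have "L ** R ** transpose L = G R + (2 * \<nu>) *\<^sub>R S"
  proof -
    have "L ** R ** transpose L = (L ** T) ** (G R + (2 * \<nu>) *\<^sub>R S) ** transpose (L ** T)"
      by (subst R(2)[symmetric]) (simp add: \<Psi>_def matrix_transpose_mul matrix_mul_assoc)
    then show ?thesis by (simp add: T transpose_mat)
  qed
  moreover have "L ** R ** transpose L
      = (2 * \<nu>) *\<^sub>R ((2 * \<nu>) *\<^sub>R R + A ** R + R ** transpose A) + A ** R ** transpose A"
  proof -
    have tL: "transpose L = (2 * \<nu>) *\<^sub>R mat 1 + transpose A"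
      by (simp add: L_def transpose_def vec_eq_iff mat_def)
    show ?thesis unfolding tL unfolding L_def
      by (simp add: matrix_add_ldistrib matrix_add_rdistrib scalar_matrix_assoc[symmetric] matrix_scalar_ac
          algebra_simps)
  qed
  ultimately have "(2 * \<nu>) *\<^sub>R ((2 * \<nu>) *\<^sub>R R + A ** R + R ** transpose A) = (2 * \<nu>) *\<^sub>R (C ** R ** transpose C + S)"
    by (simp add: G_def algebra_simps)
  then have "(2 * \<nu>) *\<^sub>R R + A ** R + R ** transpose A = C ** R ** transpose C + S"
    using \<nu> by (metis mult_eq_0_iff less_irrefl scaleR_left_imp_eq zero_neq_numeral)
  then show thesis using that[of \<nu> R] R \<nu> by (auto simp: PSD_def)
qed

text \<open>
  Take \<open>R\<close> from the shifted Lyapunov equation with \<open>S = B B\<^sup>T\<close>, the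
  analogue of a reachability Gramian. If \<open>R x = 0\<close>, the equation, tested with
  \<open>x\<close>, shows that \<open>B\<^sup>T x = 0\<close> and that \<open>R\<close> also annihilates
  \<open>A\<^sup>T x\<close> and \<open>C\<^sup>T x\<close>. Hence \<open>x\<close> is orthogonal to the
  images of all words, and \<open>R\<close> is positive definite. With \<open>Y = - B\<^sup>T / 2\<close>
  the form of the matrix inequality equals \<open>- 2 \<nu> (y \<bullet> R y)\<close>.
\<close>

lemma lmi_feasible_controllable:
  fixes A C :: "real^'n^'n" and B :: "real^'m^'n"
  assumes full: "word_span j A C B = UNIV"
  shows "lmi_feasible A B C"
proof -
  define S where "S = B ** transpose B"
  have S: "transpose S = S" "\<And>x. x \<bullet> (S *v x) = (transpose B *v x) \<bullet> (transpose B *v x)"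
    by (simp_all add: S_def matrix_transpose_mul transpose_transpose matrix_vector_mul_assoc[symmetric]
        inner_transpose_left del: matrix_vector_mul_assoc)
  then have S': "\<And>x. 0 \<le> x \<bullet> (S *v x)" by simp
  obtain \<nu> R where \<nu>: "\<nu> > 0" and R: "transpose R = R" "\<And>x. 0 \<le> x \<bullet> (R *v x)"
    and eq: "(2 * \<nu>) *\<^sub>R R + A ** R + R ** transpose A = C ** R ** transpose C + S"
    using shifted_lyapunov_equation[OF S(1) S', where A = A and C = C] by blast
  have eqv: "(2 * \<nu>) *\<^sub>R (R *v x) + A *v (R *v x) + R *v (transpose A *v x)
      = C *v (R *v (transpose C *v x)) + S *v x" for x
    using arg_cong[OF eq, of "\<lambda>M. M *v x"]
    by (simp add: matrix_vector_mult_add_rdistrib matrix_vector_mul_assoc[symmetric]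
        scaleR_matrix_vector_assoc[symmetric] del: matrix_vector_mul_assoc)
  have form: "2 * \<nu> * (x \<bullet> (R *v x)) + 2 * ((transpose A *v x) \<bullet> (R *v x))
      = (transpose C *v x) \<bullet> (R *v (transpose C *v x)) + (transpose B *v x) \<bullet> (transpose B *v x)" for x
  proof -
    have "x \<bullet> (R *v (transpose A *v x)) = (transpose A *v x) \<bullet> (R *v x)"
      using inner_symmetric_matrix[OF R(1)] by blast
    then show ?thesis
      using arg_cong[OF eqv[of x], of "\<lambda>v. x \<bullet> v"] S(2)[of x] by (simp add: inner_add_right inner_transpose_left)
  qed
  \<comment> \<open>The kernel of \<open>R\<close> is orthogonal to everything that the words can reach.\<close>
  have inv: "R *v (transpose C *v x) = 0 \<and> transpose B *v x = 0 \<and> R *v (transpose A *v x) = 0"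
    if "R *v x = 0" for x
  proof -
    have "(transpose C *v x) \<bullet> (R *v (transpose C *v x)) + (transpose B *v x) \<bullet> (transpose B *v x) = 0"
      using form[of x] that by simp
    then have 1: "(transpose C *v x) \<bullet> (R *v (transpose C *v x)) = 0" "(transpose B *v x) \<bullet> (transpose B *v x) = 0"
      using R(2)[of "transpose C *v x"] inner_ge_zero[of "transpose B *v x"] by linarith+
    have C0: "R *v (transpose C *v x) = 0" by (rule psd_kernel[OF R 1(1)])
    have B0: "transpose B *v x = 0" using 1(2) by simp
    have "S *v x = 0" using B0 by (simp add: S_def matrix_vector_mul_assoc[symmetric] del: matrix_vector_mul_assoc)
    then show ?thesis using eqv[of x] that C0 B0 by simp
  qed
  have word0: "transpose (foldr (**) Xs (mat 1) ** B) *v x = 0" if "set Xs \<subseteq> {A, C}" "R *v x = 0" for Xs x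
    using that
  proof (induction Xs arbitrary: x)
    case Nil
    then show ?case using inv by simp
  next
    case (Cons X Xs)
    have "R *v (transpose X *v x) = 0" using Cons.prems inv by auto
    then have "transpose (foldr (**) Xs (mat 1) ** B) *v (transpose X *v x) = 0"
      using Cons.IH Cons.prems by simp
    then show ?case by (simp add: matrix_transpose_mul matrix_vector_mul_assoc matrix_mul_assoc)
  qed
  have "posdef R" unfolding posdef_def
  proof (intro conjI allI impI R(1))
    fix x :: "real^'n" assume "x \<noteq> 0"
    have "R *v x \<noteq> 0"
    proof
      assume Rx: "R *v x = 0"
      have "x \<bullet> v = 0" if "v \<in> word_span j A C B" for v
        using that unfolding word_span_def
      proof (induction rule: span_induct)
        case base
        show ?case by (simp add: subspace_def inner_add_right)
      next
        case (step v)
        then obtain Xs u where "set Xs \<subseteq> {A, C}" and v: "v = (foldr (**) Xs (mat 1) ** B) *v u"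
          unfolding words_def by auto
        then have "transpose (foldr (**) Xs (mat 1) ** B) *v x = 0" using Rx word0 by blast
        then show ?case unfolding v by (metis inner_transpose_left inner_zero_left)
      qed
      then have "x \<bullet> x = 0" using full by blast
      then show False using \<open>x \<noteq> 0\<close> by simp
    qed
    then have "x \<bullet> (R *v x) \<noteq> 0" using psd_kernel[OF R] by blast
    then show "0 < x \<bullet> (R *v x)" using R(2)[of x] by linarith
  qed
  moreover have "lmi_form A B C R (- (1/2) *\<^sub>R transpose B) y < 0" if "y \<noteq> 0" for y
  proof -
    have "(- (1/2) *\<^sub>R transpose B) *v y = - (1/2) *\<^sub>R (transpose B *v y)"
      by (rule scaleR_matrix_vector_assoc[symmetric])
    then have "lmi_form A B C R (- (1/2) *\<^sub>R transpose B) y = - (2 * \<nu> * (y \<bullet> (R *v y)))"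
      using form[of y] by (simp add: lmi_form_def)
    moreover have "0 < 2 * \<nu> * (y \<bullet> (R *v y))"
      using \<nu> \<open>posdef R\<close> that by (simp add: posdef_def)
    ultimately show ?thesis by linarith
  qed
  ultimately show ?thesis unfolding lmi_feasible_def by blast
qed

text \<open>
  The first block is controllable, so its inequality costs nothing, and the whole system is feasible as
  soon as the second block is; the converse is the restriction to vectors supported in the second block.
\<close>

lemma lmi_feasible_decomposition:
  fixes A C P :: "real^('k::finite + 'l::finite)^('k + 'l)" and B :: "real^'m::finite^('k + 'l)"
  assumes "orthogonal_matrix P"
    and "transpose P ** A ** P = block_matrix A11 A12 0 A22"
    and "transpose P ** C ** P = block_matrix C11 C12 0 C22"
    and "transpose P ** B = block_column B1 0"
    and "dim (word_span j A11 C11 B1) = CARD('k)"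
  shows "lmi_feasible A B C \<longleftrightarrow> lmi_feasible A22 (0::real^'m^'l) C22"
proof -
  have "word_span j A11 C11 B1 = UNIV"
  proof -
    have "dim (word_span j A11 C11 B1) = DIM(real^'k)" using assms(5) by simp
    then have "span (word_span j A11 C11 B1) = UNIV" using dim_eq_full by blast
    then show ?thesis by (simp add: word_span_def span_span)
  qed
  then have "lmi_feasible A11 B1 C11" by (rule lmi_feasible_controllable)
  then have "lmi_feasible A22 (0::real^'m^'l) C22 \<longleftrightarrow>
      lmi_feasible (block_matrix A11 A12 0 A22) (block_column B1 0) (block_matrix C11 C12 0 C22)"
    using lmi_feasible_block_triangular lmi_feasible_lower_block by blast
  also have "\<dots> \<longleftrightarrow> lmi_feasible A B C"
    using lmi_feasible_orthogonal_iff[OF assms(1), of A B C] assms(2-4) by simp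
  finally show ?thesis by simp
qed

section \<open>Square integrable functions\<close>

definition square_integrable :: "'a measure \<Rightarrow> ('a \<Rightarrow> 'b::euclidean_space) \<Rightarrow> bool" where
  "square_integrable N f \<longleftrightarrow> f \<in> borel_measurable N \<and> integrable N (\<lambda>x. (norm (f x))\<^sup>2)"

lemma square_integrable_measurable: "square_integrable N f \<Longrightarrow> f \<in> borel_measurable N"
  by (simp add: square_integrable_def)

lemma square_integrable_iff_nn:
  assumes "f \<in> borel_measurable N"
  shows "square_integrable N f \<longleftrightarrow> (\<integral>\<^sup>+x. ennreal ((norm (f x))\<^sup>2) \<partial>N) < \<infinity>"
  using assms by (auto simp: square_integrable_def integrable_iff_bounded)

lemma square_integrable_bilinear:
  assumes h: "bounded_bilinear h" and f: "square_integrable N f" and g: "square_integrable N g"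
  shows "integrable N (\<lambda>x. (h (f x) (g x)) :: real)"
proof -
  obtain K where K: "K > 0" "\<And>x y. norm (h x y) \<le> norm x * norm y * K"
    using bounded_bilinear.pos_bounded[OF h] by blast
  show ?thesis
  proof (rule Bochner_Integration.integrable_bound)
    show "integrable N (\<lambda>x. K * ((norm (f x))\<^sup>2 + (norm (g x))\<^sup>2))"
      using f g by (auto simp: square_integrable_def)
    show "(\<lambda>x. h (f x) (g x)) \<in> borel_measurable N"
    proof -
      have "continuous_on UNIV (\<lambda>p. h (fst p) (snd p))"
        by (intro bounded_bilinear.continuous_on[OF h] continuous_intros)
      then have m: "(\<lambda>p. h (fst p) (snd p)) \<in> borel_measurable borel" by (rule borel_measurable_continuous_onI)
      have "(\<lambda>x. (f x, g x)) \<in> borel_measurable N"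
        using f g by (auto simp: square_integrable_def intro: borel_measurable_Pair)
      from measurable_compose[OF this m] show ?thesis by simp
    qed
    show "AE x in N. norm (h (f x) (g x)) \<le> norm (K * ((norm (f x))\<^sup>2 + (norm (g x))\<^sup>2))"
    proof (rule AE_I2)
      fix x
      have "norm (f x) * norm (g x) \<le> (norm (f x))\<^sup>2 + (norm (g x))\<^sup>2"
        using sum_squares_bound[of "norm (f x)" "norm (g x)"]
          mult_nonneg_nonneg[OF norm_ge_zero[of "f x"] norm_ge_zero[of "g x"]] by linarith
      then have "norm (f x) * norm (g x) * K \<le> ((norm (f x))\<^sup>2 + (norm (g x))\<^sup>2) * K"
        using K by (intro mult_right_mono) auto
      with K(2)[of "f x" "g x"] have "norm (h (f x) (g x)) \<le> ((norm (f x))\<^sup>2 + (norm (g x))\<^sup>2) * K" by linarith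
      then show "norm (h (f x) (g x)) \<le> norm (K * ((norm (f x))\<^sup>2 + (norm (g x))\<^sup>2))"
        using K(1) by (simp add: mult.commute)
    qed
  qed
qed

lemma square_integrable_add:
  assumes "square_integrable N f" "square_integrable N g"
  shows "square_integrable N (\<lambda>x. f x + g x)"
proof -
  have [measurable]: "f \<in> borel_measurable N" "g \<in> borel_measurable N" using assms by (auto simp: square_integrable_def)
  have "integrable N (\<lambda>x. f x \<bullet> g x)"
    using square_integrable_bilinear[OF bounded_bilinear_inner assms] .
  then have "integrable N (\<lambda>x. (norm (f x))\<^sup>2 + (norm (g x))\<^sup>2 + 2 * (f x \<bullet> g x))"
    using assms by (auto simp: square_integrable_def)
  moreover have "(norm (f x))\<^sup>2 + (norm (g x))\<^sup>2 + 2 * (f x \<bullet> g x) = (norm (f x + g x))\<^sup>2" for x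
    by (simp add: power2_norm_eq_inner inner_add_left inner_add_right inner_commute)
  ultimately show ?thesis by (simp add: square_integrable_def)
qed

lemma square_integrable_linear:
  assumes T: "bounded_linear T" and f: "square_integrable N f"
  shows "square_integrable N (\<lambda>x. T (f x))"
proof -
  have [measurable]: "f \<in> borel_measurable N" using f by (simp add: square_integrable_def)
  have Tm: "(\<lambda>x. T (f x)) \<in> borel_measurable N"
    using measurable_compose[OF \<open>f \<in> borel_measurable N\<close>
        borel_measurable_continuous_onI[OF linear_continuous_on[OF T]]] .
  obtain K where K: "\<And>x. norm (T x) \<le> norm x * K" using bounded_linear.bounded[OF T] by blast
  have "integrable N (\<lambda>x. (norm (T (f x)))\<^sup>2)"
  proof (rule Bochner_Integration.integrable_bound)
    show "integrable N (\<lambda>x. K\<^sup>2 * (norm (f x))\<^sup>2)" using f by (simp add: square_integrable_def)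
    show "AE x in N. norm ((norm (T (f x)))\<^sup>2) \<le> norm (K\<^sup>2 * (norm (f x))\<^sup>2)"
    proof (rule AE_I2)
      fix x show "norm ((norm (T (f x)))\<^sup>2) \<le> norm (K\<^sup>2 * (norm (f x))\<^sup>2)"
        using power_mono[OF K[of "f x"], of 2] by (simp add: power_mult_distrib mult.commute)
    qed
  qed (use Tm in measurable)
  then show ?thesis using Tm by (simp add: square_integrable_def)
qed

lemma square_integrable_uminus: "square_integrable N f \<Longrightarrow> square_integrable N (\<lambda>x. - f x)"
  by (rule square_integrable_linear[OF bounded_linear_minus[OF bounded_linear_ident]])

lemma square_integrable_diff:
  "square_integrable N f \<Longrightarrow> square_integrable N g \<Longrightarrow> square_integrable N (\<lambda>x. f x - g x)"
  using square_integrable_add[OF _ square_integrable_uminus] by force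

lemma square_integrable_zero [simp]: "square_integrable N (\<lambda>x. 0)"
  by (simp add: square_integrable_def)

lemma square_integrable_sum:
  "(\<And>i. i \<in> S \<Longrightarrow> square_integrable N (f i)) \<Longrightarrow> square_integrable N (\<lambda>x. \<Sum>i\<in>S. f i x)"
  by (induction S rule: infinite_finite_induct) (auto intro: square_integrable_add)

lemma (in finite_measure) square_integrable_const [simp]: "square_integrable M (\<lambda>x. c)"
  by (simp add: square_integrable_def)

text \<open>
  Stated with the nonnegative integral, so that it makes sense before \<open>g\<close> is known to be
  square integrable.
\<close>

definition mean_square_tendsto ::
  "'a measure \<Rightarrow> (nat \<Rightarrow> 'a \<Rightarrow> 'b::euclidean_space) \<Rightarrow> ('a \<Rightarrow> 'b) \<Rightarrow> bool" where
  "mean_square_tendsto N f g \<longleftrightarrow> (\<lambda>j. \<integral>\<^sup>+x. ennreal ((norm (g x - f j x))\<^sup>2) \<partial>N) \<longlonglongrightarrow> 0"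

lemma ennreal_norm_add_sq:
  fixes u v :: "'b::euclidean_space"
  shows "ennreal ((norm (u + v))\<^sup>2) \<le> 2 * ennreal ((norm u)\<^sup>2) + 2 * ennreal ((norm v)\<^sup>2)"
proof -
  have "(norm (u + v))\<^sup>2 \<le> (norm u + norm v)\<^sup>2" by (intro power_mono norm_triangle_ineq) auto
  also have "\<dots> \<le> 2 * (norm u)\<^sup>2 + 2 * (norm v)\<^sup>2"
    using sum_squares_bound[of "norm u" "norm v"] by (simp add: power2_eq_square algebra_simps)
  finally have "ennreal ((norm (u + v))\<^sup>2) \<le> ennreal (2 * (norm u)\<^sup>2 + 2 * (norm v)\<^sup>2)" by (rule ennreal_leI)
  then show ?thesis by (simp add: ennreal_plus ennreal_mult)
qed

lemma nn_integral_norm_add_sq: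
  fixes u v :: "'a \<Rightarrow> 'b::euclidean_space"
  assumes [measurable]: "u \<in> borel_measurable N" "v \<in> borel_measurable N"
  shows "(\<integral>\<^sup>+x. ennreal ((norm (u x + v x))\<^sup>2) \<partial>N)
    \<le> 2 * (\<integral>\<^sup>+x. ennreal ((norm (u x))\<^sup>2) \<partial>N) + 2 * (\<integral>\<^sup>+x. ennreal ((norm (v x))\<^sup>2) \<partial>N)"
proof -
  have "(\<integral>\<^sup>+x. ennreal ((norm (u x + v x))\<^sup>2) \<partial>N)
    \<le> (\<integral>\<^sup>+x. 2 * ennreal ((norm (u x))\<^sup>2) + 2 * ennreal ((norm (v x))\<^sup>2) \<partial>N)"
    by (intro nn_integral_mono ennreal_norm_add_sq)
  also have "\<dots> = 2 * (\<integral>\<^sup>+x. ennreal ((norm (u x))\<^sup>2) \<partial>N) + 2 * (\<integral>\<^sup>+x. ennreal ((norm (v x))\<^sup>2) \<partial>N)"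
    by (simp add: nn_integral_add nn_integral_cmult)
  finally show ?thesis .
qed

lemma mean_square_tendsto_add:
  assumes f: "mean_square_tendsto N f g" "mean_square_tendsto N f' g'"
    and [measurable]: "\<And>j. f j \<in> borel_measurable N" "\<And>j. f' j \<in> borel_measurable N"
      "g \<in> borel_measurable N" "g' \<in> borel_measurable N"
  shows "mean_square_tendsto N (\<lambda>j x. f j x + f' j x) (\<lambda>x. g x + g' x)"
  unfolding mean_square_tendsto_def
proof (rule tendsto_sandwich[OF _ _ tendsto_const])
  show "\<forall>\<^sub>F j in sequentially. (\<integral>\<^sup>+x. ennreal ((norm (g x + g' x - (f j x + f' j x)))\<^sup>2) \<partial>N)
    \<le> 2 * (\<integral>\<^sup>+x. ennreal ((norm (g x - f j x))\<^sup>2) \<partial>N) + 2 * (\<integral>\<^sup>+x. ennreal ((norm (g' x - f' j x))\<^sup>2) \<partial>N)"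
  proof (rule always_eventually, rule allI)
    fix j
    show "(\<integral>\<^sup>+x. ennreal ((norm (g x + g' x - (f j x + f' j x)))\<^sup>2) \<partial>N)
      \<le> 2 * (\<integral>\<^sup>+x. ennreal ((norm (g x - f j x))\<^sup>2) \<partial>N) + 2 * (\<integral>\<^sup>+x. ennreal ((norm (g' x - f' j x))\<^sup>2) \<partial>N)"
      using nn_integral_norm_add_sq[of "\<lambda>x. g x - f j x" N "\<lambda>x. g' x - f' j x"] by (simp add: algebra_simps)
  qed
  have "(\<lambda>j. 2 * (\<integral>\<^sup>+x. ennreal ((norm (g x - f j x))\<^sup>2) \<partial>N) + 2 * (\<integral>\<^sup>+x. ennreal ((norm (g' x - f' j x))\<^sup>2) \<partial>N))
     \<longlonglongrightarrow> 2 * 0 + 2 * 0"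
    using f unfolding mean_square_tendsto_def
    by (intro tendsto_add tendsto_mult_ennreal tendsto_const) auto
  then show "(\<lambda>j. 2 * (\<integral>\<^sup>+x. ennreal ((norm (g x - f j x))\<^sup>2) \<partial>N) + 2 * (\<integral>\<^sup>+x. ennreal ((norm (g' x - f' j x))\<^sup>2) \<partial>N))
     \<longlonglongrightarrow> 0" by simp
qed auto

lemma mean_square_tendsto_const: "mean_square_tendsto N (\<lambda>_. g) g"
  by (simp add: mean_square_tendsto_def)

lemma mean_square_tendsto_square_integrable:
  assumes f: "mean_square_tendsto N f g" "\<And>j. square_integrable N (f j)"
    and [measurable]: "g \<in> borel_measurable N"
  shows "square_integrable N g"
proof -
  have "eventually (\<lambda>j. (\<integral>\<^sup>+x. ennreal ((norm (g x - f j x))\<^sup>2) \<partial>N) < 1) sequentially"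
    using f(1) unfolding mean_square_tendsto_def by (rule order_tendstoD) simp
  then obtain j where j: "(\<integral>\<^sup>+x. ennreal ((norm (g x - f j x))\<^sup>2) \<partial>N) < 1"
    by (auto dest: eventually_happens)
  have [measurable]: "f j \<in> borel_measurable N" using f(2) by (simp add: square_integrable_def)
  have "square_integrable N (\<lambda>x. g x - f j x)"
    using order.strict_trans[OF j] by (subst square_integrable_iff_nn) auto
  from square_integrable_add[OF this f(2)[of j]] show ?thesis by simp
qed

text \<open>
  Cauchy-Schwarz, from \<open>2 u v \<le> r u\<^sup>2 + v\<^sup>2 / r\<close> with the best
  \<open>r\<close>; the degenerate cases use \<open>r\<close> large or small.
\<close>

lemma integral_bilinear_le:
  fixes N :: "'a measure"
  assumes h: "bounded_bilinear h" and K: "K > 0" "\<And>x y. norm (h x y) \<le> norm x * norm y * K"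
    and f: "square_integrable N f" and g: "square_integrable N g"
  shows "\<bar>\<integral>x. h (f x) (g x) \<partial>N\<bar> \<le> K * sqrt (\<integral>x. (norm (f x))\<^sup>2 \<partial>N) * sqrt (\<integral>x. (norm (g x))\<^sup>2 \<partial>N)"
proof -
  define a where "a = (\<integral>x. (norm (f x))\<^sup>2 \<partial>N)"
  define b where "b = (\<integral>x. (norm (g x))\<^sup>2 \<partial>N)"
  have fi: "integrable N (\<lambda>x. (norm (f x))\<^sup>2)" and gi: "integrable N (\<lambda>x. (norm (g x))\<^sup>2)"
    using f g by (auto simp: square_integrable_def)
  have ab: "a \<ge> 0" "b \<ge> 0" by (simp_all add: a_def b_def)
  define I where "I = \<bar>\<integral>x. h (f x) (g x) \<partial>N\<bar>"
  have hi: "integrable N (\<lambda>x. h (f x) (g x))" by (rule square_integrable_bilinear[OF h f g])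
  have le: "I \<le> K / 2 * (r * a + b / r)" if r: "r > 0" for r
  proof -
    have "I \<le> (\<integral>x. \<bar>h (f x) (g x)\<bar> \<partial>N)" unfolding I_def by (rule integral_abs_bound)
    also have "\<dots> \<le> (\<integral>x. K / 2 * (r * (norm (f x))\<^sup>2 + (norm (g x))\<^sup>2 / r) \<partial>N)"
    proof (rule integral_mono)
      fix x
      have "2 * (norm (f x) * norm (g x)) \<le> r * (norm (f x))\<^sup>2 + (norm (g x))\<^sup>2 / r"
      proof -
        have "0 \<le> (r * norm (f x) - norm (g x))\<^sup>2 / r" using r by simp
        also have "\<dots> = r * (norm (f x))\<^sup>2 + (norm (g x))\<^sup>2 / r - 2 * (norm (f x) * norm (g x))"
          using r by (simp add: power2_eq_square field_simps)
        finally show ?thesis by simp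
      qed
      then have "K / 2 * (2 * (norm (f x) * norm (g x))) \<le> K / 2 * (r * (norm (f x))\<^sup>2 + (norm (g x))\<^sup>2 / r)"
        using K by (intro mult_left_mono) auto
      then show "\<bar>h (f x) (g x)\<bar> \<le> K / 2 * (r * (norm (f x))\<^sup>2 + (norm (g x))\<^sup>2 / r)"
        using K(2)[of "f x" "g x"] by (simp add: mult.commute)
    qed (use fi gi hi in auto)
    also have "\<dots> = K / 2 * (r * a + b / r)" using fi gi by (simp add: a_def b_def)
    finally show ?thesis .
  qed
  show ?thesis
  proof (cases "a = 0 \<or> b = 0")
    case True
    have "I \<le> 0"
    proof (rule field_le_epsilon)
      fix e :: real assume e: "e > 0"
      show "I \<le> 0 + e"
      proof (cases "a = 0")
        case True
        have "K / 2 * (((K * b / e) + 1) * a + b / ((K * b / e) + 1)) \<le> e"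
          using True K e ab by (simp add: field_simps add_pos_nonneg)
        moreover have "(K * b / e) + 1 > 0" using K e ab by (simp add: add_nonneg_pos)
        ultimately show ?thesis using le[of "(K * b / e) + 1"] by linarith
      next
        case False
        then have b0: "b = 0" "a > 0" using True ab by auto
        have "K / 2 * (2 * e / (K * a) * a + b / (2 * e / (K * a))) \<le> e"
          using b0 K e by (simp add: field_simps)
        moreover have "2 * e / (K * a) > 0" using b0 K e by simp
        ultimately show ?thesis using le[of "2 * e / (K * a)"] by linarith
      qed
    qed
    then show ?thesis using True by (auto simp: I_def a_def b_def)
  next
    case False
    then have p: "a > 0" "b > 0" using ab by auto
    have "sqrt b / sqrt a * a + b / (sqrt b / sqrt a) = 2 * (sqrt a * sqrt b)"
      using p by (simp add: field_simps)
    then show ?thesis using le[of "sqrt b / sqrt a"] p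
      by (simp add: I_def a_def b_def mult.assoc)
  qed
qed

lemma mean_square_tendsto_integral:
  assumes f: "mean_square_tendsto N f g" "\<And>j. square_integrable N (f j)" "square_integrable N g"
  shows "(\<lambda>j. \<integral>x. (norm (g x - f j x))\<^sup>2 \<partial>N) \<longlonglongrightarrow> 0"
proof -
  have sq: "square_integrable N (\<lambda>x. g x - f j x)" for j using f by (intro square_integrable_diff) auto
  have "(\<integral>\<^sup>+x. ennreal ((norm (g x - f j x))\<^sup>2) \<partial>N) = ennreal (\<integral>x. (norm (g x - f j x))\<^sup>2 \<partial>N)" for j
    using sq[of j] by (intro nn_integral_eq_integral) (auto simp: square_integrable_def)
  then have "(\<lambda>j. ennreal (\<integral>x. (norm (g x - f j x))\<^sup>2 \<partial>N)) \<longlonglongrightarrow> ennreal 0"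
    using f(1) by (simp add: mean_square_tendsto_def)
  then show ?thesis by (subst (asm) tendsto_ennreal_iff) auto
qed

lemma mean_square_tendsto_bilinear:
  assumes h: "bounded_bilinear h"
    and f: "mean_square_tendsto N f g" "\<And>j. square_integrable N (f j)" "square_integrable N g"
    and f': "mean_square_tendsto N f' g'" "\<And>j. square_integrable N (f' j)" "square_integrable N g'"
  shows "(\<lambda>j. \<integral>x. (h (f j x) (f' j x) :: real) \<partial>N) \<longlonglongrightarrow> (\<integral>x. h (g x) (g' x) \<partial>N)"
proof -
  interpret h: bounded_bilinear h by (rule h)
  obtain K where K: "K > 0" "\<And>x y. norm (h x y) \<le> norm x * norm y * K"
    using h.pos_bounded by blast
  define a where "a j = (\<integral>x. (norm (g x - f j x))\<^sup>2 \<partial>N)" for j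
  define b where "b j = (\<integral>x. (norm (g' x - f' j x))\<^sup>2 \<partial>N)" for j
  define a0 where "a0 = (\<integral>x. (norm (g x))\<^sup>2 \<partial>N)"
  define b0 where "b0 = (\<integral>x. (norm (g' x))\<^sup>2 \<partial>N)"
  have ab: "a \<longlonglongrightarrow> 0" "b \<longlonglongrightarrow> 0"
    unfolding a_def b_def using mean_square_tendsto_integral[OF f] mean_square_tendsto_integral[OF f'] by auto
  have sf: "square_integrable N (\<lambda>x. g x - f j x)" "square_integrable N (\<lambda>x. g' x - f' j x)" for j
    using f f' by (auto intro: square_integrable_diff)
  have bound: "\<bar>(\<integral>x. h (g x) (g' x) \<partial>N) - (\<integral>x. h (f j x) (f' j x) \<partial>N)\<bar>
      \<le> K * sqrt (a j) * sqrt b0 + K * sqrt a0 * sqrt (b j) + K * sqrt (a j) * sqrt (b j)" for j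
  proof -
    have "(\<integral>x. h (g x) (g' x) \<partial>N) - (\<integral>x. h (f j x) (f' j x) \<partial>N)
      = (\<integral>x. h (g x - f j x) (g' x) \<partial>N) + (\<integral>x. h (g x) (g' x - f' j x) \<partial>N)
        - (\<integral>x. h (g x - f j x) (g' x - f' j x) \<partial>N)"
    proof -
      have "(\<integral>x. h (g x - f j x) (g' x) \<partial>N) + (\<integral>x. h (g x) (g' x - f' j x) \<partial>N)
        - (\<integral>x. h (g x - f j x) (g' x - f' j x) \<partial>N)
        = (\<integral>x. h (g x - f j x) (g' x) + h (g x) (g' x - f' j x) - h (g x - f j x) (g' x - f' j x) \<partial>N)"
        using square_integrable_bilinear[OF h sf(1)[of j] f'(3)] square_integrable_bilinear[OF h f(3) sf(2)[of j]]
          square_integrable_bilinear[OF h sf(1)[of j] sf(2)[of j]] by simp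
      also have "\<dots> = (\<integral>x. h (g x) (g' x) - h (f j x) (f' j x) \<partial>N)"
        by (rule Bochner_Integration.integral_cong)
          (auto simp: h.diff_left h.diff_right algebra_simps)
      also have "\<dots> = (\<integral>x. h (g x) (g' x) \<partial>N) - (\<integral>x. h (f j x) (f' j x) \<partial>N)"
        using square_integrable_bilinear[OF h f(3) f'(3)] square_integrable_bilinear[OF h f(2)[of j] f'(2)[of j]]
        by simp
      finally show ?thesis by simp
    qed
    moreover have "\<bar>\<integral>x. h (g x - f j x) (g' x) \<partial>N\<bar> \<le> K * sqrt (a j) * sqrt b0"
      unfolding a_def b0_def by (intro integral_bilinear_le[OF h K] sf f f')
    moreover have "\<bar>\<integral>x. h (g x) (g' x - f' j x) \<partial>N\<bar> \<le> K * sqrt a0 * sqrt (b j)"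
      unfolding a0_def b_def by (intro integral_bilinear_le[OF h K] sf f f')
    moreover have "\<bar>\<integral>x. h (g x - f j x) (g' x - f' j x) \<partial>N\<bar> \<le> K * sqrt (a j) * sqrt (b j)"
      unfolding a_def b_def by (intro integral_bilinear_le[OF h K] sf f f')
    ultimately show ?thesis by linarith
  qed
  have "(\<lambda>j. K * sqrt (a j) * sqrt b0 + K * sqrt a0 * sqrt (b j) + K * sqrt (a j) * sqrt (b j))
     \<longlonglongrightarrow> K * sqrt 0 * sqrt b0 + K * sqrt a0 * sqrt 0 + K * sqrt 0 * sqrt 0"
    by (intro tendsto_intros ab)
  then have lim: "(\<lambda>j. K * sqrt (a j) * sqrt b0 + K * sqrt a0 * sqrt (b j) + K * sqrt (a j) * sqrt (b j)) \<longlonglongrightarrow> 0"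
    by simp
  have "(\<lambda>j. (\<integral>x. h (g x) (g' x) \<partial>N) - (\<integral>x. h (f j x) (f' j x) \<partial>N)) \<longlonglongrightarrow> 0"
    by (rule Lim_null_comparison[OF _ lim], rule always_eventually) (use bound in simp)
  from tendsto_diff[OF tendsto_const[of "\<integral>x. h (g x) (g' x) \<partial>N"] this] show ?thesis by simp
qed

lemma bounded_bilinear_matrix_form: "bounded_bilinear (\<lambda>x y. x \<bullet> (Q *v y))" for Q :: "real^'n^'m"
  by (rule bounded_bilinear.comp[OF bounded_bilinear_inner bounded_linear_ident matrix_vector_mul_bounded_linear])

section \<open>Increments of a Brownian motion\<close>

lemma measurable_vec_nth:
  fixes f :: "'a \<Rightarrow> real^'i"
  assumes "f \<in> borel_measurable N"
  shows "(\<lambda>x. f x $ i) \<in> borel_measurable N"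
  using measurable_compose[OF assms borel_measurable_continuous_onI[OF linear_continuous_on[OF bounded_linear_vec_nth]]] .

lemma measurable_matrix_vector_mult:
  fixes f :: "'a \<Rightarrow> real^'i"
  assumes "f \<in> borel_measurable N"
  shows "(\<lambda>x. Q *v f x) \<in> borel_measurable N"
  using measurable_compose[OF assms borel_measurable_continuous_onI[OF linear_continuous_on[OF matrix_vector_mul_bounded_linear]]] .

context brownian_motion
begin

lemma measurable_F_mono: "s \<le> t \<Longrightarrow> f \<in> measurable (F s) N \<Longrightarrow> f \<in> measurable (F t) N"
  using sets_F_mono[of s t] space_F[of s] space_F[of t] unfolding measurable_def by auto

lemma measurable_F_M: "f \<in> measurable (F t) N \<Longrightarrow> f \<in> measurable M N"
  by (rule measurable_from_subalg[OF subalgebra_F])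

lemma W_measurable: "0 \<le> t \<Longrightarrow> W t \<in> borel_measurable M"
  by (rule measurable_F_M[OF adapted])

lemma increment_moments:
  assumes "0 \<le> s" "s \<le> t"
  shows "integrable M (\<lambda>\<omega>. (W t \<omega> - W s \<omega>) ^ k)"
    and "(\<integral>\<omega>. W t \<omega> - W s \<omega> \<partial>M) = 0"
    and "(\<integral>\<omega>. (W t \<omega> - W s \<omega>)\<^sup>2 \<partial>M) = t - s"
    and "(\<integral>\<omega>. (W t \<omega> - W s \<omega>) ^ 4 \<partial>M) = 3 * (t - s)\<^sup>2"
proof -
  let ?D = "\<lambda>\<omega>. W t \<omega> - W s \<omega>"
  have "integrable M (\<lambda>\<omega>. ?D \<omega> ^ k) \<and> (\<integral>\<omega>. ?D \<omega> \<partial>M) = 0 \<and> (\<integral>\<omega>. (?D \<omega>)\<^sup>2 \<partial>M) = t - s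
      \<and> (\<integral>\<omega>. (?D \<omega>) ^ 4 \<partial>M) = 3 * (t - s)\<^sup>2"
  proof (cases "s = t")
    case True
    then show ?thesis by simp
  next
    case False
    then have st: "s < t" using assms by simp
    define \<sigma> where "\<sigma> = sqrt (t - s)"
    have \<sigma>: "\<sigma> > 0" "\<sigma>\<^sup>2 = t - s" using st by (auto simp: \<sigma>_def)
    have d: "distributed M lborel ?D (normal_density 0 \<sigma>)"
      using normal_increments[OF assms(1) st] by (simp add: \<sigma>_def)
    have int: "integrable M (\<lambda>\<omega>. ?D \<omega> ^ k)"
      using distributed_integrable[OF d, of "\<lambda>x. x ^ k"] integrable_normal_moment[OF \<sigma>(1), of 0 k] by simp
    have m: "(\<integral>\<omega>. ?D \<omega> ^ i \<partial>M) = (\<integral>x. normal_density 0 \<sigma> x * (x - 0) ^ i \<partial>lborel)" for i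
      using distributed_integral[OF d, of "\<lambda>x. x ^ i"] by simp
    have "(\<integral>\<omega>. ?D \<omega> ^ 1 \<partial>M) = 0"
      unfolding m using integral_normal_moment_odd[OF \<sigma>(1), of 0 0] by simp
    moreover have "(\<integral>\<omega>. ?D \<omega> ^ 2 \<partial>M) = t - s"
      unfolding m using integral_normal_moment_even[OF \<sigma>(1), of 0 1] \<sigma> by (simp add: fact_numeral)
    moreover have "(\<integral>\<omega>. ?D \<omega> ^ 4 \<partial>M) = 3 * (t - s)\<^sup>2"
      unfolding m using integral_normal_moment_even[OF \<sigma>(1), of 0 2] \<sigma>(1)
      by (simp add: fact_numeral \<sigma>(2)[symmetric]) (simp add: field_simps)
    ultimately show ?thesis using int by simp
  qed
  then show "integrable M (\<lambda>\<omega>. ?D \<omega> ^ k)" "(\<integral>\<omega>. ?D \<omega> \<partial>M) = 0" "(\<integral>\<omega>. (?D \<omega>)\<^sup>2 \<partial>M) = t - s"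
    "(\<integral>\<omega>. (?D \<omega>) ^ 4 \<partial>M) = 3 * (t - s)\<^sup>2" by auto
qed

text \<open>
  The preimages of the Borel sets already form a \<open>\<sigma>\<close>-algebra, so independence of the
  increment from \<open>F s\<close> is independence of the two random variables.
\<close>

lemma indep_var_increment:
  assumes "0 \<le> s" "s < t" and U: "U \<in> borel_measurable (F s)"
  shows "indep_var borel U borel (\<lambda>\<omega>. W t \<omega> - W s \<omega>)"
proof -
  let ?D = "\<lambda>\<omega>. W t \<omega> - W s \<omega>"
  have rv: "U \<in> borel_measurable M" "?D \<in> borel_measurable M"
    using measurable_F_M[OF U] W_measurable assms by auto
  have sU: "{U -` A \<inter> space M | A. A \<in> sets borel} \<subseteq> sets (F s)"
    using U space_F[of s] by (auto simp: measurable_def)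
  have eU: "sigma_sets (space M) {U -` A \<inter> space M | A. A \<in> sets borel} = {U -` A \<inter> space M | A. A \<in> sets borel}"
    using sets.sigma_sets_eq[of "vimage_algebra (space M) U borel"] by (simp add: sets_vimage_algebra2 Setcompr_eq_image)
  have eD: "sigma_sets (space M) {?D -` A \<inter> space M | A. A \<in> sets borel} = {?D -` A \<inter> space M | A. A \<in> sets borel}"
    using sets.sigma_sets_eq[of "vimage_algebra (space M) ?D borel"] by (simp add: sets_vimage_algebra2 Setcompr_eq_image)
  have "indep_set (sets (F s)) {?D -` S \<inter> space M | S. S \<in> sets borel}"
    by (rule indep_increments[OF assms(1,2)])
  then have "indep_set {U -` A \<inter> space M | A. A \<in> sets borel} {?D -` A \<inter> space M | A. A \<in> sets borel}"
    using sU unfolding indep_sets2_eq by blast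
  then show ?thesis unfolding indep_var_eq eU eD using rv by auto
qed

lemma integral_times_increment:
  assumes st: "0 \<le> s" "s \<le> t" and U: "U \<in> borel_measurable (F s)" "integrable M U"
  shows "integrable M (\<lambda>\<omega>. U \<omega> * (W t \<omega> - W s \<omega>) ^ k)"
    and "(\<integral>\<omega>. U \<omega> * (W t \<omega> - W s \<omega>) ^ k \<partial>M) = (\<integral>\<omega>. U \<omega> \<partial>M) * (\<integral>\<omega>. (W t \<omega> - W s \<omega>) ^ k \<partial>M)"
proof -
  let ?D = "\<lambda>\<omega>. W t \<omega> - W s \<omega>"
  have "integrable M (\<lambda>\<omega>. U \<omega> * ?D \<omega> ^ k) \<and>
      (\<integral>\<omega>. U \<omega> * ?D \<omega> ^ k \<partial>M) = (\<integral>\<omega>. U \<omega> \<partial>M) * (\<integral>\<omega>. ?D \<omega> ^ k \<partial>M)"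
  proof (cases "s = t")
    case True
    then show ?thesis using U by (cases k) (auto simp: prob_space)
  next
    case False
    then have "s < t" using st by simp
    have "indep_var borel ((\<lambda>x. x) \<circ> U) borel ((\<lambda>x. x ^ k) \<circ> ?D)"
      by (rule indep_var_compose[OF indep_var_increment[OF st(1) \<open>s < t\<close> U(1)]]) auto
    then have "indep_var borel U borel (\<lambda>\<omega>. ?D \<omega> ^ k)" by (simp add: comp_def)
    then show ?thesis
      using indep_var_integrable[OF _ U(2) increment_moments(1)[OF st]]
        indep_var_lebesgue_integral[OF _ U(2) increment_moments(1)[OF st]] by blast
  qed
  then show "integrable M (\<lambda>\<omega>. U \<omega> * ?D \<omega> ^ k)"
    "(\<integral>\<omega>. U \<omega> * ?D \<omega> ^ k \<partial>M) = (\<integral>\<omega>. U \<omega> \<partial>M) * (\<integral>\<omega>. ?D \<omega> ^ k \<partial>M)" by auto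
qed

lemma integral_times_increment_0:
  assumes "0 \<le> s" "s \<le> t" "U \<in> borel_measurable (F s)" "integrable M U"
  shows "integrable M (\<lambda>\<omega>. U \<omega> * (W t \<omega> - W s \<omega>))" "(\<integral>\<omega>. U \<omega> * (W t \<omega> - W s \<omega>) \<partial>M) = 0"
  using integral_times_increment[OF assms, of 1] increment_moments(2)[OF assms(1,2)] by auto

lemma square_integrable_times_increment:
  fixes U :: "'w \<Rightarrow> 'b::euclidean_space"
  assumes st: "0 \<le> s" "s \<le> t" and U: "U \<in> borel_measurable (F s)" "square_integrable M U"
  shows "square_integrable M (\<lambda>\<omega>. (W t \<omega> - W s \<omega>) *\<^sub>R U \<omega>)"
proof -
  have [measurable]: "U \<in> borel_measurable M" "W s \<in> borel_measurable M" "W t \<in> borel_measurable M"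
    using U W_measurable st by (auto simp: square_integrable_def)
  have "(\<lambda>\<omega>. (norm (U \<omega>))\<^sup>2) \<in> borel_measurable (F s)" using U(1) by measurable
  then have "integrable M (\<lambda>\<omega>. (norm (U \<omega>))\<^sup>2 * (W t \<omega> - W s \<omega>)\<^sup>2)"
    using U st by (intro integral_times_increment) (auto simp: square_integrable_def)
  then show ?thesis by (simp add: square_integrable_def power_mult_distrib mult.commute)
qed

text \<open>
  Splitting the increments at the end points of the other interval leaves one square, of expectation the length of
  the overlap; in every other product one increment lies to the right of all other factors and is independent
  of them with mean zero.
\<close>

lemma increment_product_ordered:
  fixes f g :: "'w \<Rightarrow> real"
  assumes t: "0 \<le> a" "a \<le> b" "c \<le> d" "a \<le> c"
    and f: "f \<in> borel_measurable (F a)" "square_integrable M f"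
    and g: "g \<in> borel_measurable (F c)" "square_integrable M g"
  shows "(\<integral>\<omega>. ((W b \<omega> - W a \<omega>) * f \<omega>) * ((W d \<omega> - W c \<omega>) * g \<omega>) \<partial>M)
    = max 0 (min b d - max a c) * (\<integral>\<omega>. f \<omega> * g \<omega> \<partial>M)"
proof -
  note prod = square_integrable_bilinear[OF bounded_bilinear_mult]
  have sqi: "square_integrable M (\<lambda>\<omega>. (W v \<omega> - W u \<omega>) * h \<omega>)"
    if "0 \<le> u" "u \<le> v" "h \<in> borel_measurable (F u)" "square_integrable M h" for u v and h :: "'w \<Rightarrow> real"
    using square_integrable_times_increment[OF that] by simp
  have fc: "f \<in> borel_measurable (F c)" using measurable_F_mono[OF t(4)] f by blast
  have meas: "(\<lambda>\<omega>. (W v \<omega> - W u \<omega>) * f \<omega> * g \<omega>) \<in> borel_measurable (F w)"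
    if "0 \<le> u" "u \<le> v" "v \<le> w" "c \<le> w" for u v w
  proof -
    have "W v \<in> borel_measurable (F w)" "W u \<in> borel_measurable (F w)"
      using that measurable_F_mono[OF _ adapted] by auto
    moreover have "f \<in> borel_measurable (F w)" "g \<in> borel_measurable (F w)"
      using that measurable_F_mono[OF _ fc] measurable_F_mono[OF _ g(1)] by auto
    ultimately show ?thesis by measurable
  qed
  have int_l: "integrable M (\<lambda>\<omega>. (W v \<omega> - W u \<omega>) * f \<omega> * g \<omega>)" if "a \<le> u" "u \<le> v" for u v
    using prod[OF sqi[of u v f] g(2)] that t f measurable_F_mono[OF that(1) f(1)] by simp
  have zero: "integrable M (\<lambda>\<omega>. (W v \<omega> - W u \<omega>) * f \<omega> * g \<omega> * (W z \<omega> - W y \<omega>))"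
      "(\<integral>\<omega>. (W v \<omega> - W u \<omega>) * f \<omega> * g \<omega> * (W z \<omega> - W y \<omega>) \<partial>M) = 0"
    if "a \<le> u" "u \<le> v" "v \<le> y" "c \<le> y" "y \<le> z" for u v y z
    using integral_times_increment_0[OF _ that(5) meas[of u v y] int_l[of u v]] that t by auto
  show ?thesis
  proof (cases "b \<le> c")
    case True
    have "(\<integral>\<omega>. (W b \<omega> - W a \<omega>) * f \<omega> * g \<omega> * (W d \<omega> - W c \<omega>) \<partial>M) = 0"
      using True t by (intro zero) auto
    moreover have "max 0 (min b d - max a c) = 0" using True t by simp
    ultimately show ?thesis by (simp add: mult_ac)
  next
    case False
    define m where "m = min b d"
    have m: "c \<le> m" "m \<le> b" "m \<le> d" using False t by (auto simp: m_def)
    let ?g = "\<lambda>\<omega>. f \<omega> * g \<omega>"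
    have sq: "integrable M (\<lambda>\<omega>. ?g \<omega> * (W m \<omega> - W c \<omega>)\<^sup>2)"
        "(\<integral>\<omega>. ?g \<omega> * (W m \<omega> - W c \<omega>)\<^sup>2 \<partial>M) = (\<integral>\<omega>. ?g \<omega> \<partial>M) * (m - c)"
    proof -
      have "?g \<in> borel_measurable (F c)" using fc g(1) by measurable
      moreover have "integrable M ?g" using prod[OF f(2) g(2)] .
      moreover have "0 \<le> c" using t by simp
      ultimately show "integrable M (\<lambda>\<omega>. ?g \<omega> * (W m \<omega> - W c \<omega>)\<^sup>2)"
        "(\<integral>\<omega>. ?g \<omega> * (W m \<omega> - W c \<omega>)\<^sup>2 \<partial>M) = (\<integral>\<omega>. ?g \<omega> \<partial>M) * (m - c)"
        using integral_times_increment[of c m ?g 2] increment_moments(3)[of c m] m by auto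
    qed
    have bm: "(W b \<omega> - W m \<omega>) * (W d \<omega> - W m \<omega>) = 0" for \<omega>
      by (cases "b \<le> d") (auto simp: m_def min_def)
    have "((W b \<omega> - W a \<omega>) * f \<omega>) * ((W d \<omega> - W c \<omega>) * g \<omega>)
      = (W c \<omega> - W a \<omega>) * f \<omega> * g \<omega> * (W d \<omega> - W c \<omega>)
        + ?g \<omega> * (W m \<omega> - W c \<omega>)\<^sup>2
        + (W m \<omega> - W c \<omega>) * f \<omega> * g \<omega> * (W d \<omega> - W m \<omega>)
        + (W m \<omega> - W c \<omega>) * f \<omega> * g \<omega> * (W b \<omega> - W m \<omega>)" for \<omega>
    proof -
      have "((W b \<omega> - W a \<omega>) * f \<omega>) * ((W d \<omega> - W c \<omega>) * g \<omega>)
        = (W c \<omega> - W a \<omega>) * f \<omega> * g \<omega> * (W d \<omega> - W c \<omega>)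
        + ?g \<omega> * (W m \<omega> - W c \<omega>)\<^sup>2
        + (W m \<omega> - W c \<omega>) * f \<omega> * g \<omega> * (W d \<omega> - W m \<omega>)
        + (W m \<omega> - W c \<omega>) * f \<omega> * g \<omega> * (W b \<omega> - W m \<omega>)
        + ?g \<omega> * ((W b \<omega> - W m \<omega>) * (W d \<omega> - W m \<omega>))"
        by (simp add: power2_eq_square algebra_simps)
      then show ?thesis by (simp add: bm)
    qed
    moreover note zero[of a c c d] zero[of c m m d] zero[of c m m b] sq
    ultimately have "(\<integral>\<omega>. ((W b \<omega> - W a \<omega>) * f \<omega>) * ((W d \<omega> - W c \<omega>) * g \<omega>) \<partial>M) = (\<integral>\<omega>. ?g \<omega> \<partial>M) * (m - c)"
      using m t by (simp add: Bochner_Integration.integral_add Bochner_Integration.integrable_add)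
    then show ?thesis using m t by (simp add: m_def mult.commute)
  qed
qed

lemma increment_product_scalar:
  fixes f g :: "'w \<Rightarrow> real"
  assumes t: "0 \<le> a" "a \<le> b" "0 \<le> c" "c \<le> d"
    and f: "f \<in> borel_measurable (F a)" "square_integrable M f"
    and g: "g \<in> borel_measurable (F c)" "square_integrable M g"
  shows "(\<integral>\<omega>. ((W b \<omega> - W a \<omega>) * f \<omega>) * ((W d \<omega> - W c \<omega>) * g \<omega>) \<partial>M)
    = max 0 (min b d - max a c) * (\<integral>\<omega>. f \<omega> * g \<omega> \<partial>M)"
proof (cases "a \<le> c")
  case True
  then show ?thesis by (intro increment_product_ordered assms)
next
  case False
  then have "(\<integral>\<omega>. ((W d \<omega> - W c \<omega>) * g \<omega>) * ((W b \<omega> - W a \<omega>) * f \<omega>) \<partial>M)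
    = max 0 (min d b - max c a) * (\<integral>\<omega>. g \<omega> * f \<omega> \<partial>M)"
    by (intro increment_product_ordered assms) auto
  then show ?thesis by (simp add: mult.commute min.commute max.commute)
qed

lemma increment_product:
  fixes f :: "'w \<Rightarrow> real^'i" and g :: "'w \<Rightarrow> real^'j" and Q :: "real^'j^'i"
  assumes t: "0 \<le> a" "a \<le> b" "0 \<le> c" "c \<le> d"
    and f: "f \<in> borel_measurable (F a)" "square_integrable M f"
    and g: "g \<in> borel_measurable (F c)" "square_integrable M g"
  shows "(\<integral>\<omega>. ((W b \<omega> - W a \<omega>) *\<^sub>R f \<omega>) \<bullet> (Q *v ((W d \<omega> - W c \<omega>) *\<^sub>R g \<omega>)) \<partial>M)
    = max 0 (min b d - max a c) * (\<integral>\<omega>. f \<omega> \<bullet> (Q *v g \<omega>) \<partial>M)"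
proof -
  have fi: "(\<lambda>\<omega>. f \<omega> $ i) \<in> borel_measurable (F a)" "square_integrable M (\<lambda>\<omega>. f \<omega> $ i)" for i
    using measurable_vec_nth[OF f(1)] square_integrable_linear[OF bounded_linear_vec_nth f(2)] by auto
  have gi: "(\<lambda>\<omega>. g \<omega> $ i) \<in> borel_measurable (F c)" "square_integrable M (\<lambda>\<omega>. g \<omega> $ i)" for i
    using measurable_vec_nth[OF g(1)] square_integrable_linear[OF bounded_linear_vec_nth g(2)] by auto
  have int1: "integrable M (\<lambda>\<omega>. f \<omega> $ i * g \<omega> $ j)" for i j
    using square_integrable_bilinear[OF bounded_bilinear_mult fi(2) gi(2)] .
  have int2: "integrable M (\<lambda>\<omega>. ((W b \<omega> - W a \<omega>) * f \<omega> $ i) * ((W d \<omega> - W c \<omega>) * g \<omega> $ j))" for i j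
    using square_integrable_bilinear[OF bounded_bilinear_mult
        square_integrable_times_increment[OF t(1,2) fi] square_integrable_times_increment[OF t(3,4) gi]] by simp
  have e1: "f \<omega> \<bullet> (Q *v g \<omega>) = (\<Sum>i\<in>UNIV. \<Sum>j\<in>UNIV. Q $ i $ j * (f \<omega> $ i * g \<omega> $ j))" for \<omega>
    by (simp add: inner_vec_def matrix_vector_mult_def sum_distrib_left mult_ac)
  have e2: "((W b \<omega> - W a \<omega>) *\<^sub>R f \<omega>) \<bullet> (Q *v ((W d \<omega> - W c \<omega>) *\<^sub>R g \<omega>))
    = (\<Sum>i\<in>UNIV. \<Sum>j\<in>UNIV. Q $ i $ j * (((W b \<omega> - W a \<omega>) * f \<omega> $ i) * ((W d \<omega> - W c \<omega>) * g \<omega> $ j)))" for \<omega>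
    by (simp add: inner_vec_def matrix_vector_mult_def sum_distrib_left mult_ac)
  show ?thesis
    unfolding e1 e2
    using int1 int2 by (simp add: increment_product_scalar[OF t fi gi]) (simp add: sum_distrib_left mult_ac)
qed


section \<open>The Ito isometry\<close>

interpretation time_space: pair_sigma_finite lborel M ..

lemma tensor_integral:
  fixes f :: "real \<Rightarrow> real" and g :: "'w \<Rightarrow> real"
  assumes f: "integrable lborel f" and g: "integrable M g"
  shows "integrable (lborel \<Otimes>\<^sub>M M) (\<lambda>z. f (fst z) * g (snd z))"
    and "(\<integral>z. f (fst z) * g (snd z) \<partial>(lborel \<Otimes>\<^sub>M M)) = (\<integral>s. f s \<partial>lborel) * (\<integral>\<omega>. g \<omega> \<partial>M)"
proof -
  have [measurable]: "f \<in> borel_measurable lborel" "g \<in> borel_measurable M" using f g by auto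
  show i: "integrable (lborel \<Otimes>\<^sub>M M) (\<lambda>z. f (fst z) * g (snd z))"
    using f g by (intro time_space.Fubini_integrable) (auto simp: abs_mult)
  show "(\<integral>z. f (fst z) * g (snd z) \<partial>(lborel \<Otimes>\<^sub>M M)) = (\<integral>s. f s \<partial>lborel) * (\<integral>\<omega>. g \<omega> \<partial>M)"
    using time_space.integral_fst'[OF i] by simp
qed

text \<open>
  A formal sum of integrands \<open>\<xi> i\<close> on intervals \<open>(a i, b i]\<close>. The intervals
  may overlap and the index type is arbitrary, so that differences of simple processes over different
  partitions, and simple processes stopped at some time, are again of this form.
\<close>

definition adapted_family ::
  "'i set \<Rightarrow> ('i \<Rightarrow> real) \<Rightarrow> ('i \<Rightarrow> real) \<Rightarrow> ('i \<Rightarrow> 'w \<Rightarrow> real^'n) \<Rightarrow> bool" where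
  "adapted_family S a b \<xi> \<longleftrightarrow> finite S \<and>
     (\<forall>i\<in>S. 0 \<le> a i \<and> a i \<le> b i \<and> \<xi> i \<in> borel_measurable (F (a i)) \<and> square_integrable M (\<xi> i))"

definition step_process ::
  "'i set \<Rightarrow> ('i \<Rightarrow> real) \<Rightarrow> ('i \<Rightarrow> real) \<Rightarrow> ('i \<Rightarrow> 'w \<Rightarrow> real^'n) \<Rightarrow> real \<times> 'w \<Rightarrow> real^'n" where
  "step_process S a b \<xi> z = (\<Sum>i\<in>S. indicator {a i<..b i} (fst z) *\<^sub>R \<xi> i (snd z))"

definition step_integral ::
  "'i set \<Rightarrow> ('i \<Rightarrow> real) \<Rightarrow> ('i \<Rightarrow> real) \<Rightarrow> ('i \<Rightarrow> 'w \<Rightarrow> real^'n) \<Rightarrow> 'w \<Rightarrow> real^'n" where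
  "step_integral S a b \<xi> \<omega> = (\<Sum>i\<in>S. (W (b i) \<omega> - W (a i) \<omega>) *\<^sub>R \<xi> i \<omega>)"

lemma square_integrable_indicator_process:
  fixes \<xi> :: "'w \<Rightarrow> real^'n" and a b :: real
  assumes "square_integrable M \<xi>"
  shows "square_integrable (lborel \<Otimes>\<^sub>M M) (\<lambda>z. indicator {a<..b} (fst z) *\<^sub>R \<xi> (snd z))"
proof -
  have [measurable]: "\<xi> \<in> borel_measurable M" using assms by (simp add: square_integrable_def)
  have "integrable lborel (indicator {a<..b} :: real \<Rightarrow> real)"
    by (cases "a \<le> b") (auto intro!: integrable_real_indicator)
  then have "integrable (lborel \<Otimes>\<^sub>M M) (\<lambda>z. indicator {a<..b} (fst z) * (norm (\<xi> (snd z)))\<^sup>2)"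
    using assms by (intro tensor_integral) (auto simp: square_integrable_def)
  moreover have "(norm (indicator {a<..b} (fst z) *\<^sub>R \<xi> (snd z)))\<^sup>2
      = indicator {a<..b} (fst z) * (norm (\<xi> (snd z)))\<^sup>2" for z
    by (simp split: split_indicator)
  ultimately show ?thesis by (simp add: square_integrable_def)
qed

lemma step_process_square_integrable:
  "adapted_family S a b \<xi> \<Longrightarrow> square_integrable (lborel \<Otimes>\<^sub>M M) (step_process S a b \<xi>)"
  unfolding step_process_def[abs_def] adapted_family_def
  by (intro square_integrable_sum square_integrable_indicator_process) auto

lemma step_integral_square_integrable:
  "adapted_family S a b \<xi> \<Longrightarrow> square_integrable M (step_integral S a b \<xi>)"
  unfolding step_integral_def[abs_def] adapted_family_def
  by (intro square_integrable_sum square_integrable_times_increment) auto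

lemma integral_double_sum:
  fixes f :: "'i \<Rightarrow> 'j \<Rightarrow> 'a \<Rightarrow> real"
  assumes "\<And>i j. i \<in> S \<Longrightarrow> j \<in> S' \<Longrightarrow> integrable N (f i j)"
  shows "(\<integral>x. (\<Sum>i\<in>S. \<Sum>j\<in>S'. f i j x) \<partial>N) = (\<Sum>i\<in>S. \<Sum>j\<in>S'. \<integral>x. f i j x \<partial>N)"
proof -
  have "(\<integral>x. (\<Sum>i\<in>S. \<Sum>j\<in>S'. f i j x) \<partial>N) = (\<Sum>i\<in>S. \<integral>x. (\<Sum>j\<in>S'. f i j x) \<partial>N)"
    using assms by (intro Bochner_Integration.integral_sum Bochner_Integration.integrable_sum) auto
  also have "\<dots> = (\<Sum>i\<in>S. \<Sum>j\<in>S'. \<integral>x. f i j x \<partial>N)"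
    using assms by (intro sum.cong refl Bochner_Integration.integral_sum) auto
  finally show ?thesis .
qed

text \<open>
  Both sides are bilinear in the two families, and for single intervals this is the product formula for
  two increments.
\<close>

lemma step_isometry:
  fixes Q :: "real^'m^'n"
  assumes A: "adapted_family S a b \<xi>" and A': "adapted_family S' a' b' \<xi>'"
  shows "(\<integral>\<omega>. step_integral S a b \<xi> \<omega> \<bullet> (Q *v step_integral S' a' b' \<xi>' \<omega>) \<partial>M)
    = (\<integral>z. step_process S a b \<xi> z \<bullet> (Q *v step_process S' a' b' \<xi>' z) \<partial>(lborel \<Otimes>\<^sub>M M))"
proof -
  note form = square_integrable_bilinear[OF bounded_bilinear_matrix_form[of Q]]
  have QS: "Q *v sum f X = (\<Sum>i\<in>X. Q *v f i)" for f :: "'x \<Rightarrow> real^'m" and X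
    by (rule linear_sum) (rule matrix_vector_mul_linear)
  have sq: "square_integrable M (\<xi> i)" "\<xi> i \<in> borel_measurable (F (a i))" "0 \<le> a i" "a i \<le> b i" if "i \<in> S" for i
    using A that by (auto simp: adapted_family_def)
  have sq': "square_integrable M (\<xi>' i)" "\<xi>' i \<in> borel_measurable (F (a' i))" "0 \<le> a' i" "a' i \<le> b' i" if "i \<in> S'" for i
    using A' that by (auto simp: adapted_family_def)
  have "(\<integral>\<omega>. step_integral S a b \<xi> \<omega> \<bullet> (Q *v step_integral S' a' b' \<xi>' \<omega>) \<partial>M)
    = (\<Sum>i\<in>S. \<Sum>j\<in>S'. \<integral>\<omega>. ((W (b i) \<omega> - W (a i) \<omega>) *\<^sub>R \<xi> i \<omega>) \<bullet> (Q *v ((W (b' j) \<omega> - W (a' j) \<omega>) *\<^sub>R \<xi>' j \<omega>)) \<partial>M)"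
  proof -
    have "step_integral S a b \<xi> \<omega> \<bullet> (Q *v step_integral S' a' b' \<xi>' \<omega>)
      = (\<Sum>i\<in>S. \<Sum>j\<in>S'. ((W (b i) \<omega> - W (a i) \<omega>) *\<^sub>R \<xi> i \<omega>) \<bullet> (Q *v ((W (b' j) \<omega> - W (a' j) \<omega>) *\<^sub>R \<xi>' j \<omega>)))" for \<omega>
      unfolding step_integral_def QS by (subst inner_sum_left) (simp only: inner_sum_right)
    moreover have "integrable M (\<lambda>\<omega>. ((W (b i) \<omega> - W (a i) \<omega>) *\<^sub>R \<xi> i \<omega>) \<bullet> (Q *v ((W (b' j) \<omega> - W (a' j) \<omega>) *\<^sub>R \<xi>' j \<omega>)))"
      if "i \<in> S" "j \<in> S'" for i j
      by (intro form square_integrable_times_increment sq sq' that)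
    ultimately show ?thesis by (simp only: integral_double_sum)
  qed
  also have "\<dots> = (\<Sum>i\<in>S. \<Sum>j\<in>S'. \<integral>z. (indicator {a i<..b i} (fst z) *\<^sub>R \<xi> i (snd z)) \<bullet>
      (Q *v (indicator {a' j<..b' j} (fst z) *\<^sub>R \<xi>' j (snd z))) \<partial>(lborel \<Otimes>\<^sub>M M))"
  proof (intro sum.cong refl)
    fix i j assume ij: "i \<in> S" "j \<in> S'"
    let ?I = "{max (a i) (a' j)<..min (b i) (b' j)}"
    have ind: "(indicator {a i<..b i} (fst z) *\<^sub>R \<xi> i (snd z)) \<bullet> (Q *v (indicator {a' j<..b' j} (fst z) *\<^sub>R \<xi>' j (snd z)))
      = indicator ?I (fst z) * (\<xi> i (snd z) \<bullet> (Q *v \<xi>' j (snd z)))" for z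
      by (auto split: split_indicator)
    have I1: "integrable lborel (indicator {p<..q} :: real \<Rightarrow> real)" and I2: "(\<integral>s. indicator {p<..q} s \<partial>lborel) = max 0 (q - p)" for p q :: real
      by (cases "p \<le> q"; simp)+
    have f: "integrable M (\<lambda>\<omega>. \<xi> i \<omega> \<bullet> (Q *v \<xi>' j \<omega>))" using sq[OF ij(1)] sq'[OF ij(2)] by (intro form)
    show "(\<integral>\<omega>. ((W (b i) \<omega> - W (a i) \<omega>) *\<^sub>R \<xi> i \<omega>) \<bullet> (Q *v ((W (b' j) \<omega> - W (a' j) \<omega>) *\<^sub>R \<xi>' j \<omega>)) \<partial>M)
      = (\<integral>z. (indicator {a i<..b i} (fst z) *\<^sub>R \<xi> i (snd z)) \<bullet>
      (Q *v (indicator {a' j<..b' j} (fst z) *\<^sub>R \<xi>' j (snd z))) \<partial>(lborel \<Otimes>\<^sub>M M))"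
      unfolding ind tensor_integral(2)[OF I1 f] I2
      using sq[OF ij(1)] sq'[OF ij(2)] by (intro increment_product) auto
  qed
  also have "\<dots> = (\<integral>z. step_process S a b \<xi> z \<bullet> (Q *v step_process S' a' b' \<xi>' z) \<partial>(lborel \<Otimes>\<^sub>M M))"
  proof -
    have "step_process S a b \<xi> z \<bullet> (Q *v step_process S' a' b' \<xi>' z)
      = (\<Sum>i\<in>S. \<Sum>j\<in>S'. (indicator {a i<..b i} (fst z) *\<^sub>R \<xi> i (snd z)) \<bullet>
      (Q *v (indicator {a' j<..b' j} (fst z) *\<^sub>R \<xi>' j (snd z))))" for z
      unfolding step_process_def QS by (subst inner_sum_left) (simp only: inner_sum_right)
    moreover have "integrable (lborel \<Otimes>\<^sub>M M) (\<lambda>z. (indicator {a i<..b i} (fst z) *\<^sub>R \<xi> i (snd z)) \<bullet>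
      (Q *v (indicator {a' j<..b' j} (fst z) *\<^sub>R \<xi>' j (snd z))))"
      if "i \<in> S" "j \<in> S'" for i j
      by (rule form[OF square_integrable_indicator_process[OF sq(1)[OF that(1)]]
          square_integrable_indicator_process[OF sq'(1)[OF that(2)]]])
    ultimately show ?thesis by (simp only: integral_double_sum)
  qed
  finally show ?thesis .
qed

lemma step_isometry_nn:
  assumes A: "adapted_family S a b \<xi>"
  shows "(\<integral>\<^sup>+\<omega>. ennreal ((norm (step_integral S a b \<xi> \<omega>))\<^sup>2) \<partial>M)
    = (\<integral>\<^sup>+z. ennreal ((norm (step_process S a b \<xi> z))\<^sup>2) \<partial>(lborel \<Otimes>\<^sub>M M))"
proof -
  have "(\<integral>\<omega>. (norm (step_integral S a b \<xi> \<omega>))\<^sup>2 \<partial>M) = (\<integral>z. (norm (step_process S a b \<xi> z))\<^sup>2 \<partial>(lborel \<Otimes>\<^sub>M M))"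
    using step_isometry[OF A A, of "mat 1"] by (simp add: power2_norm_eq_inner)
  then show ?thesis
    using step_process_square_integrable[OF A] step_integral_square_integrable[OF A]
    by (simp add: nn_integral_eq_integral square_integrable_def)
qed

text \<open>
  The difference of two step processes, even over unrelated partitions, is again a step process, over the
  disjoint union of the index sets.
\<close>

lemma step_isometry_diff:
  assumes A: "adapted_family S a b \<xi>" and A': "adapted_family S' a' b' \<xi>'"
  shows "(\<integral>\<^sup>+\<omega>. ennreal ((norm (step_integral S a b \<xi> \<omega> - step_integral S' a' b' \<xi>' \<omega>))\<^sup>2) \<partial>M)
    = (\<integral>\<^sup>+z. ennreal ((norm (step_process S a b \<xi> z - step_process S' a' b' \<xi>' z))\<^sup>2) \<partial>(lborel \<Otimes>\<^sub>M M))"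
proof -
  define \<zeta> where "\<zeta> = case_sum \<xi> (\<lambda>i \<omega>. - \<xi>' i \<omega>)"
  have fam: "adapted_family (S <+> S') (case_sum a a') (case_sum b b') \<zeta>"
    using A A' by (auto simp: adapted_family_def \<zeta>_def intro!: square_integrable_uminus)
  have fin: "finite S" "finite S'" using A A' by (auto simp: adapted_family_def)
  have "step_integral (S <+> S') (case_sum a a') (case_sum b b') \<zeta> \<omega>
      = step_integral S a b \<xi> \<omega> - step_integral S' a' b' \<xi>' \<omega>" for \<omega>
    using fin by (simp add: step_integral_def sum.Plus \<zeta>_def sum_negf)
  moreover have "step_process (S <+> S') (case_sum a a') (case_sum b b') \<zeta> z
      = step_process S a b \<xi> z - step_process S' a' b' \<xi>' z" for z
    unfolding step_process_def using fin by (subst sum.Plus) (simp_all add: \<zeta>_def sum_negf)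
  ultimately show ?thesis using step_isometry_nn[OF fam] by simp
qed

text \<open>
  A process cut off outside \<open>[0, T]\<close>, seen as a function on
  \<open>lborel \<Otimes>\<^sub>M M\<close>.
\<close>

definition on_horizon :: "real \<Rightarrow> (real \<Rightarrow> 'w \<Rightarrow> real^'n) \<Rightarrow> real \<times> 'w \<Rightarrow> real^'n" where
  "on_horizon T \<phi> z = indicator {0..T} (fst z) *\<^sub>R \<phi> (fst z) (snd z)"

text \<open>
  Joint measurability is given on \<open>S\<close> only; clamping the time to \<open>[0, T]\<close>
  transports it to the whole line.
\<close>

lemma on_horizon_measurable:
  assumes "adapted_measurable M F S \<phi>" "{0..T} \<subseteq> S"
  shows "on_horizon T \<phi> \<in> borel_measurable (lborel \<Otimes>\<^sub>M M)"
proof (cases "0 \<le> T")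
  case True
  have phi: "(\<lambda>(s, \<omega>). \<phi> s \<omega>) \<in> borel_measurable (restrict_space borel S \<Otimes>\<^sub>M M)"
    using assms by (simp add: adapted_measurable_def)
  have "(\<lambda>s. max 0 (min T s)) \<in> measurable lborel (restrict_space borel S)"
    using True assms(2) by (intro measurable_restrict_space2) auto
  then have "(\<lambda>z. (max 0 (min T (fst z)), snd z)) \<in> measurable (lborel \<Otimes>\<^sub>M M) (restrict_space borel S \<Otimes>\<^sub>M M)"
    by (intro measurable_Pair measurable_compose[OF measurable_fst]) auto
  from measurable_compose[OF this phi]
  have "(\<lambda>z. \<phi> (max 0 (min T (fst z))) (snd z)) \<in> borel_measurable (lborel \<Otimes>\<^sub>M M)" by simp
  then have "(\<lambda>z. indicator {0..T} (fst z) *\<^sub>R \<phi> (max 0 (min T (fst z))) (snd z)) \<in> borel_measurable (lborel \<Otimes>\<^sub>M M)"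
    by measurable
  moreover have "indicator {0..T} (fst z) *\<^sub>R \<phi> (max 0 (min T (fst z))) (snd z) = on_horizon T \<phi> z" for z
    by (auto simp: on_horizon_def split: split_indicator)
  ultimately show ?thesis by (simp cong: measurable_cong)
qed (auto simp: on_horizon_def[abs_def])

lemma simple_integrand_times:
  assumes "simple_integrand M F T N t \<xi>" "i \<le> N"
  shows "0 \<le> t i" "t i \<le> T"
proof -
  have mono: "t i \<le> t j" if "i \<le> j" "j \<le> N" for i j
    using that assms(1) by (induction j) (auto simp: simple_integrand_def le_Suc_eq intro: order_trans)
  show "0 \<le> t i" "t i \<le> T" using mono[of 0 i] mono[of i N] assms by (auto simp: simple_integrand_def)
qed

lemma simple_integrand_family:
  assumes "simple_integrand M F T N t \<xi>"
  shows "adapted_family {..<N} t (\<lambda>i. t (Suc i)) \<xi>"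
  unfolding adapted_family_def
proof (intro conjI ballI)
  fix i assume i: "i \<in> {..<N}"
  show "0 \<le> t i" using simple_integrand_times[OF assms, of i] i by simp
  show m: "t i \<le> t (Suc i)" "\<xi> i \<in> borel_measurable (F (t i))"
    using assms i by (auto simp: simple_integrand_def)
  show "square_integrable M (\<xi> i)"
    using assms i measurable_F_M[OF m(2)] by (auto simp: simple_integrand_def square_integrable_def)
qed simp

lemma has_ito_integral_approx:
  assumes "has_ito_integral M F W \<phi> T I"
  shows "\<exists>N t \<xi>. (\<forall>j. simple_integrand M F T (N j) (t j) (\<xi> j)) \<and>
    mean_square_tendsto (lborel \<Otimes>\<^sub>M M) (\<lambda>j. step_process {..<N j} (t j) (\<lambda>i. t j (Suc i)) (\<xi> j)) (on_horizon T \<phi>) \<and>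
    mean_square_tendsto M (\<lambda>j. step_integral {..<N j} (t j) (\<lambda>i. t j (Suc i)) (\<xi> j)) I"
proof -
  obtain N t \<xi> where s: "\<And>j. simple_integrand M F T (N j) (t j) (\<xi> j)"
    and p: "(\<lambda>j. \<integral>\<^sup>+\<omega>. (\<integral>\<^sup>+s\<in>{0..T}. ennreal ((norm (\<phi> s \<omega> - simple_process (N j) (t j) (\<xi> j) s \<omega>))\<^sup>2) \<partial>lborel) \<partial>M) \<longlonglongrightarrow> 0"
    and i: "(\<lambda>j. \<integral>\<^sup>+\<omega>. ennreal ((norm (I \<omega> - simple_integral W (N j) (t j) (\<xi> j) \<omega>))\<^sup>2) \<partial>M) \<longlonglongrightarrow> 0"
    using assms unfolding has_ito_integral_def by blast
  have am: "adapted_measurable M F {0..T} \<phi>" using assms by (simp add: has_ito_integral_def)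
  define \<Phi> where "\<Phi> j = step_process {..<N j} (t j) (\<lambda>i. t j (Suc i)) (\<xi> j)" for j
  have eq: "(\<integral>\<^sup>+\<omega>. (\<integral>\<^sup>+s\<in>{0..T}. ennreal ((norm (\<phi> s \<omega> - simple_process (N j) (t j) (\<xi> j) s \<omega>))\<^sup>2) \<partial>lborel) \<partial>M)
     = (\<integral>\<^sup>+z. ennreal ((norm (on_horizon T \<phi> z - \<Phi> j z))\<^sup>2) \<partial>(lborel \<Otimes>\<^sub>M M))" for j
  proof -
    have [measurable]: "\<Phi> j \<in> borel_measurable (lborel \<Otimes>\<^sub>M M)" "on_horizon T \<phi> \<in> borel_measurable (lborel \<Otimes>\<^sub>M M)"
      using step_process_square_integrable[OF simple_integrand_family[OF s]] on_horizon_measurable[OF am]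
      by (auto simp: \<Phi>_def square_integrable_def)
    have "ennreal ((norm (\<phi> s \<omega> - simple_process (N j) (t j) (\<xi> j) s \<omega>))\<^sup>2) * indicator {0..T} s
      = ennreal ((norm (on_horizon T \<phi> (s, \<omega>) - \<Phi> j (s, \<omega>)))\<^sup>2)" for s \<omega>
    proof (cases "s \<in> {0..T}")
      case True
      then show ?thesis by (simp add: on_horizon_def \<Phi>_def step_process_def simple_process_def)
    next
      case False
      have "s \<notin> {t j i<..t j (Suc i)}" if "i < N j" for i
        using False simple_integrand_times[OF s, of i j] simple_integrand_times[OF s, of "Suc i" j] that by auto
      then show ?thesis using False by (simp add: on_horizon_def \<Phi>_def step_process_def)
    qed
    then show ?thesis by (simp add: time_space.nn_integral_snd[symmetric])
  qed
  show ?thesis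
  proof (intro exI[of _ N] exI[of _ t] exI[of _ \<xi>] conjI allI s)
    show "mean_square_tendsto (lborel \<Otimes>\<^sub>M M) (\<lambda>j. step_process {..<N j} (t j) (\<lambda>i. t j (Suc i)) (\<xi> j)) (on_horizon T \<phi>)"
      using p unfolding mean_square_tendsto_def eq by (simp add: \<Phi>_def)
    show "mean_square_tendsto M (\<lambda>j. step_integral {..<N j} (t j) (\<lambda>i. t j (Suc i)) (\<xi> j)) I"
      using i unfolding mean_square_tendsto_def by (simp add: simple_integral_def step_integral_def)
  qed
qed

lemma has_ito_integral_square_integrable:
  assumes "has_ito_integral M F W \<phi> T I"
  shows "square_integrable (lborel \<Otimes>\<^sub>M M) (on_horizon T \<phi>)" "square_integrable M I"
proof -
  obtain N t \<xi> where s: "\<And>j. simple_integrand M F T (N j) (t j) (\<xi> j)"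
    "mean_square_tendsto (lborel \<Otimes>\<^sub>M M) (\<lambda>j. step_process {..<N j} (t j) (\<lambda>i. t j (Suc i)) (\<xi> j)) (on_horizon T \<phi>)"
    "mean_square_tendsto M (\<lambda>j. step_integral {..<N j} (t j) (\<lambda>i. t j (Suc i)) (\<xi> j)) I"
    using has_ito_integral_approx[OF assms] by blast
  note fam = simple_integrand_family[OF s(1)]
  have m: "adapted_measurable M F {0..T} \<phi>" "I \<in> borel_measurable M"
    using assms by (auto simp: has_ito_integral_def)
  show "square_integrable (lborel \<Otimes>\<^sub>M M) (on_horizon T \<phi>)"
    by (rule mean_square_tendsto_square_integrable[OF s(2) step_process_square_integrable[OF fam] on_horizon_measurable[OF m(1)]]) simp
  show "square_integrable M I"
    by (rule mean_square_tendsto_square_integrable[OF s(3) step_integral_square_integrable[OF fam] m(2)])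
qed

text \<open>
  The isometry passes to mean-square limits. A general matrix \<open>Q\<close> is allowed because the
  quadratic forms that follow are not squares of norms.
\<close>

lemma ito_isometry:
  fixes Q :: "real^'n^'n"
  assumes I: "has_ito_integral M F W \<phi> T I"
  shows "(\<integral>\<omega>. I \<omega> \<bullet> (Q *v I \<omega>) \<partial>M)
    = (\<integral>z. on_horizon T \<phi> z \<bullet> (Q *v on_horizon T \<phi> z) \<partial>(lborel \<Otimes>\<^sub>M M))"
proof -
  obtain N t \<xi> where s: "\<And>j. simple_integrand M F T (N j) (t j) (\<xi> j)"
    "mean_square_tendsto (lborel \<Otimes>\<^sub>M M) (\<lambda>j. step_process {..<N j} (t j) (\<lambda>i. t j (Suc i)) (\<xi> j)) (on_horizon T \<phi>)"
    "mean_square_tendsto M (\<lambda>j. step_integral {..<N j} (t j) (\<lambda>i. t j (Suc i)) (\<xi> j)) I"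
    using has_ito_integral_approx[OF I] by blast
  note fam = simple_integrand_family[OF s(1)]
  note sq = has_ito_integral_square_integrable[OF I]
  have 1: "(\<lambda>j. \<integral>z. step_process {..<N j} (t j) (\<lambda>i. t j (Suc i)) (\<xi> j) z \<bullet>
      (Q *v step_process {..<N j} (t j) (\<lambda>i. t j (Suc i)) (\<xi> j) z) \<partial>(lborel \<Otimes>\<^sub>M M))
    \<longlonglongrightarrow> (\<integral>z. on_horizon T \<phi> z \<bullet> (Q *v on_horizon T \<phi> z) \<partial>(lborel \<Otimes>\<^sub>M M))"
    by (rule mean_square_tendsto_bilinear[OF bounded_bilinear_matrix_form s(2) step_process_square_integrable[OF fam] sq(1)
        s(2) step_process_square_integrable[OF fam] sq(1)])
  have 2: "(\<lambda>j. \<integral>\<omega>. step_integral {..<N j} (t j) (\<lambda>i. t j (Suc i)) (\<xi> j) \<omega> \<bullet>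
      (Q *v step_integral {..<N j} (t j) (\<lambda>i. t j (Suc i)) (\<xi> j) \<omega>) \<partial>M)
    \<longlonglongrightarrow> (\<integral>\<omega>. I \<omega> \<bullet> (Q *v I \<omega>) \<partial>M)"
    by (rule mean_square_tendsto_bilinear[OF bounded_bilinear_matrix_form s(3) step_integral_square_integrable[OF fam] sq(2)
        s(3) step_integral_square_integrable[OF fam] sq(2)])
  show ?thesis using LIMSEQ_unique[OF 2] 1 unfolding step_isometry[OF fam fam] by blast
qed

text \<open>
  Stopping at \<open>s\<close> the step processes that approximate the integrand on \<open>[0, T]\<close>
  gives approximations of the integrand on \<open>[0, s]\<close>, so by the isometry their integrals tend
  to \<open>Is\<close>. What was cut off is a sum of increments after \<open>s\<close>, which are
  orthogonal to \<open>\<eta>\<close> at every stage.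
\<close>

lemma ito_martingale:
  fixes \<eta> :: "'w \<Rightarrow> real^'n" and Q :: "real^'n^'n"
  assumes st: "0 \<le> s" "s \<le> T" and Is: "has_ito_integral M F W \<phi> s Is" and It: "has_ito_integral M F W \<phi> T It"
    and \<eta>: "\<eta> \<in> borel_measurable (F s)" "square_integrable M \<eta>"
  shows "(\<integral>\<omega>. \<eta> \<omega> \<bullet> (Q *v It \<omega>) \<partial>M) = (\<integral>\<omega>. \<eta> \<omega> \<bullet> (Q *v Is \<omega>) \<partial>M)"
proof -
  let ?N = "lborel \<Otimes>\<^sub>M M"
  obtain N t \<xi> where a: "\<And>j. simple_integrand M F T (N j) (t j) (\<xi> j)"
    "mean_square_tendsto ?N (\<lambda>j. step_process {..<N j} (t j) (\<lambda>i. t j (Suc i)) (\<xi> j)) (on_horizon T \<phi>)"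
    "mean_square_tendsto M (\<lambda>j. step_integral {..<N j} (t j) (\<lambda>i. t j (Suc i)) (\<xi> j)) It"
    using has_ito_integral_approx[OF It] by blast
  obtain N' t' \<xi>' where a': "\<And>j. simple_integrand M F s (N' j) (t' j) (\<xi>' j)"
    "mean_square_tendsto ?N (\<lambda>j. step_process {..<N' j} (t' j) (\<lambda>i. t' j (Suc i)) (\<xi>' j)) (on_horizon s \<phi>)"
    "mean_square_tendsto M (\<lambda>j. step_integral {..<N' j} (t' j) (\<lambda>i. t' j (Suc i)) (\<xi>' j)) Is"
    using has_ito_integral_approx[OF Is] by blast
  note fam = simple_integrand_family[OF a(1)] and fam' = simple_integrand_family[OF a'(1)]
  note sqT = has_ito_integral_square_integrable[OF It] and sqs = has_ito_integral_square_integrable[OF Is]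
  define \<Phi> where "\<Phi> j = step_process {..<N j} (t j) (\<lambda>i. t j (Suc i)) (\<xi> j)" for j
  define \<Phi>' where "\<Phi>' j = step_process {..<N' j} (t' j) (\<lambda>i. t' j (Suc i)) (\<xi>' j)" for j
  define J where "J j = step_integral {..<N j} (t j) (\<lambda>i. t j (Suc i)) (\<xi> j)" for j
  define J' where "J' j = step_integral {..<N' j} (t' j) (\<lambda>i. t' j (Suc i)) (\<xi>' j)" for j
  \<comment> \<open>Stop the approximations of the later integral at time \<open>s\<close>.\<close>
  define \<xi>s where "\<xi>s j i = (if t j i < s then \<xi> j i else (\<lambda>_. 0))" for j i
  define \<Phi>s where "\<Phi>s j = step_process {..<N j} (\<lambda>i. min s (t j i)) (\<lambda>i. min s (t j (Suc i))) (\<xi>s j)" for j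
  define Js where "Js j = step_integral {..<N j} (\<lambda>i. min s (t j i)) (\<lambda>i. min s (t j (Suc i))) (\<xi>s j)" for j
  have fams: "adapted_family {..<N j} (\<lambda>i. min s (t j i)) (\<lambda>i. min s (t j (Suc i))) (\<xi>s j)" for j
    using fam[of j] st(1)
    by (auto simp: adapted_family_def \<xi>s_def min_def) (meson lessThan_iff order_trans)
  have meas [measurable]: "\<Phi> j \<in> borel_measurable ?N" "\<Phi>' j \<in> borel_measurable ?N" "\<Phi>s j \<in> borel_measurable ?N"
      "J j \<in> borel_measurable M" "J' j \<in> borel_measurable M" "Js j \<in> borel_measurable M" for j
    using step_process_square_integrable[OF fam] step_process_square_integrable[OF fam'] step_process_square_integrable[OF fams]
      step_integral_square_integrable[OF fam] step_integral_square_integrable[OF fam'] step_integral_square_integrable[OF fams]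
    by (auto simp: \<Phi>_def \<Phi>'_def \<Phi>s_def J_def J'_def Js_def square_integrable_def)
  have [measurable]: "on_horizon T \<phi> \<in> borel_measurable ?N" "on_horizon s \<phi> \<in> borel_measurable ?N" "It \<in> borel_measurable M" "Is \<in> borel_measurable M"
    using sqT sqs by (auto simp: square_integrable_def)
  have \<Phi>s: "\<Phi>s j z = indicator {..s} (fst z) *\<^sub>R \<Phi> j z" for j z
    unfolding \<Phi>s_def \<Phi>_def step_process_def \<xi>s_def scaleR_sum_right
    by (intro sum.cong refl) (auto split: split_indicator)
  have "mean_square_tendsto ?N \<Phi>s (on_horizon s \<phi>)"
    unfolding mean_square_tendsto_def
  proof (rule tendsto_sandwich[OF _ _ tendsto_const])
    show "(\<lambda>j. \<integral>\<^sup>+z. ennreal ((norm (on_horizon T \<phi> z - \<Phi> j z))\<^sup>2) \<partial>?N) \<longlonglongrightarrow> 0"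
      using a(2) by (simp add: mean_square_tendsto_def \<Phi>_def)
    have "on_horizon s \<phi> z - \<Phi>s j z = indicator {..s} (fst z) *\<^sub>R (on_horizon T \<phi> z - \<Phi> j z)" for z j
      using st by (auto simp: on_horizon_def \<Phi>s split: split_indicator)
    then show "\<forall>\<^sub>F j in sequentially. (\<integral>\<^sup>+z. ennreal ((norm (on_horizon s \<phi> z - \<Phi>s j z))\<^sup>2) \<partial>?N)
       \<le> (\<integral>\<^sup>+z. ennreal ((norm (on_horizon T \<phi> z - \<Phi> j z))\<^sup>2) \<partial>?N)"
      by (intro always_eventually allI nn_integral_mono ennreal_leI) (auto split: split_indicator)
  qed auto
  moreover have neg: "mean_square_tendsto ?N (\<lambda>j z. - \<Phi>' j z) (\<lambda>z. - on_horizon s \<phi> z)"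
    using a'(2) unfolding mean_square_tendsto_def \<Phi>'_def
    by (simp add: norm_minus_commute[of "on_horizon s \<phi> _"])
  ultimately have "mean_square_tendsto ?N (\<lambda>j z. \<Phi>s j z + - \<Phi>' j z) (\<lambda>z. on_horizon s \<phi> z + - on_horizon s \<phi> z)"
    by (rule mean_square_tendsto_add) measurable
  then have "(\<lambda>j. \<integral>\<^sup>+z. ennreal ((norm (\<Phi>s j z - \<Phi>' j z))\<^sup>2) \<partial>?N) \<longlonglongrightarrow> 0"
    by (simp add: mean_square_tendsto_def norm_minus_commute)
  then have "mean_square_tendsto M (\<lambda>j \<omega>. Js j \<omega> - J' j \<omega>) (\<lambda>_. 0)"
    unfolding \<Phi>s_def \<Phi>'_def step_isometry_diff[OF fams fam', symmetric]
    by (simp add: mean_square_tendsto_def Js_def J'_def norm_minus_commute)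
  moreover have "mean_square_tendsto M J' Is" using a'(3) by (simp add: J'_def[abs_def])
  ultimately have "mean_square_tendsto M (\<lambda>j \<omega>. (Js j \<omega> - J' j \<omega>) + J' j \<omega>) (\<lambda>\<omega>. 0 + Is \<omega>)"
    by (rule mean_square_tendsto_add) measurable
  then have Js: "mean_square_tendsto M Js Is" by simp
  have sqJs: "square_integrable M (Js j)" for j using step_integral_square_integrable[OF fams] by (simp add: Js_def)
  have sqJ: "square_integrable M (J j)" for j using step_integral_square_integrable[OF fam] by (simp add: J_def)
  have J: "mean_square_tendsto M J It" using a(3) by (simp add: J_def[abs_def])
  have same: "(\<integral>\<omega>. \<eta> \<omega> \<bullet> (Q *v J j \<omega>) \<partial>M) = (\<integral>\<omega>. \<eta> \<omega> \<bullet> (Q *v Js j \<omega>) \<partial>M)" for j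
  proof -
    note form = square_integrable_bilinear[OF bounded_bilinear_matrix_form[of Q]]
    have QS: "Q *v sum f X = (\<Sum>i\<in>X. Q *v f i)" for f :: "'x \<Rightarrow> real^'n" and X
      by (rule linear_sum) (rule matrix_vector_mul_linear)
    define u where "u i = max s (t j i)" for i
    define v where "v i = max s (t j (Suc i))" for i
    have famu: "0 \<le> u i \<and> u i \<le> v i \<and> \<xi> j i \<in> borel_measurable (F (u i)) \<and> square_integrable M (\<xi> j i)" if "i < N j" for i
    proof -
      have f: "0 \<le> t j i" "t j i \<le> t j (Suc i)" "\<xi> j i \<in> borel_measurable (F (t j i))" "square_integrable M (\<xi> j i)"
        using fam[of j] that by (auto simp: adapted_family_def)
      have "t j i \<le> u i" by (simp add: u_def)
      then show ?thesis using f measurable_F_mono[OF _ f(3), of "u i"] st by (auto simp: u_def v_def)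
    qed
    have "\<eta> \<omega> \<bullet> (Q *v J j \<omega>) = \<eta> \<omega> \<bullet> (Q *v Js j \<omega>) + (\<Sum>i<N j. (\<eta> \<omega> \<bullet> (Q *v \<xi> j i \<omega>)) * (W (v i) \<omega> - W (u i) \<omega>))" for \<omega>
    proof -
      have "J j \<omega> = Js j \<omega> + (\<Sum>i<N j. (W (v i) \<omega> - W (u i) \<omega>) *\<^sub>R \<xi> j i \<omega>)"
        unfolding J_def Js_def step_integral_def sum.distrib[symmetric]
      proof (intro sum.cong refl)
        fix i assume "i \<in> {..<N j}"
        then have "t j i \<le> t j (Suc i)" using fam[of j] by (auto simp: adapted_family_def)
        then show "(W (t j (Suc i)) \<omega> - W (t j i) \<omega>) *\<^sub>R \<xi> j i \<omega> =
            (W (min s (t j (Suc i))) \<omega> - W (min s (t j i)) \<omega>) *\<^sub>R \<xi>s j i \<omega> + (W (v i) \<omega> - W (u i) \<omega>) *\<^sub>R \<xi> j i \<omega>"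
          by (auto simp: u_def v_def \<xi>s_def min_def max_def scaleR_diff_left)
      qed
      then show ?thesis
        by (simp add: matrix_vector_right_distrib QS inner_add_right inner_sum_right matrix_vector_mult_scaleR mult.commute)
    qed
    moreover have z: "integrable M (\<lambda>\<omega>. (\<eta> \<omega> \<bullet> (Q *v \<xi> j i \<omega>)) * (W (v i) \<omega> - W (u i) \<omega>))"
      "(\<integral>\<omega>. (\<eta> \<omega> \<bullet> (Q *v \<xi> j i \<omega>)) * (W (v i) \<omega> - W (u i) \<omega>) \<partial>M) = 0" if "i < N j" for i
    proof -
      have "\<eta> \<in> borel_measurable (F (u i))" using measurable_F_mono[OF _ \<eta>(1), of "u i"] by (simp add: u_def)
      then have "(\<lambda>\<omega>. \<eta> \<omega> \<bullet> (Q *v \<xi> j i \<omega>)) \<in> borel_measurable (F (u i))"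
        using measurable_matrix_vector_mult[of "\<xi> j i" "F (u i)" Q] famu[OF that] by (intro borel_measurable_inner) auto
      moreover have "integrable M (\<lambda>\<omega>. \<eta> \<omega> \<bullet> (Q *v \<xi> j i \<omega>))" using form[OF \<eta>(2)] famu[OF that] by blast
      ultimately show "integrable M (\<lambda>\<omega>. (\<eta> \<omega> \<bullet> (Q *v \<xi> j i \<omega>)) * (W (v i) \<omega> - W (u i) \<omega>))"
        "(\<integral>\<omega>. (\<eta> \<omega> \<bullet> (Q *v \<xi> j i \<omega>)) * (W (v i) \<omega> - W (u i) \<omega>) \<partial>M) = 0"
        using integral_times_increment_0 famu[OF that] by blast+
    qed
    moreover note form[OF \<eta>(2) sqJs[of j]]
    moreover have "integrable M (\<lambda>\<omega>. \<Sum>i<N j. (\<eta> \<omega> \<bullet> (Q *v \<xi> j i \<omega>)) * (W (v i) \<omega> - W (u i) \<omega>))"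
      by (intro Bochner_Integration.integrable_sum z(1)) simp
    moreover have "(\<integral>\<omega>. (\<Sum>i<N j. (\<eta> \<omega> \<bullet> (Q *v \<xi> j i \<omega>)) * (W (v i) \<omega> - W (u i) \<omega>)) \<partial>M) = 0"
      by (subst Bochner_Integration.integral_sum) (use z in auto)
    ultimately show ?thesis by (simp add: Bochner_Integration.integral_add)
  qed
  have "(\<lambda>j. \<integral>\<omega>. \<eta> \<omega> \<bullet> (Q *v J j \<omega>) \<partial>M) \<longlonglongrightarrow> (\<integral>\<omega>. \<eta> \<omega> \<bullet> (Q *v It \<omega>) \<partial>M)"
    by (rule mean_square_tendsto_bilinear[OF bounded_bilinear_matrix_form mean_square_tendsto_const \<eta>(2) \<eta>(2) J sqJ sqT(2)])
  moreover have "(\<lambda>j. \<integral>\<omega>. \<eta> \<omega> \<bullet> (Q *v Js j \<omega>) \<partial>M) \<longlonglongrightarrow> (\<integral>\<omega>. \<eta> \<omega> \<bullet> (Q *v Is \<omega>) \<partial>M)"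
    by (rule mean_square_tendsto_bilinear[OF bounded_bilinear_matrix_form mean_square_tendsto_const \<eta>(2) \<eta>(2) Js sqJs sqs(2)])
  ultimately show ?thesis unfolding same by (rule LIMSEQ_unique)
qed

end

section \<open>Second moments of solutions\<close>

text \<open>
  Cauchy-Schwarz against the indicator function of \<open>[0, T]\<close>.
\<close>

lemma norm_integral_sq_le:
  fixes f :: "real \<Rightarrow> real^'n"
  assumes [measurable]: "f \<in> borel_measurable lborel" and T: "0 \<le> T" and supp: "\<And>s. s \<notin> {0..T} \<Longrightarrow> f s = 0"
  shows "ennreal ((norm (\<integral>s. f s \<partial>lborel))\<^sup>2) \<le> ennreal T * (\<integral>\<^sup>+s. ennreal ((norm (f s))\<^sup>2) \<partial>lborel)"
proof (cases "integrable lborel f")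
  case False
  then show ?thesis by (simp add: not_integrable_integral_eq)
next
  case True
  have "ennreal (norm (\<integral>s. f s \<partial>lborel)) \<le> (\<integral>\<^sup>+s. ennreal (norm (f s)) \<partial>lborel)"
    by (rule integral_norm_bound_ennreal[OF True])
  also have "\<dots> = (\<integral>\<^sup>+s. ennreal (norm (f s)) * indicator {0..T} s \<partial>lborel)"
    using supp by (intro nn_integral_cong) (auto split: split_indicator)
  finally have "(ennreal (norm (\<integral>s. f s \<partial>lborel)))\<^sup>2 \<le> (\<integral>\<^sup>+s. ennreal (norm (f s)) * indicator {0..T} s \<partial>lborel)\<^sup>2"
    by (rule power_mono) simp
  also have "\<dots> \<le> (\<integral>\<^sup>+s. (ennreal (norm (f s)))\<^sup>2 \<partial>lborel) * (\<integral>\<^sup>+s. (indicator {0..T} s)\<^sup>2 \<partial>lborel)"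
    by (rule Cauchy_Schwarz_nn_integral) auto
  also have "(\<integral>\<^sup>+s. (indicator {0..T} s :: ennreal)\<^sup>2 \<partial>lborel) = (\<integral>\<^sup>+s. indicator {0..T} s \<partial>lborel)"
    by (intro nn_integral_cong) (auto split: split_indicator)
  also have "\<dots> = ennreal T" using T by simp
  finally show ?thesis by (simp add: ennreal_power mult.commute)
qed

lemma quadratic_form_primitive:
  fixes c :: "real \<Rightarrow> real^'n" and x :: "real^'n" and Q :: "real^'n^'n"
  assumes c: "continuous_on {0..T} c" and T: "0 \<le> T"
  defines "v \<equiv> \<lambda>r. x + (LINT s:{0..r}|lborel. c s)"
  shows "v T \<bullet> (Q *v v T) = x \<bullet> (Q *v x) + (LINT r:{0..T}|lborel. c r \<bullet> (Q *v v r) + v r \<bullet> (Q *v c r))"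
proof -
  have si: "set_integrable lborel {0..r} c" if "r \<le> T" for r
    using that by (intro borel_integrable_atLeastAtMost' continuous_on_subset[OF c]) auto
  have v: "v r = x + integral {0..r} c" if "r \<le> T" for r
    using set_borel_integral_eq_integral(2)[OF si[OF that]] by (simp add: v_def)
  have deriv: "(v has_vector_derivative c r) (at r within {0..T})" if "r \<in> {0..T}" for r
  proof (rule has_vector_derivative_transform[OF that])
    show "((\<lambda>r. x + integral {0..r} c) has_vector_derivative c r) (at r within {0..T})"
      using integral_has_vector_derivative[OF c that] by (auto intro!: derivative_eq_intros)
  qed (simp add: v)
  have cv: "continuous_on {0..T} v"
    unfolding continuous_on_eq_continuous_within using has_vector_derivative_continuous[OF deriv] by blast
  interpret h: bounded_bilinear "\<lambda>x y. x \<bullet> (Q *v y)" by (rule bounded_bilinear_matrix_form)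
  have "((\<lambda>r. v r \<bullet> (Q *v v r)) has_vector_derivative (v r \<bullet> (Q *v c r) + c r \<bullet> (Q *v v r))) (at r within {0..T})"
    if "r \<in> {0..T}" for r
    using h.has_vector_derivative[OF deriv[OF that] deriv[OF that]] .
  then have "((\<lambda>r. v r \<bullet> (Q *v c r) + c r \<bullet> (Q *v v r)) has_integral v T \<bullet> (Q *v v T) - v 0 \<bullet> (Q *v v 0)) {0..T}"
    by (intro fundamental_theorem_of_calculus T)
  then have "integral {0..T} (\<lambda>r. c r \<bullet> (Q *v v r) + v r \<bullet> (Q *v c r)) = v T \<bullet> (Q *v v T) - x \<bullet> (Q *v x)"
    using v[of 0] T by (simp add: integral_unique add.commute)
  moreover have "set_integrable lborel {0..T} (\<lambda>r. c r \<bullet> (Q *v v r) + v r \<bullet> (Q *v c r))"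
    by (intro borel_integrable_atLeastAtMost' continuous_intros c cv bounded_linear.continuous_on[OF matrix_vector_mul_bounded_linear])
  ultimately show ?thesis using set_borel_integral_eq_integral(2) by fastforce
qed

text \<open>
  The adjoint of the evolution of second moments: its quadratic form is the drift of
  \<open>X \<bullet> Q X\<close>.
\<close>

definition generator :: "real^'n^'n \<Rightarrow> real^'n^'n \<Rightarrow> real^'n^'n \<Rightarrow> real^'n^'n" where
  "generator D E Q = transpose D ** Q + Q ** D + transpose E ** Q ** E"

lemma generator_form:
  "y \<bullet> (generator D E Q *v y) = (D *v y) \<bullet> (Q *v y) + y \<bullet> (Q *v (D *v y)) + (E *v y) \<bullet> (Q *v (E *v y))"
  by (simp add: generator_def matrix_vector_mult_add_rdistrib inner_add_right matrix_vector_mul_assoc[symmetric]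
      inner_transpose_right del: matrix_vector_mul_assoc)

context brownian_motion
begin

interpretation time_space: pair_sigma_finite lborel M ..

lemma has_ito_integral_cong_AE:
  assumes I: "has_ito_integral M F W \<phi> T I" and I': "I' \<in> borel_measurable M" "AE \<omega> in M. I' \<omega> = I \<omega>"
  shows "has_ito_integral M F W \<phi> T I'"
proof -
  have "(\<integral>\<^sup>+\<omega>. ennreal ((norm (I' \<omega> - g \<omega>))\<^sup>2) \<partial>M) = (\<integral>\<^sup>+\<omega>. ennreal ((norm (I \<omega> - g \<omega>))\<^sup>2) \<partial>M)" for g
    using I'(2) by (intro nn_integral_cong_AE) auto
  then show ?thesis using I I'(1) unfolding has_ito_integral_def by simp
qed

lemma square_integrable_on_horizon_const:
  fixes \<xi> :: "'w \<Rightarrow> real^'n"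
  assumes "square_integrable M \<xi>"
  shows "square_integrable (lborel \<Otimes>\<^sub>M M) (on_horizon T (\<lambda>_. \<xi>))"
proof -
  have [measurable]: "\<xi> \<in> borel_measurable M" using assms by (simp add: square_integrable_def)
  have "integrable lborel (indicator {0..T} :: real \<Rightarrow> real)"
    by (cases "0 \<le> T") (auto intro!: integrable_real_indicator)
  then have "integrable (lborel \<Otimes>\<^sub>M M) (\<lambda>z. indicator {0..T} (fst z) * (norm (\<xi> (snd z)))\<^sup>2)"
    using assms by (intro tensor_integral) (auto simp: square_integrable_def)
  moreover have "(norm (on_horizon T (\<lambda>_. \<xi>) z))\<^sup>2 = indicator {0..T} (fst z) * (norm (\<xi> (snd z)))\<^sup>2" for z
    by (simp add: on_horizon_def split: split_indicator)
  moreover have "on_horizon T (\<lambda>_. \<xi>) \<in> borel_measurable (lborel \<Otimes>\<^sub>M M)"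
    unfolding on_horizon_def[abs_def] by measurable
  ultimately show ?thesis by (simp add: square_integrable_def)
qed

definition drift_part :: "real^'n^'n \<Rightarrow> (real \<Rightarrow> 'w \<Rightarrow> real^'n) \<Rightarrow> real \<Rightarrow> 'w \<Rightarrow> real^'n" where
  "drift_part D X t \<omega> = (LINT s:{0..t}|lborel. D *v X s \<omega>)"

lemma square_integrable_on_horizon_iff:
  assumes am: "adapted_measurable M F S X" "{0..T} \<subseteq> S"
  shows "square_integrable (lborel \<Otimes>\<^sub>M M) (on_horizon T X) \<longleftrightarrow>
    (\<integral>\<^sup>+\<omega>. (\<integral>\<^sup>+t\<in>{0..T}. ennreal ((norm (X t \<omega>))\<^sup>2) \<partial>lborel) \<partial>M) < \<infinity>"
proof -
  have [measurable]: "on_horizon T X \<in> borel_measurable (lborel \<Otimes>\<^sub>M M)" by (rule on_horizon_measurable[OF am])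
  have "ennreal ((norm (X t \<omega>))\<^sup>2) * indicator {0..T} t = ennreal ((norm (on_horizon T X (t, \<omega>)))\<^sup>2)" for t \<omega>
    by (simp add: on_horizon_def split: split_indicator)
  then show ?thesis
    by (subst square_integrable_iff_nn) (simp_all add: time_space.nn_integral_snd[symmetric])
qed

lemma drift_part_measurable:
  assumes am: "adapted_measurable M F {0..} X"
  shows "(\<lambda>z. drift_part D X (min T (fst z)) (snd z)) \<in> borel_measurable (lborel \<Otimes>\<^sub>M M)"
proof -
  have [measurable]: "on_horizon T X \<in> borel_measurable (lborel \<Otimes>\<^sub>M M)" by (rule on_horizon_measurable[OF am]) auto
  have "(\<lambda>z. on_horizon T X (snd z, snd (fst z))) \<in> borel_measurable ((lborel \<Otimes>\<^sub>M M) \<Otimes>\<^sub>M lborel)"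
    by measurable
  then have [measurable]: "(\<lambda>z. D *v on_horizon T X (snd z, snd (fst z))) \<in> borel_measurable ((lborel \<Otimes>\<^sub>M M) \<Otimes>\<^sub>M lborel)"
    by (rule measurable_matrix_vector_mult)
  have "(\<lambda>z. \<integral>s. (if 0 \<le> s \<and> s \<le> fst z then D *v on_horizon T X (s, snd z) else 0) \<partial>lborel) \<in> borel_measurable (lborel \<Otimes>\<^sub>M M)"
    by (rule lborel.borel_measurable_lebesgue_integral) (simp add: split_beta', measurable)
  also have "(\<lambda>z. \<integral>s. (if 0 \<le> s \<and> s \<le> fst z then D *v on_horizon T X (s, snd z) else 0) \<partial>lborel)
      = (\<lambda>z. drift_part D X (min T (fst z)) (snd z))"
    unfolding drift_part_def set_lebesgue_integral_def on_horizon_def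
    by (intro ext Bochner_Integration.integral_cong refl) (auto split: split_indicator)
  finally show ?thesis .
qed

lemma drift_part_measurable_M:
  assumes am: "adapted_measurable M F {0..} X"
  shows "drift_part D X T \<in> borel_measurable M"
proof -
  have "(\<lambda>\<omega>. drift_part D X (min T (fst (T, \<omega>))) (snd (T, \<omega>))) \<in> borel_measurable M"
    by (rule measurable_compose[OF _ drift_part_measurable[OF am]]) simp
  then show ?thesis by simp
qed

text \<open>
  The bound does not depend on \<open>r\<close>, so it gives square integrability of the drift part both
  at fixed times and over time and probability space jointly.
\<close>

lemma drift_part_bound:
  assumes am: "adapted_measurable M F {0..} X" and r: "0 \<le> r" "r \<le> T" and w: "\<omega> \<in> space M"
  shows "ennreal ((norm (drift_part D X r \<omega>))\<^sup>2)
    \<le> ennreal T * (\<integral>\<^sup>+s. ennreal ((norm (D *v on_horizon T X (s, \<omega>)))\<^sup>2) \<partial>lborel)"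
proof -
  have [measurable]: "on_horizon r X \<in> borel_measurable (lborel \<Otimes>\<^sub>M M)" by (rule on_horizon_measurable[OF am]) auto
  have "(\<lambda>s. on_horizon r X (s, \<omega>)) \<in> borel_measurable lborel" using w by measurable
  then have m: "(\<lambda>s. D *v on_horizon r X (s, \<omega>)) \<in> borel_measurable lborel" by (rule measurable_matrix_vector_mult)
  have "drift_part D X r \<omega> = (\<integral>s. D *v on_horizon r X (s, \<omega>) \<partial>lborel)"
    unfolding drift_part_def set_lebesgue_integral_def on_horizon_def
    by (intro Bochner_Integration.integral_cong refl) (simp add: matrix_vector_mult_scaleR)
  then have "ennreal ((norm (drift_part D X r \<omega>))\<^sup>2)
    \<le> ennreal r * (\<integral>\<^sup>+s. ennreal ((norm (D *v on_horizon r X (s, \<omega>)))\<^sup>2) \<partial>lborel)"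
    using norm_integral_sq_le[OF m r(1)] by (simp add: on_horizon_def)
  also have "\<dots> \<le> ennreal T * (\<integral>\<^sup>+s. ennreal ((norm (D *v on_horizon T X (s, \<omega>)))\<^sup>2) \<partial>lborel)"
    using r by (intro mult_mono nn_integral_mono ennreal_leI)
      (auto simp: on_horizon_def split: split_indicator)
  finally show ?thesis .
qed

lemma drift_part_energy:
  assumes am: "adapted_measurable M F {0..} X" and sq: "square_integrable (lborel \<Otimes>\<^sub>M M) (on_horizon T X)"
  shows "(\<integral>\<^sup>+\<omega>. (\<integral>\<^sup>+s. ennreal ((norm (D *v on_horizon T X (s, \<omega>)))\<^sup>2) \<partial>lborel) \<partial>M) < \<infinity>"
proof -
  have DX: "square_integrable (lborel \<Otimes>\<^sub>M M) (\<lambda>z. D *v on_horizon T X z)"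
    by (rule square_integrable_linear[OF matrix_vector_mul_bounded_linear sq])
  have [measurable]: "(\<lambda>z. D *v on_horizon T X z) \<in> borel_measurable (lborel \<Otimes>\<^sub>M M)"
    by (rule square_integrable_measurable[OF DX])
  have "(\<integral>\<^sup>+\<omega>. (\<integral>\<^sup>+s. ennreal ((norm (D *v on_horizon T X (s, \<omega>)))\<^sup>2) \<partial>lborel) \<partial>M)
    = (\<integral>\<^sup>+z. ennreal ((norm (D *v on_horizon T X z))\<^sup>2) \<partial>(lborel \<Otimes>\<^sub>M M))"
    by (rule time_space.nn_integral_snd) measurable
  also have "\<dots> < \<infinity>" using DX square_integrable_iff_nn square_integrable_measurable by blast
  finally show ?thesis .
qed

lemma drift_part_square_integrable:
  assumes am: "adapted_measurable M F {0..} X" and sq: "square_integrable (lborel \<Otimes>\<^sub>M M) (on_horizon T X)"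
    and T: "0 \<le> T"
  shows "square_integrable M (drift_part D X T)" "square_integrable (lborel \<Otimes>\<^sub>M M) (on_horizon T (drift_part D X))"
proof -
  note [measurable] = drift_part_measurable_M[OF am]
  have [measurable]: "(\<lambda>z. D *v on_horizon T X z) \<in> borel_measurable (lborel \<Otimes>\<^sub>M M)"
    by (rule measurable_matrix_vector_mult) (rule square_integrable_measurable[OF sq])
  define e where "e \<omega> = (\<integral>\<^sup>+s. ennreal ((norm (D *v on_horizon T X (s, \<omega>)))\<^sup>2) \<partial>lborel)" for \<omega>
  have em [measurable]: "e \<in> borel_measurable M" unfolding e_def by measurable
  have e: "(\<integral>\<^sup>+\<omega>. e \<omega> \<partial>M) < \<infinity>" using drift_part_energy[OF am sq] by (simp add: e_def)
  have "(\<integral>\<^sup>+\<omega>. ennreal ((norm (drift_part D X T \<omega>))\<^sup>2) \<partial>M) \<le> (\<integral>\<^sup>+\<omega>. ennreal T * e \<omega> \<partial>M)"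
    unfolding e_def by (intro nn_integral_mono drift_part_bound[OF am T]) auto
  also have "\<dots> < \<infinity>" using e by (simp add: nn_integral_cmult ennreal_mult_less_top)
  finally show "square_integrable M (drift_part D X T)" by (simp add: square_integrable_iff_nn)
  have eq: "on_horizon T (drift_part D X) = (\<lambda>z. indicator {0..T} (fst z) *\<^sub>R drift_part D X (min T (fst z)) (snd z))"
    by (auto simp: on_horizon_def fun_eq_iff split: split_indicator)
  have m [measurable]: "on_horizon T (drift_part D X) \<in> borel_measurable (lborel \<Otimes>\<^sub>M M)"
    unfolding eq using drift_part_measurable[OF am, of D T] by measurable
  have "(\<integral>\<^sup>+z. ennreal ((norm (on_horizon T (drift_part D X) z))\<^sup>2) \<partial>(lborel \<Otimes>\<^sub>M M))
    = (\<integral>\<^sup>+\<omega>. \<integral>\<^sup>+r. ennreal ((norm (on_horizon T (drift_part D X) (r, \<omega>)))\<^sup>2) \<partial>lborel \<partial>M)"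
    by (rule time_space.nn_integral_snd[symmetric]) measurable
  also have "\<dots> \<le> (\<integral>\<^sup>+\<omega>. \<integral>\<^sup>+r. (ennreal T * e \<omega>) * indicator {0..T} r \<partial>lborel \<partial>M)"
  proof (intro nn_integral_mono)
    fix \<omega> r assume "\<omega> \<in> space M"
    then show "ennreal ((norm (on_horizon T (drift_part D X) (r, \<omega>)))\<^sup>2) \<le> (ennreal T * e \<omega>) * indicator {0..T} r"
      using drift_part_bound[OF am, of r T \<omega> D] by (auto simp: on_horizon_def e_def split: split_indicator)
  qed
  also have "\<dots> = (\<integral>\<^sup>+\<omega>. (ennreal T * e \<omega>) * ennreal T \<partial>M)"
    using T by (simp add: nn_integral_cmult)
  also have "\<dots> < \<infinity>" using e by (simp add: nn_integral_cmult nn_integral_multc ennreal_mult_less_top)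
  finally show "square_integrable (lborel \<Otimes>\<^sub>M M) (on_horizon T (drift_part D X))"
    by (simp add: square_integrable_iff_nn)
qed


text \<open>
  What remains of \<open>X\<close> after the initial value and the drift. For a solution it is a version
  of the Ito integral at every time; unlike the integrals chosen time by time it is a single jointly
  measurable process.
\<close>

definition noise_part :: "real^'n^'n \<Rightarrow> real^'n \<Rightarrow> (real \<Rightarrow> 'w \<Rightarrow> real^'n) \<Rightarrow> real \<Rightarrow> 'w \<Rightarrow> real^'n" where
  "noise_part D x X t \<omega> = X t \<omega> - (x + drift_part D X t \<omega>)"

lemma sde_solution_parts:
  assumes sol: "sde_solution M F W D E x X" and t: "0 \<le> t"
  shows "square_integrable (lborel \<Otimes>\<^sub>M M) (on_horizon t X)"
    and "has_ito_integral M F W (\<lambda>s \<omega>. E *v X s \<omega>) t (noise_part D x X t)"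
    and "X t \<in> borel_measurable (F t)" "square_integrable M (X t)"
proof -
  have am: "adapted_measurable M F {0..} X" using sol by (simp add: sde_solution_def)
  show sq: "square_integrable (lborel \<Otimes>\<^sub>M M) (on_horizon t X)"
    using sol t by (subst square_integrable_on_horizon_iff[OF am]) (auto simp: sde_solution_def)
  show XF: "X t \<in> borel_measurable (F t)" using am t by (auto simp: adapted_measurable_def)
  obtain I where I: "has_ito_integral M F W (\<lambda>s \<omega>. E *v X s \<omega>) t I"
    "AE \<omega> in M. X t \<omega> = x + (LINT s:{0..t}|lborel. D *v X s \<omega>) + I \<omega>"
    using sol t unfolding sde_solution_def by blast
  have dm [measurable]: "drift_part D X t \<in> borel_measurable M" by (rule drift_part_measurable_M[OF am])
  have Xm [measurable]: "X t \<in> borel_measurable M" by (rule measurable_F_M[OF XF])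
  have nm: "noise_part D x X t \<in> borel_measurable M" unfolding noise_part_def[abs_def] by measurable
  show ni: "has_ito_integral M F W (\<lambda>s \<omega>. E *v X s \<omega>) t (noise_part D x X t)"
    by (rule has_ito_integral_cong_AE[OF I(1) nm]) (use I(2) in \<open>auto simp: noise_part_def drift_part_def\<close>)
  have "square_integrable M (\<lambda>\<omega>. (x + drift_part D X t \<omega>) + noise_part D x X t \<omega>)"
    by (intro square_integrable_add square_integrable_const drift_part_square_integrable[OF am sq t]
        has_ito_integral_square_integrable[OF ni])
  then show "square_integrable M (X t)" by (simp add: noise_part_def)
qed

text \<open>
  By the martingale property the time may be replaced by \<open>0\<close>, where the isometry makes the
  integral vanish.
\<close>

lemma noise_part_mean_zero:
  fixes Q :: "real^'n^'n" and x :: "real^'n"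
  assumes sol: "sde_solution M F W D E x X" and t: "0 \<le> t"
  shows "(\<integral>\<omega>. c \<bullet> (Q *v noise_part D x X t \<omega>) \<partial>M) = 0"
proof -
  let ?N = "noise_part D x X"
  note N0 = sde_solution_parts(2)[OF sol order_refl] and Nt = sde_solution_parts(2)[OF sol t]
  have "AE z in lborel \<Otimes>\<^sub>M M. on_horizon 0 (\<lambda>s \<omega>. E *v X s \<omega>) z = 0"
  proof (rule time_space.AE_pair_measure)
    have "on_horizon 0 (\<lambda>s \<omega>. E *v X s \<omega>) \<in> borel_measurable (lborel \<Otimes>\<^sub>M M)"
      using has_ito_integral_square_integrable[OF N0] by (simp add: square_integrable_def)
    then show "{z \<in> space (lborel \<Otimes>\<^sub>M M). on_horizon 0 (\<lambda>s \<omega>. E *v X s \<omega>) z = 0} \<in> sets (lborel \<Otimes>\<^sub>M M)"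
      by measurable
    have "AE s in lborel. s \<noteq> (0::real)" by (rule AE_lborel_singleton)
    then show "AE s in lborel. AE \<omega> in M. on_horizon 0 (\<lambda>s \<omega>. E *v X s \<omega>) (s, \<omega>) = 0"
      by eventually_elim (simp add: on_horizon_def)
  qed
  then have "(\<integral>z. on_horizon 0 (\<lambda>s \<omega>. E *v X s \<omega>) z \<bullet> (mat 1 *v on_horizon 0 (\<lambda>s \<omega>. E *v X s \<omega>) z) \<partial>(lborel \<Otimes>\<^sub>M M)) = 0"
    by (intro integral_eq_zero_AE) auto
  then have "(\<integral>\<omega>. (norm (?N 0 \<omega>))\<^sup>2 \<partial>M) = 0"
    using ito_isometry[OF N0, of "mat 1"] by (simp add: power2_norm_eq_inner)
  moreover have "integrable M (\<lambda>\<omega>. (norm (?N 0 \<omega>))\<^sup>2)"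
    using has_ito_integral_square_integrable(2)[OF N0] by (simp add: square_integrable_def)
  ultimately have "AE \<omega> in M. ?N 0 \<omega> = 0"
    by (subst (asm) integral_nonneg_eq_0_iff_AE) auto
  then have "(\<integral>\<omega>. c \<bullet> (Q *v ?N 0 \<omega>) \<partial>M) = 0" by (intro integral_eq_zero_AE) auto
  then show ?thesis
    using ito_martingale[OF order_refl t N0 Nt, of "\<lambda>_. c" Q] by simp
qed

text \<open>
  The drift part is an integral over times \<open>r \<le> t\<close>. After an exchange of integrals the
  noise at time \<open>t\<close> is tested against \<open>D X r\<close>, which is known at time
  \<open>r\<close>, so the martingale property replaces it by the noise at time \<open>r\<close>.
\<close>

lemma drift_noise_product:
  assumes sol: "sde_solution M F W D E x X" and t: "0 \<le> t"
  shows "(\<integral>\<omega>. drift_part D X t \<omega> \<bullet> (Q *v noise_part D x X t \<omega>) \<partial>M)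
    = (\<integral>z. (D *v on_horizon t X z) \<bullet> (Q *v on_horizon t (noise_part D x X) z) \<partial>(lborel \<Otimes>\<^sub>M M))"
proof -
  let ?N = "noise_part D x X"
  have am: "adapted_measurable M F {0..} X" using sol by (simp add: sde_solution_def)
  note sq = sde_solution_parts(1)[OF sol t]
  have DX: "square_integrable (lborel \<Otimes>\<^sub>M M) (\<lambda>z. D *v on_horizon t X z)"
    by (rule square_integrable_linear[OF matrix_vector_mul_bounded_linear sq])
  note Nt = has_ito_integral_square_integrable(2)[OF sde_solution_parts(2)[OF sol t]]
  define G where "G r \<omega> = (D *v on_horizon t X (r, \<omega>)) \<bullet> (Q *v ?N t \<omega>)" for r \<omega>
  have intG: "integrable (lborel \<Otimes>\<^sub>M M) (case_prod G)"
  proof -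
    have "integrable (lborel \<Otimes>\<^sub>M M) (\<lambda>z. (D *v on_horizon t X z) \<bullet> (Q *v on_horizon t (\<lambda>_. ?N t) z))"
      by (rule square_integrable_bilinear[OF bounded_bilinear_matrix_form DX square_integrable_on_horizon_const[OF Nt]])
    also have "(\<lambda>z. (D *v on_horizon t X z) \<bullet> (Q *v on_horizon t (\<lambda>_. ?N t) z)) = case_prod G"
      by (auto simp: fun_eq_iff G_def on_horizon_def split: split_indicator)
    finally show ?thesis .
  qed
  have "(\<integral>\<omega>. drift_part D X t \<omega> \<bullet> (Q *v ?N t \<omega>) \<partial>M) = (\<integral>\<omega>. (\<integral>r. G r \<omega> \<partial>lborel) \<partial>M)"
  proof (rule integral_cong_AE)
    show "(\<lambda>\<omega>. drift_part D X t \<omega> \<bullet> (Q *v ?N t \<omega>)) \<in> borel_measurable M"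
      using drift_part_measurable_M[OF am] measurable_matrix_vector_mult[OF square_integrable_measurable[OF Nt]]
      by (rule borel_measurable_inner)
    show "(\<lambda>\<omega>. \<integral>r. G r \<omega> \<partial>lborel) \<in> borel_measurable M"
      using time_space.integrable_snd[OF intG] by (rule borel_measurable_integrable)
    have "AE \<omega> in M. continuous_on {0..} (\<lambda>t. X t \<omega>)" using sol by (simp add: sde_solution_def)
    then show "AE \<omega> in M. drift_part D X t \<omega> \<bullet> (Q *v ?N t \<omega>) = (\<integral>r. G r \<omega> \<partial>lborel)"
    proof eventually_elim
      case (elim \<omega>)
      have "continuous_on {0..t} (\<lambda>s. D *v X s \<omega>)"
        by (intro bounded_linear.continuous_on[OF matrix_vector_mul_bounded_linear] continuous_on_subset[OF elim]) auto
      then have "set_integrable lborel {0..t} (\<lambda>s. D *v X s \<omega>)" by (rule borel_integrable_atLeastAtMost')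
      then have i: "integrable lborel (\<lambda>s. indicator {0..t} s *\<^sub>R (D *v X s \<omega>))" by (simp add: set_integrable_def)
      have "drift_part D X t \<omega> \<bullet> (Q *v ?N t \<omega>) = (\<integral>s. (indicator {0..t} s *\<^sub>R (D *v X s \<omega>)) \<bullet> (Q *v ?N t \<omega>) \<partial>lborel)"
        unfolding drift_part_def set_lebesgue_integral_def by (rule integral_inner_left[symmetric]) (rule i)
      also have "\<dots> = (\<integral>r. G r \<omega> \<partial>lborel)"
        by (simp add: G_def on_horizon_def matrix_vector_mult_scaleR)
      finally show ?case .
    qed
  qed
  also have "\<dots> = (\<integral>r. (\<integral>\<omega>. G r \<omega> \<partial>M) \<partial>lborel)" by (rule time_space.Fubini_integral[OF intG])
  also have "\<dots> = (\<integral>r. (\<integral>\<omega>. (D *v on_horizon t X (r, \<omega>)) \<bullet> (Q *v on_horizon t ?N (r, \<omega>)) \<partial>M) \<partial>lborel)"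
  proof (rule Bochner_Integration.integral_cong[OF refl])
    fix r
    show "(\<integral>\<omega>. G r \<omega> \<partial>M) = (\<integral>\<omega>. (D *v on_horizon t X (r, \<omega>)) \<bullet> (Q *v on_horizon t ?N (r, \<omega>)) \<partial>M)"
    proof (cases "r \<in> {0..t}")
      case False
      then show ?thesis by (simp add: G_def on_horizon_def)
    next
      case True
      then have r: "0 \<le> r" "r \<le> t" by auto
      have "(\<lambda>\<omega>. D *v X r \<omega>) \<in> borel_measurable (F r)"
        by (rule measurable_matrix_vector_mult[OF sde_solution_parts(3)[OF sol r(1)]])
      moreover have "square_integrable M (\<lambda>\<omega>. D *v X r \<omega>)"
        by (rule square_integrable_linear[OF matrix_vector_mul_bounded_linear sde_solution_parts(4)[OF sol r(1)]])
      ultimately have "(\<integral>\<omega>. (D *v X r \<omega>) \<bullet> (Q *v ?N t \<omega>) \<partial>M) = (\<integral>\<omega>. (D *v X r \<omega>) \<bullet> (Q *v ?N r \<omega>) \<partial>M)"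
        by (rule ito_martingale[OF r sde_solution_parts(2)[OF sol r(1)] sde_solution_parts(2)[OF sol t]])
      then show ?thesis using True by (simp add: G_def on_horizon_def)
    qed
  qed
  also have "\<dots> = (\<integral>z. (D *v on_horizon t X z) \<bullet> (Q *v on_horizon t ?N z) \<partial>(lborel \<Otimes>\<^sub>M M))"
  proof -
    have "square_integrable (lborel \<Otimes>\<^sub>M M) (on_horizon t (\<lambda>_ _. x))"
      by (rule square_integrable_on_horizon_const) simp
    then have "square_integrable (lborel \<Otimes>\<^sub>M M) (\<lambda>z. on_horizon t X z - (on_horizon t (\<lambda>_ _. x) z + on_horizon t (drift_part D X) z))"
      by (intro square_integrable_diff square_integrable_add sq drift_part_square_integrable[OF am sq t])
    also have "(\<lambda>z. on_horizon t X z - (on_horizon t (\<lambda>_ _. x) z + on_horizon t (drift_part D X) z)) = on_horizon t ?N"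
      by (auto simp: fun_eq_iff on_horizon_def noise_part_def split: split_indicator)
    finally have "integrable (lborel \<Otimes>\<^sub>M M) (\<lambda>z. (D *v on_horizon t X z) \<bullet> (Q *v on_horizon t ?N z))"
      by (rule square_integrable_bilinear[OF bounded_bilinear_matrix_form DX])
    from time_space.integral_fst'[OF this] show ?thesis by simp
  qed
  finally show ?thesis .
qed


text \<open>
  The paths are almost surely continuous, so the drift part is continuously differentiable in time and the
  fundamental theorem of calculus applies path by path.
\<close>

lemma quadratic_drift_integral:
  assumes sol: "sde_solution M F W D E x X" and t: "0 \<le> t"
  defines "A \<equiv> on_horizon t (\<lambda>r \<omega>. x + drift_part D X r \<omega>)"
  shows "(\<integral>\<omega>. (x + drift_part D X t \<omega>) \<bullet> (Q *v (x + drift_part D X t \<omega>)) \<partial>M)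
    = x \<bullet> (Q *v x) + (\<integral>z. (D *v on_horizon t X z) \<bullet> (Q *v A z) + A z \<bullet> (Q *v (D *v on_horizon t X z)) \<partial>(lborel \<Otimes>\<^sub>M M))"
proof -
  let ?V = "\<lambda>r \<omega>. x + drift_part D X r \<omega>"
  have am: "adapted_measurable M F {0..} X" using sol by (simp add: sde_solution_def)
  note sq = sde_solution_parts(1)[OF sol t]
  have DX: "square_integrable (lborel \<Otimes>\<^sub>M M) (\<lambda>z. D *v on_horizon t X z)"
    by (rule square_integrable_linear[OF matrix_vector_mul_bounded_linear sq])
  have "square_integrable (lborel \<Otimes>\<^sub>M M) (\<lambda>z. on_horizon t (\<lambda>_ _. x) z + on_horizon t (drift_part D X) z)"
    by (intro square_integrable_add square_integrable_on_horizon_const square_integrable_const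
        drift_part_square_integrable[OF am sq t])
  also have "(\<lambda>z. on_horizon t (\<lambda>_ _. x) z + on_horizon t (drift_part D X) z) = A"
    by (auto simp: fun_eq_iff A_def on_horizon_def split: split_indicator)
  finally have A: "square_integrable (lborel \<Otimes>\<^sub>M M) A" .
  define H where "H r \<omega> = (D *v on_horizon t X (r, \<omega>)) \<bullet> (Q *v A (r, \<omega>)) + A (r, \<omega>) \<bullet> (Q *v (D *v on_horizon t X (r, \<omega>)))" for r \<omega>
  have "integrable (lborel \<Otimes>\<^sub>M M) (\<lambda>z. (D *v on_horizon t X z) \<bullet> (Q *v A z) + A z \<bullet> (Q *v (D *v on_horizon t X z)))"
    by (intro Bochner_Integration.integrable_add square_integrable_bilinear[OF bounded_bilinear_matrix_form] DX A)
  then have iH: "integrable (lborel \<Otimes>\<^sub>M M) (case_prod H)" by (simp add: H_def split_beta')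
  have sqV: "square_integrable M (?V t)"
    by (intro square_integrable_add square_integrable_const drift_part_square_integrable[OF am sq t])
  have "(\<integral>\<omega>. ?V t \<omega> \<bullet> (Q *v ?V t \<omega>) \<partial>M) = (\<integral>\<omega>. x \<bullet> (Q *v x) + (\<integral>r. H r \<omega> \<partial>lborel) \<partial>M)"
  proof (rule integral_cong_AE)
    show "(\<lambda>\<omega>. ?V t \<omega> \<bullet> (Q *v ?V t \<omega>)) \<in> borel_measurable M"
      using square_integrable_bilinear[OF bounded_bilinear_matrix_form sqV sqV] by (rule borel_measurable_integrable)
    have [measurable]: "(\<lambda>\<omega>. \<integral>r. H r \<omega> \<partial>lborel) \<in> borel_measurable M"
      using time_space.integrable_snd[OF iH] by (rule borel_measurable_integrable)
    show "(\<lambda>\<omega>. x \<bullet> (Q *v x) + (\<integral>r. H r \<omega> \<partial>lborel)) \<in> borel_measurable M" by measurable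
    have "AE \<omega> in M. continuous_on {0..} (\<lambda>t. X t \<omega>)" using sol by (simp add: sde_solution_def)
    then show "AE \<omega> in M. ?V t \<omega> \<bullet> (Q *v ?V t \<omega>) = x \<bullet> (Q *v x) + (\<integral>r. H r \<omega> \<partial>lborel)"
    proof eventually_elim
      case (elim \<omega>)
      have c: "continuous_on {0..t} (\<lambda>s. D *v X s \<omega>)"
        by (intro bounded_linear.continuous_on[OF matrix_vector_mul_bounded_linear] continuous_on_subset[OF elim]) auto
      have "(LINT r:{0..t}|lborel. (D *v X r \<omega>) \<bullet> (Q *v ?V r \<omega>) + ?V r \<omega> \<bullet> (Q *v (D *v X r \<omega>))) = (\<integral>r. H r \<omega> \<partial>lborel)"
        unfolding set_lebesgue_integral_def H_def A_def on_horizon_def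
        by (intro Bochner_Integration.integral_cong refl) (auto split: split_indicator)
      then show ?case using quadratic_form_primitive[OF c t, of x Q] by (simp add: drift_part_def)
    qed
  qed
  also have "\<dots> = x \<bullet> (Q *v x) + (\<integral>\<omega>. (\<integral>r. H r \<omega> \<partial>lborel) \<partial>M)"
    using time_space.integrable_snd[OF iH] by (simp add: prob_space)
  also have "(\<integral>\<omega>. (\<integral>r. H r \<omega> \<partial>lborel) \<partial>M) = (\<integral>z. case_prod H z \<partial>(lborel \<Otimes>\<^sub>M M))"
    using time_space.integral_snd[OF iH] by simp
  finally show ?thesis by (simp add: H_def split_beta')
qed

text \<open>
  Ito's formula for \<open>X \<bullet> Q X\<close>, in expectation. Write \<open>X\<close> as the sum of a
  part \<open>V\<close> that is smooth in time and the noise \<open>N\<close>. The square of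
  \<open>V\<close> is a matter of calculus, the mixed products are integrals of products of drift and
  noise, and the square of \<open>N\<close> is given by the isometry; the sum is the integral of the
  generator.
\<close>

lemma second_moment_identity:
  assumes sol: "sde_solution M F W D E x X" and t: "0 \<le> t"
  shows "(\<integral>\<omega>. X t \<omega> \<bullet> (Q *v X t \<omega>) \<partial>M)
    = x \<bullet> (Q *v x) + (\<integral>z. on_horizon t X z \<bullet> (generator D E Q *v on_horizon t X z) \<partial>(lborel \<Otimes>\<^sub>M M))"
proof -
  let ?N = "noise_part D x X" and ?L = "lborel \<Otimes>\<^sub>M M"
  let ?V = "\<lambda>r \<omega>. x + drift_part D X r \<omega>"
  define A where "A = on_horizon t ?V"
  define R where "R = on_horizon t ?N"
  define Z where "Z = on_horizon t X"
  note form = square_integrable_bilinear[OF bounded_bilinear_matrix_form]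
  have am: "adapted_measurable M F {0..} X" using sol by (simp add: sde_solution_def)
  have sqZ: "square_integrable ?L Z" using sde_solution_parts(1)[OF sol t] by (simp add: Z_def)
  have DZ: "square_integrable ?L (\<lambda>z. D *v Z z)" and EZ: "square_integrable ?L (\<lambda>z. E *v Z z)"
    by (intro square_integrable_linear[OF matrix_vector_mul_bounded_linear sqZ])+
  have "square_integrable ?L (\<lambda>z. on_horizon t (\<lambda>_ _. x) z + on_horizon t (drift_part D X) z)"
    by (intro square_integrable_add square_integrable_on_horizon_const square_integrable_const
        drift_part_square_integrable[OF am sqZ[unfolded Z_def] t])
  also have "(\<lambda>z. on_horizon t (\<lambda>_ _. x) z + on_horizon t (drift_part D X) z) = A"
    by (auto simp: fun_eq_iff A_def on_horizon_def split: split_indicator)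
  finally have sqA: "square_integrable ?L A" .
  have ZAR: "Z z = A z + R z" for z
    by (auto simp: Z_def A_def R_def on_horizon_def noise_part_def split: split_indicator)
  have "square_integrable ?L (\<lambda>z. Z z - A z)" by (intro square_integrable_diff sqZ sqA)
  then have sqR: "square_integrable ?L R" by (simp add: ZAR)
  have sqV: "square_integrable M (drift_part D X t)"
    by (rule drift_part_square_integrable[OF am sqZ[unfolded Z_def] t])
  have sqN: "square_integrable M (?N t)"
    by (rule has_ito_integral_square_integrable(2)[OF sde_solution_parts(2)[OF sol t]])
  have sqW: "square_integrable M (?V t)" by (intro square_integrable_add square_integrable_const sqV)
  \<comment> \<open>The four terms of the quadratic form of \<open>X = V + N\<close>.\<close>
  have VN: "(\<integral>\<omega>. ?V t \<omega> \<bullet> (P *v ?N t \<omega>) \<partial>M) = (\<integral>z. (D *v Z z) \<bullet> (P *v R z) \<partial>?L)" for P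
  proof -
    have "(\<integral>\<omega>. ?V t \<omega> \<bullet> (P *v ?N t \<omega>) \<partial>M) = (\<integral>\<omega>. x \<bullet> (P *v ?N t \<omega>) \<partial>M) + (\<integral>\<omega>. drift_part D X t \<omega> \<bullet> (P *v ?N t \<omega>) \<partial>M)"
      using form[OF square_integrable_const sqN, of x P] form[OF sqV sqN, of P] by (simp add: inner_add_left)
    then show ?thesis using noise_part_mean_zero[OF sol t, of x P] drift_noise_product[OF sol t, of P]
      by (simp add: Z_def R_def)
  qed
  have NV: "(\<integral>\<omega>. ?N t \<omega> \<bullet> (Q *v ?V t \<omega>) \<partial>M) = (\<integral>z. R z \<bullet> (Q *v (D *v Z z)) \<partial>?L)"
    using VN[of "transpose Q"] by (simp add: inner_transpose_right inner_commute)
  have VV: "(\<integral>\<omega>. ?V t \<omega> \<bullet> (Q *v ?V t \<omega>) \<partial>M) = x \<bullet> (Q *v x) + (\<integral>z. (D *v Z z) \<bullet> (Q *v A z) + A z \<bullet> (Q *v (D *v Z z)) \<partial>?L)"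
    using quadratic_drift_integral[OF sol t, of Q] by (simp add: A_def Z_def)
  have NN: "(\<integral>\<omega>. ?N t \<omega> \<bullet> (Q *v ?N t \<omega>) \<partial>M) = (\<integral>z. (E *v Z z) \<bullet> (Q *v (E *v Z z)) \<partial>?L)"
    using ito_isometry[OF sde_solution_parts(2)[OF sol t], of Q]
    by (simp add: on_horizon_def Z_def matrix_vector_mult_scaleR)
  have "(\<integral>\<omega>. X t \<omega> \<bullet> (Q *v X t \<omega>) \<partial>M)
    = (\<integral>\<omega>. ?V t \<omega> \<bullet> (Q *v ?V t \<omega>) + ?V t \<omega> \<bullet> (Q *v ?N t \<omega>) + ?N t \<omega> \<bullet> (Q *v ?V t \<omega>) + ?N t \<omega> \<bullet> (Q *v ?N t \<omega>) \<partial>M)"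
  proof (rule Bochner_Integration.integral_cong[OF refl])
    fix \<omega>
    have "X t \<omega> = ?V t \<omega> + ?N t \<omega>" by (simp add: noise_part_def)
    then show "X t \<omega> \<bullet> (Q *v X t \<omega>) = ?V t \<omega> \<bullet> (Q *v ?V t \<omega>) + ?V t \<omega> \<bullet> (Q *v ?N t \<omega>) + ?N t \<omega> \<bullet> (Q *v ?V t \<omega>) + ?N t \<omega> \<bullet> (Q *v ?N t \<omega>)"
      by (simp only: inner_add_left inner_add_right matrix_vector_right_distrib)
  qed
  also have "\<dots> = (\<integral>\<omega>. ?V t \<omega> \<bullet> (Q *v ?V t \<omega>) \<partial>M) + (\<integral>\<omega>. ?V t \<omega> \<bullet> (Q *v ?N t \<omega>) \<partial>M)
      + (\<integral>\<omega>. ?N t \<omega> \<bullet> (Q *v ?V t \<omega>) \<partial>M) + (\<integral>\<omega>. ?N t \<omega> \<bullet> (Q *v ?N t \<omega>) \<partial>M)"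
    using form[OF sqW sqW, of Q] form[OF sqW sqN, of Q] form[OF sqN sqW, of Q] form[OF sqN sqN, of Q]
    by (simp only: Bochner_Integration.integral_add Bochner_Integration.integrable_add)
  also have "\<dots> = x \<bullet> (Q *v x) + (\<integral>z. ((D *v Z z) \<bullet> (Q *v A z) + A z \<bullet> (Q *v (D *v Z z)))
      + (D *v Z z) \<bullet> (Q *v R z) + R z \<bullet> (Q *v (D *v Z z)) + (E *v Z z) \<bullet> (Q *v (E *v Z z)) \<partial>?L)"
    unfolding VV VN NV NN
    using form[OF DZ sqA, of Q] form[OF sqA DZ, of Q] form[OF DZ sqR, of Q] form[OF sqR DZ, of Q] form[OF EZ EZ, of Q]
    by (simp only: Bochner_Integration.integral_add Bochner_Integration.integrable_add add.assoc)
  also have "(\<integral>z. ((D *v Z z) \<bullet> (Q *v A z) + A z \<bullet> (Q *v (D *v Z z)))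
      + (D *v Z z) \<bullet> (Q *v R z) + R z \<bullet> (Q *v (D *v Z z)) + (E *v Z z) \<bullet> (Q *v (E *v Z z)) \<partial>?L)
    = (\<integral>z. Z z \<bullet> (generator D E Q *v Z z) \<partial>?L)"
  proof (rule Bochner_Integration.integral_cong[OF refl])
    fix z
    have "(D *v Z z) \<bullet> (Q *v Z z) = (D *v Z z) \<bullet> (Q *v A z) + (D *v Z z) \<bullet> (Q *v R z)"
      by (subst (2) ZAR) (simp only: inner_add_right matrix_vector_right_distrib)
    moreover have "Z z \<bullet> (Q *v (D *v Z z)) = A z \<bullet> (Q *v (D *v Z z)) + R z \<bullet> (Q *v (D *v Z z))"
      by (subst (1) ZAR) (simp only: inner_add_left)
    ultimately show "((D *v Z z) \<bullet> (Q *v A z) + A z \<bullet> (Q *v (D *v Z z)))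
      + (D *v Z z) \<bullet> (Q *v R z) + R z \<bullet> (Q *v (D *v Z z)) + (E *v Z z) \<bullet> (Q *v (E *v Z z))
      = Z z \<bullet> (generator D E Q *v Z z)" unfolding generator_form by linarith
  qed
  finally show ?thesis by (simp add: Z_def)
qed

end

section \<open>The Lyapunov criterion\<close>

lemma transpose_add: "transpose (A + B) = transpose A + transpose (B :: real^'n^'m)"
  by (simp add: transpose_def vec_eq_iff)

lemma transpose_diff: "transpose (A - B) = transpose A - transpose (B :: real^'n^'m)"
  by (simp add: transpose_def vec_eq_iff)

lemma transpose_generator:
  "transpose (generator D E Q) = generator D E (transpose Q)"
  by (simp add: generator_def transpose_add matrix_transpose_mul matrix_mul_assoc add_ac)

lemma linear_generator: "linear (generator D E)"
  by (rule linearI)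
    (simp_all add: generator_def matrix_add_ldistrib matrix_add_rdistrib matrix_scalar_ac
      scalar_matrix_assoc[symmetric] scaleR_right_distrib)

lemma linear_transpose: "linear (transpose :: real^'n^'m \<Rightarrow> real^'m^'n)"
  by (rule linearI) (simp_all add: transpose_add transpose_scalar)

text \<open>
  Extended by the identity on skew matrices, the generator is an endomorphism of the space of all matrices,
  so injectivity suffices to solve \<open>generator D E Q = - 1\<close>.
\<close>

lemma generator_solvable:
  fixes D E :: "real^'n^'n"
  assumes inj: "\<And>Q x. generator D E Q = 0 \<Longrightarrow> x \<bullet> (Q *v x) = 0"
  obtains Q where "transpose Q = Q" "generator D E Q = - mat 1"
proof -
  define sy where "sy Q = (1/2) *\<^sub>R (Q + transpose Q)" for Q :: "real^'n^'n"
  define sk where "sk Q = (1/2) *\<^sub>R (Q - transpose Q)" for Q :: "real^'n^'n"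
  have sum: "sy Q + sk Q = Q" for Q by (simp add: sy_def sk_def vec_eq_iff field_simps)
  have tsy: "transpose (sy Q) = sy Q" and tsk: "transpose (sk Q) = - sk Q" for Q
    unfolding sy_def sk_def transpose_scalar transpose_add transpose_diff transpose_transpose
    by (simp_all add: add.commute scaleR_right_diff_distrib)
  define \<Lambda> where "\<Lambda> Q = generator D E (sy Q) + sk Q" for Q
  have lsy: "linear sy" and lsk: "linear sk"
    unfolding sy_def[abs_def] sk_def[abs_def]
    by (intro linear_compose_scale_right linear_compose_add linear_compose_sub linear_transpose linear_ident)+
  have lin: "linear \<Lambda>"
    unfolding \<Lambda>_def[abs_def] using linear_compose[OF lsy linear_generator[of D E]]
    by (intro linear_compose_add lsk) (simp add: comp_def)
  \<comment> \<open>The decomposition into a symmetric and a skew part is unique.\<close>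
  have split: "S = S' \<and> K = K'"
    if "transpose S = S" "transpose S' = S'" "transpose K = - K" "transpose K' = - K'" "S + K = S' + K'"
    for S K S' K' :: "real^'n^'n"
  proof -
    have "S - K = S' - K'"
      using arg_cong[OF that(5), of transpose] that(1-4) by (simp add: transpose_add)
    then have "(S + K) + (S - K) = (S' + K') + (S' - K')" using that(5) by simp
    then have "2 *\<^sub>R S = 2 *\<^sub>R S'" by (simp add: scaleR_2)
    then have "S = S'" by simp
    then show ?thesis using that(5) by simp
  qed
  have tg: "transpose (generator D E (sy Q)) = generator D E (sy Q)" for Q
    by (simp add: transpose_generator tsy)
  have "inj \<Lambda>"
  proof (subst linear_injective_0[OF lin], intro allI impI)
    fix Q assume "\<Lambda> Q = 0"
    then have "generator D E (sy Q) = 0 \<and> sk Q = 0"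
      using tg tsk unfolding \<Lambda>_def by (intro split) (simp_all)
    then have g: "generator D E (sy Q) = 0" and k: "sk Q = 0" by auto
    have z: "x \<bullet> (sy Q *v x) = 0" for x using inj[OF g] .
    have "sy Q *v x = 0" for x using psd_kernel[OF tsy] z by (metis order_refl)
    then have "sy Q = 0" by (simp add: matrix_eq)
    then show "Q = 0" using sum[of Q] k by simp
  qed
  then have "surj \<Lambda>" by (rule eucl.linear_inj_imp_surj[OF lin])
  then obtain Q where Q: "\<Lambda> Q = - mat 1" by (metis surjD)
  have "transpose (- mat 1 :: real^'n^'n) = - mat 1" by (simp add: transpose_def mat_def vec_eq_iff)
  then have "generator D E (sy Q) = - mat 1 \<and> sk Q = 0"
    using tg tsk Q unfolding \<Lambda>_def by (intro split) (simp_all)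
  then show thesis using that[of "sy Q"] tsy by blast
qed

context brownian_motion
begin

interpretation time_space: pair_sigma_finite lborel M ..

text \<open>
  The mean of \<open>X \<bullet> Q X\<close> is never negative and decreases at least at the rate
  \<open>e\<close> times the second moment of \<open>X\<close>, so the integral of the second moment is at
  most \<open>(x \<bullet> Q x) / e\<close> on every horizon.
\<close>

lemma lyapunov_energy_bound:
  assumes sol: "sde_solution M F W D E x X" and Q: "posdef Q"
    and e: "e > 0" "\<And>y. y \<bullet> (generator D E Q *v y) \<le> - e * (norm y)\<^sup>2"
  shows "(\<integral>\<^sup>+\<omega>. (\<integral>\<^sup>+t\<in>{0..}. ennreal ((norm (X t \<omega>))\<^sup>2) \<partial>lborel) \<partial>M) < \<infinity>"
proof -
  let ?L = "lborel \<Otimes>\<^sub>M M"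
  have am: "adapted_measurable M F {0..} X" using sol by (simp add: sde_solution_def)
  define B where "B = x \<bullet> (Q *v x) / e"
  have bound: "(\<integral>\<^sup>+\<omega>. (\<integral>\<^sup>+t. ennreal ((norm (on_horizon T X (t, \<omega>)))\<^sup>2) \<partial>lborel) \<partial>M) \<le> ennreal B" if T: "0 \<le> T" for T
  proof -
    note sq = sde_solution_parts(1)[OF sol T]
    have [measurable]: "on_horizon T X \<in> borel_measurable ?L" by (rule square_integrable_measurable[OF sq])
    have i: "integrable ?L (\<lambda>z. (norm (on_horizon T X z))\<^sup>2)" using sq by (simp add: square_integrable_def)
    have "0 \<le> (\<integral>\<omega>. X T \<omega> \<bullet> (Q *v X T \<omega>) \<partial>M)"
      by (rule Bochner_Integration.integral_nonneg) (rule posdef_nonneg[OF Q])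
    also have "\<dots> = x \<bullet> (Q *v x) + (\<integral>z. on_horizon T X z \<bullet> (generator D E Q *v on_horizon T X z) \<partial>?L)"
      by (rule second_moment_identity[OF sol T])
    also have "(\<integral>z. on_horizon T X z \<bullet> (generator D E Q *v on_horizon T X z) \<partial>?L)
      \<le> (\<integral>z. - e * (norm (on_horizon T X z))\<^sup>2 \<partial>?L)"
      using i by (intro integral_mono square_integrable_bilinear[OF bounded_bilinear_matrix_form] sq e) auto
    also have "\<dots> = - e * (\<integral>z. (norm (on_horizon T X z))\<^sup>2 \<partial>?L)" by simp
    finally have "(\<integral>z. (norm (on_horizon T X z))\<^sup>2 \<partial>?L) \<le> B"
      using e(1) by (simp add: B_def field_simps)
    moreover have "(\<integral>\<^sup>+\<omega>. (\<integral>\<^sup>+t. ennreal ((norm (on_horizon T X (t, \<omega>)))\<^sup>2) \<partial>lborel) \<partial>M)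
      = ennreal (\<integral>z. (norm (on_horizon T X z))\<^sup>2 \<partial>?L)"
    proof -
      have "(\<integral>\<^sup>+\<omega>. (\<integral>\<^sup>+t. ennreal ((norm (on_horizon T X (t, \<omega>)))\<^sup>2) \<partial>lborel) \<partial>M)
        = (\<integral>\<^sup>+z. ennreal ((norm (on_horizon T X z))\<^sup>2) \<partial>?L)"
        by (rule time_space.nn_integral_snd) measurable
      then show ?thesis using i by (simp add: nn_integral_eq_integral)
    qed
    ultimately show ?thesis by (simp add: ennreal_leI)
  qed
  let ?h = "\<lambda>n t \<omega>. ennreal ((norm (on_horizon (real n) X (t, \<omega>)))\<^sup>2)"
  have [measurable]: "on_horizon (real n) X \<in> borel_measurable ?L" for n by (rule on_horizon_measurable[OF am]) auto
  have incr: "incseq (\<lambda>n. ?h n t \<omega>)" for t \<omega>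
    by (auto simp: incseq_def on_horizon_def intro!: ennreal_leI split: split_indicator)
  have sup: "ennreal ((norm (X t \<omega>))\<^sup>2) * indicator {0..} t = (SUP n. ?h n t \<omega>)" for t \<omega>
  proof (rule LIMSEQ_unique[OF _ LIMSEQ_SUP[OF incr]])
    obtain m :: nat where m: "t \<le> real m" using real_arch_simple by blast
    have "\<forall>\<^sub>F n in sequentially. ?h n t \<omega> = ennreal ((norm (X t \<omega>))\<^sup>2) * indicator {0..} t"
      using eventually_ge_at_top[of m] by eventually_elim (use m in \<open>auto simp: on_horizon_def split: split_indicator\<close>)
    then show "(\<lambda>n. ?h n t \<omega>) \<longlonglongrightarrow> ennreal ((norm (X t \<omega>))\<^sup>2) * indicator {0..} t"
      by (rule tendsto_eventually)
  qed
  have "(\<integral>\<^sup>+\<omega>. (\<integral>\<^sup>+t\<in>{0..}. ennreal ((norm (X t \<omega>))\<^sup>2) \<partial>lborel) \<partial>M) = (\<integral>\<^sup>+\<omega>. (SUP n. \<integral>\<^sup>+t. ?h n t \<omega> \<partial>lborel) \<partial>M)"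
  proof (rule nn_integral_cong)
    fix \<omega> assume w: "\<omega> \<in> space M"
    have m: "(\<lambda>t. ?h n t \<omega>) \<in> borel_measurable lborel" for n using w by measurable
    show "(\<integral>\<^sup>+t\<in>{0..}. ennreal ((norm (X t \<omega>))\<^sup>2) \<partial>lborel) = (SUP n. \<integral>\<^sup>+t. ?h n t \<omega> \<partial>lborel)"
      unfolding sup by (rule nn_integral_monotone_convergence_SUP[OF _ m]) (use incr in \<open>auto simp: incseq_def le_fun_def\<close>)
  qed
  also have "\<dots> = (SUP n. \<integral>\<^sup>+\<omega>. (\<integral>\<^sup>+t. ?h n t \<omega> \<partial>lborel) \<partial>M)"
    by (rule nn_integral_monotone_convergence_SUP)
      (auto simp: incseq_def le_fun_def intro!: nn_integral_mono incr[unfolded incseq_def, rule_format])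
  also have "\<dots> \<le> ennreal B" by (intro SUP_least bound) simp
  finally show ?thesis by (simp add: order_le_less_trans)
qed

text \<open>
  Let \<open>t\<close> tend to infinity in the second moment identity. Since the right-hand side
  converges, so does the mean of \<open>X \<bullet> Q X\<close>, and its limit is zero because the second
  moment of \<open>X\<close> is integrable in time. Here \<open>Z\<close> is \<open>X\<close> extended by
  zero to negative times.
\<close>

lemma stable_solution_functional:
  fixes x :: "real^'n"
  assumes sol: "sde_solution M F W D E x X"
    and fin: "(\<integral>\<^sup>+\<omega>. (\<integral>\<^sup>+t\<in>{0..}. ennreal ((norm (X t \<omega>))\<^sup>2) \<partial>lborel) \<partial>M) < \<infinity>"
  obtains Z :: "real \<times> 'w \<Rightarrow> real^'n" where "square_integrable (lborel \<Otimes>\<^sub>M M) Z"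
    "\<And>Q. x \<bullet> (Q *v x) + (\<integral>z. Z z \<bullet> (generator D E Q *v Z z) \<partial>(lborel \<Otimes>\<^sub>M M)) = 0"
proof -
  let ?L = "lborel \<Otimes>\<^sub>M M"
  have am: "adapted_measurable M F {0..} X" using sol by (simp add: sde_solution_def)
  define Z where "Z z = indicator {0..} (fst z) *\<^sub>R X (fst z) (snd z)" for z
  have h [measurable]: "on_horizon T X \<in> borel_measurable ?L" for T by (rule on_horizon_measurable[OF am]) auto
  have lim: "((\<lambda>T. on_horizon T X z) \<longlongrightarrow> Z z) at_top" for z
  proof (rule tendsto_eventually)
    show "\<forall>\<^sub>F T in at_top. on_horizon T X z = Z z"
      using eventually_ge_at_top[of "fst z"] by eventually_elim (auto simp: on_horizon_def Z_def split: split_indicator)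
  qed
  have limn: "(\<lambda>n. on_horizon (real n) X z) \<longlonglongrightarrow> Z z" for z
    by (rule filterlim_compose[OF lim filterlim_real_sequentially])
  have Zm [measurable]: "Z \<in> borel_measurable ?L"
    by (rule borel_measurable_LIMSEQ_metric[OF _ limn]) measurable
  have "ennreal ((norm (X t \<omega>))\<^sup>2) * indicator {0..} t = ennreal ((norm (Z (t, \<omega>)))\<^sup>2)" for t \<omega>
    by (simp add: Z_def split: split_indicator)
  then have nnZ: "(\<integral>\<^sup>+z. ennreal ((norm (Z z))\<^sup>2) \<partial>?L) < \<infinity>"
    using fin by (simp add: time_space.nn_integral_snd[symmetric])
  then have sqZ: "square_integrable ?L Z" using Zm square_integrable_iff_nn by blast
  have le: "norm (on_horizon T X z) \<le> norm (Z z)" for T z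
    by (auto simp: on_horizon_def Z_def split: split_indicator)
  have conv: "((\<lambda>T. \<integral>z. on_horizon T X z \<bullet> (G *v on_horizon T X z) \<partial>?L) \<longlongrightarrow> (\<integral>z. Z z \<bullet> (G *v Z z) \<partial>?L)) at_top" for G
  proof -
    obtain K where K: "K > 0" "\<And>u v :: real^'n. norm (u \<bullet> (G *v v)) \<le> norm u * norm v * K"
      using bounded_bilinear.pos_bounded[OF bounded_bilinear_matrix_form[of G]] by blast
    interpret h: bounded_bilinear "\<lambda>u v. u \<bullet> (G *v v)" by (rule bounded_bilinear_matrix_form)
    show ?thesis
    proof (rule integral_dominated_convergence_at_top[where w = "\<lambda>z. K * (norm (Z z))\<^sup>2"])
      show "integrable ?L (\<lambda>z. K * (norm (Z z))\<^sup>2)" using sqZ by (simp add: square_integrable_def)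
      show "AE z in ?L. ((\<lambda>T. on_horizon T X z \<bullet> (G *v on_horizon T X z)) \<longlongrightarrow> Z z \<bullet> (G *v Z z)) at_top"
        by (intro AE_I2 h.tendsto lim)
      show "\<forall>\<^sub>F T in at_top. AE z in ?L. norm (on_horizon T X z \<bullet> (G *v on_horizon T X z)) \<le> K * (norm (Z z))\<^sup>2"
      proof (intro always_eventually allI AE_I2)
        fix T z
        have "norm (on_horizon T X z) * norm (on_horizon T X z) * K \<le> norm (Z z) * norm (Z z) * K"
          using K le by (intro mult_right_mono mult_mono) auto
        then show "norm (on_horizon T X z \<bullet> (G *v on_horizon T X z)) \<le> K * (norm (Z z))\<^sup>2"
          using K(2)[of "on_horizon T X z" "on_horizon T X z"] by (simp add: power2_eq_square mult.commute)
      qed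
      show "(\<lambda>z. Z z \<bullet> (G *v Z z)) \<in> borel_measurable ?L"
        by (intro borel_measurable_inner Zm measurable_matrix_vector_mult)
      show "(\<lambda>z. on_horizon T X z \<bullet> (G *v on_horizon T X z)) \<in> borel_measurable ?L" for T
        by (intro borel_measurable_inner h measurable_matrix_vector_mult)
    qed
  qed
  define q where "q Q t = (\<integral>\<omega>. X t \<omega> \<bullet> (Q *v X t \<omega>) \<partial>M)" for Q t
  define l where "l Q = x \<bullet> (Q *v x) + (\<integral>z. Z z \<bullet> (generator D E Q *v Z z) \<partial>?L)" for Q
  have ql: "(q Q \<longlongrightarrow> l Q) at_top" for Q
  proof (rule Lim_transform_eventually)
    show "((\<lambda>T. x \<bullet> (Q *v x) + (\<integral>z. on_horizon T X z \<bullet> (generator D E Q *v on_horizon T X z) \<partial>?L)) \<longlongrightarrow> l Q) at_top"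
      unfolding l_def by (intro tendsto_intros conv)
    show "\<forall>\<^sub>F T in at_top. x \<bullet> (Q *v x) + (\<integral>z. on_horizon T X z \<bullet> (generator D E Q *v on_horizon T X z) \<partial>?L) = q Q T"
      using eventually_ge_at_top[of 0] by eventually_elim (simp add: q_def second_moment_identity[OF sol])
  qed
  have sqX: "square_integrable M (X t)" if "0 \<le> t" for t by (rule sde_solution_parts(4)[OF sol that])
  \<comment> \<open>A positive limit of the second moment would make its integral over time infinite.\<close>
  have l1: "l (mat 1) = 0"
  proof (rule ccontr)
    assume ne: "l (mat 1) \<noteq> 0"
    have "0 \<le> l (mat 1)"
      by (rule tendsto_lowerbound[OF ql]) (auto simp: q_def intro!: always_eventually Bochner_Integration.integral_nonneg)
    then have pos: "0 < l (mat 1) / 2" using ne by simp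
    then have "l (mat 1) / 2 < l (mat 1)" by simp
    from order_tendstoD(1)[OF ql this] obtain t0 where t0: "\<And>t. t \<ge> t0 \<Longrightarrow> l (mat 1) / 2 < q (mat 1) t"
      by (auto simp: eventually_at_top_linorder)
    have "(\<integral>\<^sup>+t. ennreal (l (mat 1) / 2) * indicator {max 0 t0..} t \<partial>lborel)
      \<le> (\<integral>\<^sup>+t. (\<integral>\<^sup>+\<omega>. ennreal ((norm (Z (t, \<omega>)))\<^sup>2) \<partial>M) \<partial>lborel)"
    proof (rule nn_integral_mono)
      fix t :: real
      show "ennreal (l (mat 1) / 2) * indicator {max 0 t0..} t \<le> (\<integral>\<^sup>+\<omega>. ennreal ((norm (Z (t, \<omega>)))\<^sup>2) \<partial>M)"
      proof (cases "t \<in> {max 0 t0..}")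
        case True
        then have t: "0 \<le> t" "t0 \<le> t" by auto
        have "(\<integral>\<^sup>+\<omega>. ennreal ((norm (Z (t, \<omega>)))\<^sup>2) \<partial>M) = ennreal (q (mat 1) t)"
          using t sqX[OF t(1)] by (simp add: Z_def q_def square_integrable_def nn_integral_eq_integral power2_norm_eq_inner)
        then show ?thesis using t0[OF t(2)] True by (simp add: ennreal_leI)
      qed simp
    qed
    also have "\<dots> = (\<integral>\<^sup>+z. ennreal ((norm (Z z))\<^sup>2) \<partial>?L)" by (rule nn_integral_fst) measurable
    finally have "(\<integral>\<^sup>+t. ennreal (l (mat 1) / 2) * indicator {max 0 t0..} t \<partial>lborel) < \<infinity>"
      using nnZ by (rule order_le_less_trans)
    moreover have "emeasure lborel {max 0 t0..} = \<infinity>"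
    proof (rule ccontr)
      assume "emeasure lborel {max 0 t0..} \<noteq> \<infinity>"
      then obtain r where r: "0 \<le> r" "emeasure lborel {max 0 t0..} = ennreal r"
        by (cases "emeasure lborel {max 0 t0..}") auto
      have "ennreal (r + 1) = emeasure lborel {max 0 t0..max 0 t0 + (r + 1)}" using r by simp
      also have "\<dots> \<le> emeasure lborel {max 0 t0..}" by (intro emeasure_mono) auto
      finally show False using r by simp
    qed
    ultimately show False using pos by (simp add: nn_integral_cmult_indicator ennreal_mult_eq_top_iff ennreal_mult_top)
  qed
  have l0: "l Q = 0" for Q
  proof -
    obtain K where K: "K > 0" "\<And>u v :: real^'n. norm (u \<bullet> (Q *v v)) \<le> norm u * norm v * K"
      using bounded_bilinear.pos_bounded[OF bounded_bilinear_matrix_form[of Q]] by blast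
    have "((\<lambda>t. K * q (mat 1) t) \<longlongrightarrow> K * 0) at_top" using ql[of "mat 1"] unfolding l1 by (intro tendsto_intros)
    then have dom: "((\<lambda>t. K * q (mat 1) t) \<longlongrightarrow> 0) at_top" by simp
    have "(q Q \<longlongrightarrow> 0) at_top"
    proof (rule Lim_null_comparison[OF _ dom], unfold real_norm_def)
      show "\<forall>\<^sub>F t in at_top. \<bar>q Q t\<bar> \<le> K * q (mat 1) t"
        using eventually_ge_at_top[of 0]
      proof eventually_elim
        case (elim t)
        have i: "integrable M (\<lambda>\<omega>. K * (norm (X t \<omega>))\<^sup>2)" using sqX[OF elim] by (simp add: square_integrable_def)
        have "\<bar>q Q t\<bar> \<le> (\<integral>\<omega>. \<bar>X t \<omega> \<bullet> (Q *v X t \<omega>)\<bar> \<partial>M)" unfolding q_def by (rule integral_abs_bound)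
        also have "\<dots> \<le> (\<integral>\<omega>. K * (norm (X t \<omega>))\<^sup>2 \<partial>M)"
        proof (rule integral_mono[OF _ i])
          show "integrable M (\<lambda>\<omega>. \<bar>X t \<omega> \<bullet> (Q *v X t \<omega>)\<bar>)"
            by (intro integrable_abs square_integrable_bilinear[OF bounded_bilinear_matrix_form sqX[OF elim] sqX[OF elim]])
          show "\<bar>X t \<omega> \<bullet> (Q *v X t \<omega>)\<bar> \<le> K * (norm (X t \<omega>))\<^sup>2" for \<omega>
            using K(2)[of "X t \<omega>" "X t \<omega>"] by (simp add: power2_eq_square mult.commute)
        qed
        also have "\<dots> = K * q (mat 1) t" by (simp add: q_def power2_norm_eq_inner)
        finally show ?case .
      qed
    qed
    then show ?thesis using tendsto_unique[OF trivial_limit_at_top_linorder ql[of Q]] by simp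
  qed
  show thesis using that[OF sqZ] l0 unfolding l_def by blast
qed

text \<open>
  The functional of the previous lemma expresses \<open>x \<bullet> Q x\<close> through
  \<open>generator D E Q\<close>. Hence the generator is injective on symmetric matrices, and
  \<open>generator D E Q = - 1\<close> has a symmetric solution; for this \<open>Q\<close> the number
  \<open>x \<bullet> Q x\<close> is the total energy of the solution that starts in \<open>x\<close>.
\<close>

lemma L2_stable_imp_lyapunov:
  fixes D E :: "real^'n^'n"
  assumes "L2_stable M F W D E"
  shows "lyapunov_stable D E"
proof -
  let ?L = "(lborel :: real measure) \<Otimes>\<^sub>M M"
  have ex: "\<exists>Z. square_integrable ?L Z \<and> (\<forall>Q. x \<bullet> (Q *v x) + (\<integral>z. Z z \<bullet> (generator D E Q *v Z z) \<partial>?L) = 0)" for x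
  proof -
    obtain X where X: "sde_solution M F W D E x X" using assms unfolding L2_stable_def by blast
    then have "(\<integral>\<^sup>+\<omega>. (\<integral>\<^sup>+t\<in>{0..}. ennreal ((norm (X t \<omega>))\<^sup>2) \<partial>lborel) \<partial>M) < \<infinity>"
      using assms unfolding L2_stable_def by blast
    from stable_solution_functional[OF X this] show ?thesis by blast
  qed
  have "\<forall>x. \<exists>Z. square_integrable ?L Z \<and> (\<forall>Q. x \<bullet> (Q *v x) + (\<integral>z. Z z \<bullet> (generator D E Q *v Z z) \<partial>?L) = 0)"
    using ex by blast
  from choice[OF this] obtain Z where Z: "\<And>x. square_integrable ?L (Z x)"
    "\<And>x Q. x \<bullet> (Q *v x) + (\<integral>z. Z x z \<bullet> (generator D E Q *v Z x z) \<partial>?L) = 0" by blast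
  have "x \<bullet> (Q *v x) = 0" if "generator D E Q = 0" for Q x
    using Z(2)[of x Q] that by simp
  then obtain Q where Q: "transpose Q = Q" "generator D E Q = - mat 1"
    by (rule generator_solvable)
  have neg: "(- mat 1 :: real^'n^'n) *v v = - v" for v
    by (simp add: matrix_vector_mult_def mat_def vec_eq_iff sum_negf if_distrib[of "\<lambda>c. c * _"] cong: if_cong)
  have energy: "x \<bullet> (Q *v x) = (\<integral>z. (norm (Z x z))\<^sup>2 \<partial>?L)" for x
    using Z(2)[of x Q] by (simp add: Q neg power2_norm_eq_inner)
  have xx: "0 < x \<bullet> x" if "x \<noteq> 0" for x :: "real^'n" using that by simp
  have "posdef Q" unfolding posdef_def
  proof (intro conjI Q(1) allI impI)
    fix x :: "real^'n" assume "x \<noteq> 0"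
    have "x \<bullet> (Q *v x) \<noteq> 0"
    proof
      assume "x \<bullet> (Q *v x) = 0"
      then have "(\<integral>z. (norm (Z x z))\<^sup>2 \<partial>?L) = 0" using energy by simp
      then have "AE z in ?L. Z x z = 0"
        using Z(1)[of x] by (subst (asm) integral_nonneg_eq_0_iff_AE) (auto simp: square_integrable_def)
      then have "(\<integral>z. Z x z \<bullet> (generator D E (mat 1) *v Z x z) \<partial>?L) = 0" by (intro integral_eq_zero_AE) auto
      then show False using Z(2)[of x "mat 1"] \<open>x \<noteq> 0\<close> by simp
    qed
    moreover have "0 \<le> x \<bullet> (Q *v x)" unfolding energy by simp
    ultimately show "0 < x \<bullet> (Q *v x)" by simp
  qed
  moreover have "2 * ((D *v x) \<bullet> (Q *v x)) + (E *v x) \<bullet> (Q *v (E *v x)) < 0" if "x \<noteq> 0" for x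
  proof -
    have "x \<bullet> (generator D E Q *v x) = - (x \<bullet> x)" by (simp add: Q neg)
    then show ?thesis
      using generator_form[of x D E Q] inner_symmetric_matrix[OF Q(1), of x "D *v x"] xx[OF that] by linarith
  qed
  ultimately show ?thesis unfolding lyapunov_stable_def by blast
qed

lemma lyapunov_imp_energy:
  assumes lyap: "lyapunov_stable D E" and sol: "sde_solution M F W D E x X"
  shows "(\<integral>\<^sup>+\<omega>. (\<integral>\<^sup>+t\<in>{0..}. ennreal ((norm (X t \<omega>))\<^sup>2) \<partial>lborel) \<partial>M) < \<infinity>"
proof -
  obtain Q where Q: "posdef Q" "\<And>x. x \<noteq> 0 \<Longrightarrow> 2 * ((D *v x) \<bullet> (Q *v x)) + (E *v x) \<bullet> (Q *v (E *v x)) < 0"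
    using lyap unfolding lyapunov_stable_def by blast
  obtain e where e: "e > 0" "\<And>y. y \<bullet> (generator D E Q *v y) \<le> - e * (norm y)\<^sup>2"
  proof (rule negative_form_uniform[of "\<lambda>y. y \<bullet> (generator D E Q *v y)"])
    show "continuous_on UNIV (\<lambda>y. y \<bullet> (generator D E Q *v y))"
      by (intro continuous_intros bounded_linear.continuous_on[OF matrix_vector_mul_bounded_linear])
    show "(r *\<^sub>R y) \<bullet> (generator D E Q *v (r *\<^sub>R y)) = r\<^sup>2 * (y \<bullet> (generator D E Q *v y))" for r y
      by (simp add: matrix_vector_mult_scaleR power2_eq_square algebra_simps)
    show "y \<bullet> (generator D E Q *v y) < 0" if "y \<noteq> 0" for y
      using Q(2)[OF that] Q(1) inner_symmetric_matrix[of Q y "D *v y"] by (simp add: generator_form posdef_def)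
  qed blast
  show ?thesis by (rule lyapunov_energy_bound[OF sol Q(1) e])
qed

end

section \<open>Fourth moments of an Euler step\<close>

lemma fourth_power_add:
  fixes p q :: real
  assumes "0 \<le> p" "0 \<le> q" "0 \<le> \<delta>" "\<delta> \<le> 1"
  shows "(p + \<delta> * q) ^ 4 \<le> p ^ 4 + 15 * \<delta> * (p ^ 4 + q ^ 4)"
proof -
  have mono: "p ^ i * q ^ j \<le> p ^ 4 + q ^ 4" if "i + j = 4" for i j
  proof (cases "p \<le> q")
    case True
    have "p ^ i * q ^ j \<le> q ^ i * q ^ j" using assms True by (intro mult_right_mono power_mono) auto
    also have "\<dots> \<le> p ^ 4 + q ^ 4" using that by (simp add: power_add[symmetric])
    finally show ?thesis .
  next
    case False
    have "p ^ i * q ^ j \<le> p ^ i * p ^ j" using assms False by (intro mult_left_mono power_mono) auto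
    also have "\<dots> \<le> p ^ 4 + q ^ 4" using that by (simp add: power_add[symmetric])
    finally show ?thesis .
  qed
  define s where "s = p ^ 4 + q ^ 4"
  have s: "0 \<le> s" using assms by (simp add: s_def)
  have pw: "\<delta> ^ i \<le> \<delta>" if "i \<ge> 1" for i using that assms power_decreasing[of 1 i \<delta>] by simp
  have t: "\<delta> ^ i * (p ^ k * q ^ j) \<le> \<delta> * s" if "i \<ge> 1" "k + j = 4" for i k j
    using mono[OF that(2)] pw[OF that(1)] assms by (intro mult_mono) (auto simp: s_def)
  have "(p + \<delta> * q) ^ 4 = p ^ 4 + 4 * (\<delta> ^ 1 * (p ^ 3 * q ^ 1)) + 6 * (\<delta> ^ 2 * (p ^ 2 * q ^ 2))
      + 4 * (\<delta> ^ 3 * (p ^ 1 * q ^ 3)) + \<delta> ^ 4 * (p ^ 0 * q ^ 4)"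
    by (simp add: power4_eq_xxxx power3_eq_cube power2_eq_square algebra_simps)
  also have "\<dots> \<le> p ^ 4 + 4 * (\<delta> * s) + 6 * (\<delta> * s) + 4 * (\<delta> * s) + \<delta> * s"
    using t[of 1 3 1] t[of 2 2 2] t[of 3 1 3] t[of 4 0 4] by simp
  finally show ?thesis by (simp add: s_def)
qed

lemma fourth_power_add2:
  fixes p q :: real
  assumes "0 \<le> p" "0 \<le> q"
  shows "(p + q) ^ 4 \<le> 8 * (p ^ 4 + q ^ 4)"
proof -
  have "(p + q)\<^sup>2 \<le> 2 * (p\<^sup>2 + q\<^sup>2)"
    using sum_squares_bound[of p q] by (simp add: power2_eq_square algebra_simps)
  then have "((p + q)\<^sup>2)\<^sup>2 \<le> (2 * (p\<^sup>2 + q\<^sup>2))\<^sup>2" by (intro power_mono) auto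
  also have "\<dots> \<le> 8 * ((p\<^sup>2)\<^sup>2 + (q\<^sup>2)\<^sup>2)"
    using sum_squares_bound[of "p\<^sup>2" "q\<^sup>2"] by (simp add: power2_eq_square algebra_simps)
  finally show ?thesis by simp
qed

lemma norm_add_fourth:
  fixes a b :: "'b::euclidean_space"
  shows "norm (a + b) ^ 4 \<le> 8 * (norm a ^ 4 + norm b ^ 4)"
proof -
  have "norm (a + b) ^ 4 \<le> (norm a + norm b) ^ 4" by (intro power_mono norm_triangle_ineq) simp
  also have "\<dots> \<le> 8 * (norm a ^ 4 + norm b ^ 4)" by (rule fourth_power_add2) auto
  finally show ?thesis .
qed

text \<open>
  The cubic term in \<open>d\<close> is absorbed into the even ones, so that only the linear term can have
  either sign; for a Brownian increment \<open>d\<close> it has mean zero.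
\<close>

lemma fourth_power_increment:
  fixes a b :: "'b::euclidean_space" and d :: real
  shows "norm (a + d *\<^sub>R b) ^ 4 \<le> norm a ^ 4 + 4 * ((norm a)\<^sup>2 * (a \<bullet> b)) * d
    + 8 * ((norm a)\<^sup>2 * (norm b)\<^sup>2) * d\<^sup>2 + 3 * norm b ^ 4 * d ^ 4"
proof -
  define A where "A = (norm a)\<^sup>2"
  define B where "B = (norm b)\<^sup>2"
  define k where "k = a \<bullet> b"
  have k2: "k\<^sup>2 \<le> A * B"
    using Cauchy_Schwarz_ineq[of a b] by (simp add: A_def B_def k_def power2_norm_eq_inner)
  have "norm (a + d *\<^sub>R b) ^ 4 = ((norm (a + d *\<^sub>R b))\<^sup>2)\<^sup>2" by simp
  also have "(norm (a + d *\<^sub>R b))\<^sup>2 = A + 2 * d * k + d\<^sup>2 * B"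
    unfolding A_def B_def k_def power2_norm_eq_inner
    by (simp add: inner_add_left inner_add_right inner_commute power2_eq_square)
  also have "(A + 2 * d * k + d\<^sup>2 * B)\<^sup>2 = A\<^sup>2 + 4 * (A * k) * d + (4 * k\<^sup>2 + 2 * A * B) * d\<^sup>2
      + 2 * (2 * (d * k) * (d\<^sup>2 * B)) + B\<^sup>2 * d ^ 4"
    by (simp add: power4_eq_xxxx power2_eq_square algebra_simps)
  also have "2 * (2 * (d * k) * (d\<^sup>2 * B)) \<le> 2 * ((d * k)\<^sup>2 + (d\<^sup>2 * B)\<^sup>2)"
    using sum_squares_bound[of "d * k" "d\<^sup>2 * B"] by simp
  also have "A\<^sup>2 + 4 * (A * k) * d + (4 * k\<^sup>2 + 2 * A * B) * d\<^sup>2 + 2 * ((d * k)\<^sup>2 + (d\<^sup>2 * B)\<^sup>2) + B\<^sup>2 * d ^ 4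
      = A\<^sup>2 + 4 * (A * k) * d + (6 * k\<^sup>2 + 2 * A * B) * d\<^sup>2 + 3 * B\<^sup>2 * d ^ 4"
    by (simp add: power4_eq_xxxx power2_eq_square algebra_simps)
  also have "\<dots> \<le> A\<^sup>2 + 4 * (A * k) * d + (8 * (A * B)) * d\<^sup>2 + 3 * B\<^sup>2 * d ^ 4"
    using k2 by (intro add_mono mult_right_mono order_refl) auto
  finally show ?thesis by (simp add: A_def B_def k_def)
qed

definition fourth_integrable :: "'a measure \<Rightarrow> ('a \<Rightarrow> 'b::euclidean_space) \<Rightarrow> bool" where
  "fourth_integrable N f \<longleftrightarrow> f \<in> borel_measurable N \<and> integrable N (\<lambda>x. norm (f x) ^ 4)"

lemma fourth_integrable_add:
  assumes "fourth_integrable N f" "fourth_integrable N g"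
  shows "fourth_integrable N (\<lambda>x. f x + g x)"
    and "(\<integral>x. norm (f x + g x) ^ 4 \<partial>N) \<le> 8 * ((\<integral>x. norm (f x) ^ 4 \<partial>N) + (\<integral>x. norm (g x) ^ 4 \<partial>N))"
proof -
  have [measurable]: "f \<in> borel_measurable N" "g \<in> borel_measurable N"
    and i: "integrable N (\<lambda>x. norm (f x) ^ 4)" "integrable N (\<lambda>x. norm (g x) ^ 4)"
    using assms by (auto simp: fourth_integrable_def)
  have j: "integrable N (\<lambda>x. norm (f x + g x) ^ 4)"
  proof (rule Bochner_Integration.integrable_bound)
    show "integrable N (\<lambda>x. 8 * (norm (f x) ^ 4 + norm (g x) ^ 4))" using i by simp
    show "AE x in N. norm (norm (f x + g x) ^ 4) \<le> norm (8 * (norm (f x) ^ 4 + norm (g x) ^ 4))"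
      using norm_add_fourth by (intro AE_I2) (auto simp: abs_mult)
  qed measurable
  then show "fourth_integrable N (\<lambda>x. f x + g x)" by (simp add: fourth_integrable_def)
  have "(\<integral>x. norm (f x + g x) ^ 4 \<partial>N) \<le> (\<integral>x. 8 * (norm (f x) ^ 4 + norm (g x) ^ 4) \<partial>N)"
    using i j by (intro integral_mono norm_add_fourth) auto
  then show "(\<integral>x. norm (f x + g x) ^ 4 \<partial>N) \<le> 8 * ((\<integral>x. norm (f x) ^ 4 \<partial>N) + (\<integral>x. norm (g x) ^ 4 \<partial>N))"
    using i by simp
qed

lemma fourth_integrable_scale:
  assumes "fourth_integrable N f"
  shows "fourth_integrable N (\<lambda>x. c *\<^sub>R f x)"
proof -
  have [measurable]: "f \<in> borel_measurable N" using assms by (simp add: fourth_integrable_def)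
  have "(\<lambda>x. c *\<^sub>R f x) \<in> borel_measurable N" by measurable
  then show ?thesis using assms by (simp add: fourth_integrable_def power_mult_distrib)
qed

lemma fourth_integrable_diff:
  assumes "fourth_integrable N f" "fourth_integrable N g"
  shows "fourth_integrable N (\<lambda>x. f x - g x)"
  using fourth_integrable_add(1)[OF assms(1) fourth_integrable_scale[OF assms(2), of "-1"]] by simp

lemma onorm_matrix: "norm (A *v v) \<le> onorm ((*v) A) * norm v" for A :: "real^'n^'m"
  by (rule onorm) (rule matrix_vector_mul_bounded_linear)

lemma onorm_matrix_nonneg: "0 \<le> onorm ((*v) A)" for A :: "real^'n^'m"
  by (rule onorm_pos_le) (rule matrix_vector_mul_bounded_linear)

lemma onorm_matrix_fourth: "norm (A *v v) ^ 4 \<le> onorm ((*v) A) ^ 4 * norm v ^ 4" for A :: "real^'n^'m"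
  using power_mono[OF onorm_matrix[of A v], of 4] by (simp add: power_mult_distrib)

lemma fourth_integrable_matrix:
  fixes A :: "real^'n^'m"
  assumes "fourth_integrable N f"
  shows "fourth_integrable N (\<lambda>x. A *v f x)"
    and "(\<integral>x. norm (A *v f x) ^ 4 \<partial>N) \<le> onorm ((*v) A) ^ 4 * (\<integral>x. norm (f x) ^ 4 \<partial>N)"
proof -
  have f: "f \<in> borel_measurable N" and i: "integrable N (\<lambda>x. norm (f x) ^ 4)"
    using assms by (auto simp: fourth_integrable_def)
  have [measurable]: "(\<lambda>x. A *v f x) \<in> borel_measurable N" by (rule measurable_matrix_vector_mult[OF f])
  have j: "integrable N (\<lambda>x. norm (A *v f x) ^ 4)"
  proof (rule Bochner_Integration.integrable_bound)
    show "integrable N (\<lambda>x. onorm ((*v) A) ^ 4 * norm (f x) ^ 4)" using i by simp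
    show "AE x in N. norm (norm (A *v f x) ^ 4) \<le> norm (onorm ((*v) A) ^ 4 * norm (f x) ^ 4)"
      using onorm_matrix_fourth by (intro AE_I2) (auto simp: abs_mult)
  qed measurable
  then show "fourth_integrable N (\<lambda>x. A *v f x)" by (simp add: fourth_integrable_def)
  have "(\<integral>x. norm (A *v f x) ^ 4 \<partial>N) \<le> (\<integral>x. onorm ((*v) A) ^ 4 * norm (f x) ^ 4 \<partial>N)"
    using i j by (intro integral_mono onorm_matrix_fourth) auto
  then show "(\<integral>x. norm (A *v f x) ^ 4 \<partial>N) \<le> onorm ((*v) A) ^ 4 * (\<integral>x. norm (f x) ^ 4 \<partial>N)" by simp
qed

text \<open>
  The numerical factors are those which the estimate of an Euler step produces; what matters is that they
  do not depend on the length of the step.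
\<close>

definition growth_const :: "real^'n^'n \<Rightarrow> real^'n^'n \<Rightarrow> real" where
  "growth_const D E = 79 + 75 * onorm ((*v) D) ^ 4 + 13 * onorm ((*v) E) ^ 4"

definition jump_const :: "real^'n^'n \<Rightarrow> real^'n^'n \<Rightarrow> real" where
  "jump_const D E = 8 * onorm ((*v) D) ^ 4 + 24 * onorm ((*v) E) ^ 4"

lemma growth_const_pos: "0 < growth_const D E" and jump_const_nonneg: "0 \<le> jump_const D E"
  by (auto simp: growth_const_def jump_const_def onorm_matrix_nonneg intro!: add_pos_nonneg)

context brownian_motion
begin

lemma increment_fourth:
  fixes v :: "'w \<Rightarrow> real^'n"
  assumes s: "0 \<le> s" "0 \<le> \<delta>" and v: "v \<in> borel_measurable (F s)" "fourth_integrable M v"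
  shows "fourth_integrable M (\<lambda>\<omega>. (W (s + \<delta>) \<omega> - W s \<omega>) *\<^sub>R v \<omega>)"
    and "(\<integral>\<omega>. norm ((W (s + \<delta>) \<omega> - W s \<omega>) *\<^sub>R v \<omega>) ^ 4 \<partial>M) = 3 * \<delta>\<^sup>2 * (\<integral>\<omega>. norm (v \<omega>) ^ 4 \<partial>M)"
proof -
  have U: "(\<lambda>\<omega>. norm (v \<omega>) ^ 4) \<in> borel_measurable (F s)" "integrable M (\<lambda>\<omega>. norm (v \<omega>) ^ 4)"
    using v by (auto simp: fourth_integrable_def)
  have eq: "norm ((W (s + \<delta>) \<omega> - W s \<omega>) *\<^sub>R v \<omega>) ^ 4 = norm (v \<omega>) ^ 4 * (W (s + \<delta>) \<omega> - W s \<omega>) ^ 4" for \<omega>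
    by (simp add: power_mult_distrib power_even_abs)
  have "(\<lambda>\<omega>. (W (s + \<delta>) \<omega> - W s \<omega>) *\<^sub>R v \<omega>) \<in> borel_measurable M"
    using W_measurable[of s] W_measurable[of "s + \<delta>"] s v by (auto simp: fourth_integrable_def)
  then show "fourth_integrable M (\<lambda>\<omega>. (W (s + \<delta>) \<omega> - W s \<omega>) *\<^sub>R v \<omega>)"
    unfolding fourth_integrable_def eq using integral_times_increment(1)[OF s(1) _ U] s by auto
  show "(\<integral>\<omega>. norm ((W (s + \<delta>) \<omega> - W s \<omega>) *\<^sub>R v \<omega>) ^ 4 \<partial>M) = 3 * \<delta>\<^sup>2 * (\<integral>\<omega>. norm (v \<omega>) ^ 4 \<partial>M)"
    unfolding eq using integral_times_increment(2)[OF s(1) _ U, of "s + \<delta>" 4] increment_moments(4)[of s "s + \<delta>"] s by simp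
qed

lemma euler_jump_fourth:
  fixes v :: "'w \<Rightarrow> real^'n" and D E :: "real^'n^'n"
  assumes s: "0 \<le> s" "0 \<le> \<delta>" "\<delta> \<le> 1" and v: "v \<in> borel_measurable (F s)" "fourth_integrable M v"
  defines "J \<equiv> \<lambda>\<omega>. \<delta> *\<^sub>R (D *v v \<omega>) + (W (s + \<delta>) \<omega> - W s \<omega>) *\<^sub>R (E *v v \<omega>)"
  shows "fourth_integrable M J"
    and "(\<integral>\<omega>. norm (J \<omega>) ^ 4 \<partial>M) \<le> jump_const D E * \<delta>\<^sup>2 * (\<integral>\<omega>. norm (v \<omega>) ^ 4 \<partial>M)"
proof -
  define m where "m = (\<integral>\<omega>. norm (v \<omega>) ^ 4 \<partial>M)"
  have m: "0 \<le> m" by (simp add: m_def)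
  have Ev: "(\<lambda>\<omega>. E *v v \<omega>) \<in> borel_measurable (F s)" by (rule measurable_matrix_vector_mult[OF v(1)])
  have 1: "fourth_integrable M (\<lambda>\<omega>. \<delta> *\<^sub>R (D *v v \<omega>))"
    by (intro fourth_integrable_scale fourth_integrable_matrix v)
  have 2: "fourth_integrable M (\<lambda>\<omega>. (W (s + \<delta>) \<omega> - W s \<omega>) *\<^sub>R (E *v v \<omega>))"
    by (intro increment_fourth s Ev fourth_integrable_matrix v)
  show "fourth_integrable M J" unfolding J_def by (rule fourth_integrable_add(1)[OF 1 2])
  have d4: "\<delta> ^ 4 \<le> \<delta>\<^sup>2" using s by (intro power_decreasing) auto
  have "(\<integral>\<omega>. norm (\<delta> *\<^sub>R (D *v v \<omega>)) ^ 4 \<partial>M) = \<delta> ^ 4 * (\<integral>\<omega>. norm (D *v v \<omega>) ^ 4 \<partial>M)"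
    using s by (simp add: power_mult_distrib)
  also have "\<dots> \<le> \<delta>\<^sup>2 * (onorm ((*v) D) ^ 4 * m)"
    unfolding m_def by (intro mult_mono fourth_integrable_matrix v d4) auto
  finally have A: "(\<integral>\<omega>. norm (\<delta> *\<^sub>R (D *v v \<omega>)) ^ 4 \<partial>M) \<le> \<delta>\<^sup>2 * (onorm ((*v) D) ^ 4 * m)" .
  have "(\<integral>\<omega>. norm ((W (s + \<delta>) \<omega> - W s \<omega>) *\<^sub>R (E *v v \<omega>)) ^ 4 \<partial>M) = 3 * \<delta>\<^sup>2 * (\<integral>\<omega>. norm (E *v v \<omega>) ^ 4 \<partial>M)"
    by (intro increment_fourth s Ev fourth_integrable_matrix v)
  also have "\<dots> \<le> 3 * \<delta>\<^sup>2 * (onorm ((*v) E) ^ 4 * m)"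
    unfolding m_def by (intro mult_left_mono fourth_integrable_matrix v) auto
  finally have B: "(\<integral>\<omega>. norm ((W (s + \<delta>) \<omega> - W s \<omega>) *\<^sub>R (E *v v \<omega>)) ^ 4 \<partial>M) \<le> 3 * \<delta>\<^sup>2 * (onorm ((*v) E) ^ 4 * m)" .
  have "(\<integral>\<omega>. norm (J \<omega>) ^ 4 \<partial>M) \<le> 8 * (\<delta>\<^sup>2 * (onorm ((*v) D) ^ 4 * m) + 3 * \<delta>\<^sup>2 * (onorm ((*v) E) ^ 4 * m))"
    unfolding J_def
    by (rule order_trans[OF fourth_integrable_add(2)[OF 1 2]]) (intro mult_left_mono add_mono A B, simp)
  then show "(\<integral>\<omega>. norm (J \<omega>) ^ 4 \<partial>M) \<le> jump_const D E * \<delta>\<^sup>2 * (\<integral>\<omega>. norm (v \<omega>) ^ 4 \<partial>M)"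
    by (simp add: jump_const_def m_def[symmetric] algebra_simps)
qed

text \<open>
  A step of length \<open>\<delta>\<close> multiplies fourth moments by \<open>1 + O(\<delta>)\<close>
  although the noise is of size \<open>\<delta>\<close> to the power \<open>1/2\<close>: its first order
  contribution has mean zero. Allowing \<open>v\<close> to differ from \<open>e\<close> covers both the
  growth of the scheme (\<open>v = e\<close>) and the propagation of errors.
\<close>

lemma euler_step_fourth:
  fixes e v :: "'w \<Rightarrow> real^'n" and D E :: "real^'n^'n"
  assumes s: "0 \<le> s" "0 \<le> \<delta>" "\<delta> \<le> 1"
    and e: "e \<in> borel_measurable (F s)" "fourth_integrable M e"
    and v: "v \<in> borel_measurable (F s)" "fourth_integrable M v"
  defines "J \<equiv> \<lambda>\<omega>. \<delta> *\<^sub>R (D *v v \<omega>) + (W (s + \<delta>) \<omega> - W s \<omega>) *\<^sub>R (E *v v \<omega>)"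
  shows "(\<integral>\<omega>. norm (e \<omega> + J \<omega>) ^ 4 \<partial>M) \<le> (\<integral>\<omega>. norm (e \<omega>) ^ 4 \<partial>M)
    + growth_const D E * \<delta> * ((\<integral>\<omega>. norm (e \<omega>) ^ 4 \<partial>M) + (\<integral>\<omega>. norm (v \<omega>) ^ 4 \<partial>M))"
proof -
  define a where "a \<omega> = e \<omega> + \<delta> *\<^sub>R (D *v v \<omega>)" for \<omega>
  define b where "b \<omega> = E *v v \<omega>" for \<omega>
  let ?d = "\<lambda>\<omega>. W (s + \<delta>) \<omega> - W s \<omega>"
  define m where "m = (\<integral>\<omega>. norm (v \<omega>) ^ 4 \<partial>M)"
  define l where "l = (\<integral>\<omega>. norm (e \<omega>) ^ 4 \<partial>M)"
  define A where "A = (\<integral>\<omega>. norm (a \<omega>) ^ 4 \<partial>M)"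
  define B where "B = (\<integral>\<omega>. norm (b \<omega>) ^ 4 \<partial>M)"
  have nn: "0 \<le> m" "0 \<le> l" "0 \<le> A" "0 \<le> B" by (simp_all add: m_def l_def A_def B_def)
  have bF: "b \<in> borel_measurable (F s)" unfolding b_def by (rule measurable_matrix_vector_mult[OF v(1)])
  have "(\<lambda>\<omega>. D *v v \<omega>) \<in> borel_measurable (F s)" by (rule measurable_matrix_vector_mult[OF v(1)])
  then have aF: "a \<in> borel_measurable (F s)" unfolding a_def using e(1) by measurable
  have a4: "fourth_integrable M a" unfolding a_def
    by (intro fourth_integrable_add e fourth_integrable_scale fourth_integrable_matrix v)
  have b4: "fourth_integrable M b" unfolding b_def by (intro fourth_integrable_matrix v)
  have ia: "integrable M (\<lambda>\<omega>. norm (a \<omega>) ^ 4)" and ib: "integrable M (\<lambda>\<omega>. norm (b \<omega>) ^ 4)"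
    and ie: "integrable M (\<lambda>\<omega>. norm (e \<omega>) ^ 4)" and iv: "integrable M (\<lambda>\<omega>. norm (v \<omega>) ^ 4)"
    using a4 b4 e v by (auto simp: fourth_integrable_def)
  have am: "a \<in> borel_measurable M" "b \<in> borel_measurable M" using a4 b4 by (auto simp: fourth_integrable_def)
  have ab: "(norm (a \<omega>))\<^sup>2 * (norm (b \<omega>))\<^sup>2 \<le> (norm (a \<omega>) ^ 4 + norm (b \<omega>) ^ 4) / 2" for \<omega>
    using sum_squares_bound[of "(norm (a \<omega>))\<^sup>2" "(norm (b \<omega>))\<^sup>2"] by simp
  have ab1: "\<bar>(norm (a \<omega>))\<^sup>2 * (a \<omega> \<bullet> b \<omega>)\<bar> \<le> norm (a \<omega>) ^ 4 + norm (b \<omega>) ^ 4" for \<omega>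
  proof -
    have n: "norm (a \<omega>) * norm (b \<omega>) \<le> (norm (a \<omega>))\<^sup>2 + (norm (b \<omega>))\<^sup>2"
      using sum_squares_bound[of "norm (a \<omega>)" "norm (b \<omega>)"]
        mult_nonneg_nonneg[OF norm_ge_zero[of "a \<omega>"] norm_ge_zero[of "b \<omega>"]] by linarith
    have "\<bar>(norm (a \<omega>))\<^sup>2 * (a \<omega> \<bullet> b \<omega>)\<bar> \<le> (norm (a \<omega>))\<^sup>2 * (norm (a \<omega>) * norm (b \<omega>))"
      unfolding abs_mult by (intro mult_mono Cauchy_Schwarz_ineq2) auto
    also have "\<dots> = norm (a \<omega>) ^ 3 * norm (b \<omega>) ^ 1" by (simp add: power2_eq_square power3_eq_cube)
    also have "\<dots> \<le> norm (a \<omega>) ^ 4 + norm (b \<omega>) ^ 4"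
    proof (cases "norm (a \<omega>) \<le> norm (b \<omega>)")
      case True
      have "norm (a \<omega>) ^ 3 * norm (b \<omega>) ^ 1 \<le> norm (b \<omega>) ^ 3 * norm (b \<omega>) ^ 1"
        using True by (intro mult_right_mono power_mono) auto
      also have "\<dots> \<le> norm (a \<omega>) ^ 4 + norm (b \<omega>) ^ 4" by (simp add: power4_eq_xxxx power3_eq_cube)
      finally show ?thesis .
    next
      case False
      have "norm (a \<omega>) ^ 3 * norm (b \<omega>) ^ 1 \<le> norm (a \<omega>) ^ 3 * norm (a \<omega>) ^ 1"
        using False by (intro mult_left_mono power_mono) auto
      also have "\<dots> \<le> norm (a \<omega>) ^ 4 + norm (b \<omega>) ^ 4" by (simp add: power4_eq_xxxx power3_eq_cube)
      finally show ?thesis .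
    qed
    finally show ?thesis .
  qed
  have U1: "(\<lambda>\<omega>. (norm (a \<omega>))\<^sup>2 * (a \<omega> \<bullet> b \<omega>)) \<in> borel_measurable (F s)" using aF bF by measurable
  have I1: "integrable M (\<lambda>\<omega>. (norm (a \<omega>))\<^sup>2 * (a \<omega> \<bullet> b \<omega>))"
    by (rule Bochner_Integration.integrable_bound[OF Bochner_Integration.integrable_add[OF ia ib] measurable_F_M[OF U1]])
      (use ab1 in \<open>auto simp: abs_of_nonneg\<close>)
  have U2: "(\<lambda>\<omega>. (norm (a \<omega>))\<^sup>2 * (norm (b \<omega>))\<^sup>2) \<in> borel_measurable (F s)" using aF bF by measurable
  have I2: "integrable M (\<lambda>\<omega>. (norm (a \<omega>))\<^sup>2 * (norm (b \<omega>))\<^sup>2)"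
  proof (rule Bochner_Integration.integrable_bound[OF Bochner_Integration.integrable_add[OF ia ib] measurable_F_M[OF U2]])
    show "AE \<omega> in M. norm ((norm (a \<omega>))\<^sup>2 * (norm (b \<omega>))\<^sup>2) \<le> norm (norm (a \<omega>) ^ 4 + norm (b \<omega>) ^ 4)"
    proof (rule AE_I2)
      fix \<omega>
      have "(norm (a \<omega>) ^ 4 + norm (b \<omega>) ^ 4) / 2 \<le> norm (a \<omega>) ^ 4 + norm (b \<omega>) ^ 4" by simp
      then have "(norm (a \<omega>))\<^sup>2 * (norm (b \<omega>))\<^sup>2 \<le> norm (a \<omega>) ^ 4 + norm (b \<omega>) ^ 4" by (rule order_trans[OF ab])
      then show "norm ((norm (a \<omega>))\<^sup>2 * (norm (b \<omega>))\<^sup>2) \<le> norm (norm (a \<omega>) ^ 4 + norm (b \<omega>) ^ 4)" by (simp add: abs_mult)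
    qed
  qed
  have U4: "(\<lambda>\<omega>. norm (b \<omega>) ^ 4) \<in> borel_measurable (F s)" using bF by measurable
  have sd: "s \<le> s + \<delta>" using s by simp
  note T1 = integral_times_increment_0[OF s(1) sd U1 I1]
    and T2 = integral_times_increment[OF s(1) sd U2 I2, of 2]
    and T4 = integral_times_increment[OF s(1) sd U4 ib, of 4]
  note mom = increment_moments(3,4)[OF s(1) sd]
  have eq: "e \<omega> + J \<omega> = a \<omega> + ?d \<omega> *\<^sub>R b \<omega>" for \<omega> by (simp add: a_def b_def J_def)
  define R where "R \<omega> = norm (a \<omega>) ^ 4 + 4 * ((norm (a \<omega>))\<^sup>2 * (a \<omega> \<bullet> b \<omega>) * ?d \<omega>)
    + 8 * ((norm (a \<omega>))\<^sup>2 * (norm (b \<omega>))\<^sup>2 * (?d \<omega>)\<^sup>2) + 3 * (norm (b \<omega>) ^ 4 * ?d \<omega> ^ 4)" for \<omega>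
  have le: "norm (e \<omega> + J \<omega>) ^ 4 \<le> R \<omega>" for \<omega>
    unfolding eq R_def using fourth_power_increment[of "a \<omega>" "?d \<omega>" "b \<omega>"] by (simp add: mult.assoc)
  have iR: "integrable M R" unfolding R_def using ia T1(1) T2(1) T4(1) by simp
  have J4: "fourth_integrable M (\<lambda>\<omega>. e \<omega> + J \<omega>)" unfolding J_def
    by (intro fourth_integrable_add e euler_jump_fourth s v)
  have "(\<integral>\<omega>. norm (e \<omega> + J \<omega>) ^ 4 \<partial>M) \<le> (\<integral>\<omega>. R \<omega> \<partial>M)"
    using J4 iR le by (intro integral_mono) (auto simp: fourth_integrable_def)
  also have "\<dots> = A + 8 * ((\<integral>\<omega>. (norm (a \<omega>))\<^sup>2 * (norm (b \<omega>))\<^sup>2 \<partial>M) * \<delta>) + 3 * (B * (3 * \<delta>\<^sup>2))"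
    unfolding R_def using ia T1 T2 T4 mom by (simp add: A_def B_def)
  also have "(\<integral>\<omega>. (norm (a \<omega>))\<^sup>2 * (norm (b \<omega>))\<^sup>2 \<partial>M) \<le> (\<integral>\<omega>. (norm (a \<omega>) ^ 4 + norm (b \<omega>) ^ 4) / 2 \<partial>M)"
    using I2 ia ib by (intro integral_mono ab) auto
  also have "(\<integral>\<omega>. (norm (a \<omega>) ^ 4 + norm (b \<omega>) ^ 4) / 2 \<partial>M) = (A + B) / 2" using ia ib by (simp add: A_def B_def)
  also have "A + 8 * ((A + B) / 2 * \<delta>) + 3 * (B * (3 * \<delta>\<^sup>2)) \<le> (1 + 4 * \<delta>) * A + 13 * \<delta> * B"
  proof -
    have "\<delta>\<^sup>2 \<le> \<delta>" using s power_decreasing[of 1 2 \<delta>] by simp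
    then have "B * \<delta>\<^sup>2 \<le> B * \<delta>" using nn by (intro mult_left_mono)
    moreover have "A + 8 * ((A + B) / 2 * \<delta>) + 3 * (B * (3 * \<delta>\<^sup>2)) = A + 4 * (A * \<delta>) + 4 * (B * \<delta>) + 9 * (B * \<delta>\<^sup>2)"
      by (simp add: field_simps)
    moreover have "(1 + 4 * \<delta>) * A + 13 * \<delta> * B = A + 4 * (A * \<delta>) + 13 * (B * \<delta>)" by (simp add: algebra_simps)
    ultimately show ?thesis by linarith
  qed
  finally have main: "(\<integral>\<omega>. norm (e \<omega> + J \<omega>) ^ 4 \<partial>M) \<le> (1 + 4 * \<delta>) * A + 13 * \<delta> * B"
    using s by (simp add: mult_right_mono)
  have Bm: "B \<le> onorm ((*v) E) ^ 4 * m" unfolding B_def b_def m_def by (intro fourth_integrable_matrix v)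
  have Am: "A \<le> l + 15 * \<delta> * (l + onorm ((*v) D) ^ 4 * m)"
  proof -
    have "A \<le> (\<integral>\<omega>. norm (e \<omega>) ^ 4 + 15 * \<delta> * (norm (e \<omega>) ^ 4 + onorm ((*v) D) ^ 4 * norm (v \<omega>) ^ 4) \<partial>M)"
      unfolding A_def
    proof (rule integral_mono[OF ia])
      show "integrable M (\<lambda>\<omega>. norm (e \<omega>) ^ 4 + 15 * \<delta> * (norm (e \<omega>) ^ 4 + onorm ((*v) D) ^ 4 * norm (v \<omega>) ^ 4))"
        using ie iv by simp
      fix \<omega>
      have "norm (a \<omega>) \<le> norm (e \<omega>) + norm (\<delta> *\<^sub>R (D *v v \<omega>))" unfolding a_def by (rule norm_triangle_ineq)
      also have "\<dots> \<le> norm (e \<omega>) + \<delta> * (onorm ((*v) D) * norm (v \<omega>))"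
        using s by (simp add: mult_left_mono onorm_matrix)
      finally have "norm (a \<omega>) ^ 4 \<le> (norm (e \<omega>) + \<delta> * (onorm ((*v) D) * norm (v \<omega>))) ^ 4"
        by (intro power_mono) auto
      also have "\<dots> \<le> norm (e \<omega>) ^ 4 + 15 * \<delta> * (norm (e \<omega>) ^ 4 + (onorm ((*v) D) * norm (v \<omega>)) ^ 4)"
        using s by (intro fourth_power_add) (auto simp: onorm_matrix_nonneg)
      finally show "norm (a \<omega>) ^ 4 \<le> norm (e \<omega>) ^ 4 + 15 * \<delta> * (norm (e \<omega>) ^ 4 + onorm ((*v) D) ^ 4 * norm (v \<omega>) ^ 4)"
        by (simp add: power_mult_distrib)
    qed
    also have "\<dots> = l + 15 * \<delta> * (l + onorm ((*v) D) ^ 4 * m)" using ie iv by (simp add: l_def m_def)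
    finally show ?thesis .
  qed
  define p where "p = onorm ((*v) D) ^ 4 * m"
  define r where "r = onorm ((*v) E) ^ 4 * m"
  have pr: "0 \<le> p" "0 \<le> r" using nn by (auto simp: p_def r_def onorm_matrix_nonneg)
  have "(1 + 4 * \<delta>) * A + 13 * \<delta> * B \<le> (1 + 4 * \<delta>) * (l + 15 * \<delta> * (l + p)) + 13 * \<delta> * r"
    using Am Bm s by (intro add_mono mult_left_mono) (auto simp: p_def r_def)
  also have "\<dots> = l + \<delta> * (4 * l + 15 * (l + p) * (1 + 4 * \<delta>) + 13 * r)" by (simp add: algebra_simps)
  also have "\<dots> \<le> l + \<delta> * (4 * l + 15 * (l + p) * 5 + 13 * r)"
    using s nn pr by (intro add_left_mono mult_left_mono add_right_mono) auto
  also have "\<dots> \<le> l + growth_const D E * \<delta> * (l + m)"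
  proof -
    have "4 * l + 15 * (l + p) * 5 + 13 * r \<le> growth_const D E * (l + m)"
      unfolding growth_const_def p_def r_def using nn onorm_matrix_nonneg[of D] onorm_matrix_nonneg[of E]
      by (simp add: algebra_simps)
    from mult_left_mono[OF this s(2)] show ?thesis by (simp add: mult_ac)
  qed
  finally show ?thesis using main by (simp add: l_def m_def)
qed

end

section \<open>The dyadic Euler scheme\<close>

context brownian_motion
begin

definition euler_jump :: "real^'n^'n \<Rightarrow> real^'n^'n \<Rightarrow> real \<Rightarrow> real \<Rightarrow> real^'n \<Rightarrow> 'w \<Rightarrow> real^'n" where
  "euler_jump D E s t y \<omega> = (t - s) *\<^sub>R (D *v y) + (W t \<omega> - W s \<omega>) *\<^sub>R (E *v y)"

primrec euler :: "real^'n^'n \<Rightarrow> real^'n^'n \<Rightarrow> real^'n \<Rightarrow> nat \<Rightarrow> nat \<Rightarrow> 'w \<Rightarrow> real^'n" where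
  "euler D E x n 0 = (\<lambda>\<omega>. x)"
| "euler D E x n (Suc k) = (\<lambda>\<omega>. euler D E x n k \<omega> + euler_jump D E (real k / 2 ^ n) (real (Suc k) / 2 ^ n) (euler D E x n k \<omega>) \<omega>)"

lemma euler_jump_diff: "euler_jump D E s t y \<omega> - euler_jump D E s t y' \<omega> = euler_jump D E s t (y - y') \<omega>"
  by (simp add: euler_jump_def matrix_vector_mult_diff_distrib scaleR_right_diff_distrib)

lemma euler_jump_add: "euler_jump D E s t y \<omega> + euler_jump D E t u y \<omega> = euler_jump D E s u y \<omega>"
  by (simp add: euler_jump_def algebra_simps)

lemma dyadic_step: "real (Suc k) / 2 ^ n = real k / 2 ^ n + 1 / 2 ^ n"
  by (simp add: add_divide_distrib)

lemma euler_jump_measurable: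
  assumes y: "y \<in> borel_measurable (F s)" and st: "0 \<le> s" "s \<le> t"
  shows "(\<lambda>\<omega>. euler_jump D E s t (y \<omega>) \<omega>) \<in> borel_measurable (F t)"
proof -
  have yt: "y \<in> borel_measurable (F t)" by (rule measurable_F_mono[OF st(2) y])
  have [measurable]: "(\<lambda>\<omega>. D *v y \<omega>) \<in> borel_measurable (F t)" "(\<lambda>\<omega>. E *v y \<omega>) \<in> borel_measurable (F t)"
    by (rule measurable_matrix_vector_mult[OF yt])+
  have [measurable]: "W t \<in> borel_measurable (F t)" "W s \<in> borel_measurable (F t)"
    using adapted[of t] measurable_F_mono[OF st(2) adapted[OF st(1)]] st by auto
  show ?thesis unfolding euler_jump_def by measurable
qed

lemma euler_measurable: "euler D E x n k \<in> borel_measurable (F (real k / 2 ^ n))"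
proof (induction k)
  case (Suc k)
  have le: "real k / 2 ^ n \<le> real (Suc k) / 2 ^ n" by (intro divide_right_mono) auto
  have "euler D E x n k \<in> borel_measurable (F (real (Suc k) / 2 ^ n))" by (rule measurable_F_mono[OF le Suc])
  moreover have "(\<lambda>\<omega>. euler_jump D E (real k / 2 ^ n) (real (Suc k) / 2 ^ n) (euler D E x n k \<omega>) \<omega>)
      \<in> borel_measurable (F (real (Suc k) / 2 ^ n))"
    by (rule euler_jump_measurable[OF Suc _ le]) simp
  ultimately show ?case unfolding euler.simps by (rule borel_measurable_add)
qed simp

lemma euler_jump_moment:
  fixes y :: "'w \<Rightarrow> real^'n"
  assumes s: "0 \<le> s" "s \<le> t" "t \<le> s + 1" and y: "y \<in> borel_measurable (F s)" "fourth_integrable M y"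
  shows "fourth_integrable M (\<lambda>\<omega>. euler_jump D E s t (y \<omega>) \<omega>)"
    and "(\<integral>\<omega>. norm (euler_jump D E s t (y \<omega>) \<omega>) ^ 4 \<partial>M) \<le> jump_const D E * (t - s)\<^sup>2 * (\<integral>\<omega>. norm (y \<omega>) ^ 4 \<partial>M)"
  using euler_jump_fourth[of s "t - s" y D E] assms by (auto simp: euler_jump_def)

lemma euler_fourth_integrable: "fourth_integrable M (euler D E x n k)"
proof (induction k)
  case 0
  show ?case by (simp add: fourth_integrable_def)
next
  case (Suc k)
  have "fourth_integrable M (\<lambda>\<omega>. euler_jump D E (real k / 2 ^ n) (real (Suc k) / 2 ^ n) (euler D E x n k \<omega>) \<omega>)"
    by (rule euler_jump_moment[OF _ _ _ euler_measurable Suc]) (auto simp: field_simps)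
  then show ?case unfolding euler.simps by (rule fourth_integrable_add[OF Suc])
qed

lemma step_moment:
  fixes e v :: "'w \<Rightarrow> real^'n"
  assumes "e \<in> borel_measurable (F (real k / 2 ^ n))" "fourth_integrable M e"
    and "v \<in> borel_measurable (F (real k / 2 ^ n))" "fourth_integrable M v"
  shows "(\<integral>\<omega>. norm (e \<omega> + euler_jump D E (real k / 2 ^ n) (real (Suc k) / 2 ^ n) (v \<omega>) \<omega>) ^ 4 \<partial>M)
    \<le> (\<integral>\<omega>. norm (e \<omega>) ^ 4 \<partial>M)
      + growth_const D E / 2 ^ n * ((\<integral>\<omega>. norm (e \<omega>) ^ 4 \<partial>M) + (\<integral>\<omega>. norm (v \<omega>) ^ 4 \<partial>M))"
  unfolding euler_jump_def dyadic_step
  using euler_step_fourth[of "real k / 2 ^ n" "1 / 2 ^ n" e v D E] assms by simp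

lemma discrete_gronwall:
  fixes u :: "nat \<Rightarrow> real"
  assumes "\<And>k. Suc k \<le> N \<Longrightarrow> u (Suc k) \<le> (1 + a) * u k + b" and a: "0 \<le> a" "0 \<le> b" and k: "k \<le> N"
  shows "u k \<le> exp (a * real k) * (max 0 (u 0) + b * real k)"
  using k
proof (induction k)
  case (Suc k)
  have IH: "u k \<le> exp (a * real k) * (max 0 (u 0) + b * real k)" using Suc by simp
  define R where "R = max 0 (u 0) + b * real k"
  have R: "0 \<le> R" using a by (simp add: R_def)
  have "u (Suc k) \<le> (1 + a) * u k + b" by (rule assms(1)[OF Suc.prems])
  also have "\<dots> \<le> (1 + a) * (exp (a * real k) * R) + b"
    using IH a by (intro add_right_mono mult_left_mono) (auto simp: R_def)
  also have "\<dots> \<le> exp a * (exp (a * real k) * R) + exp (a * real (Suc k)) * b"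
  proof (intro add_mono mult_right_mono)
    show "1 + a \<le> exp a" by (rule exp_ge_add_one_self)
    have "1 * b \<le> exp (a * real (Suc k)) * b" using a by (intro mult_right_mono) auto
    then show "b \<le> exp (a * real (Suc k)) * b" by simp
  qed (use R in simp)
  also have "exp a * (exp (a * real k) * R) = exp (a * real (Suc k)) * R"
    by (simp add: exp_add[symmetric] mult.assoc[symmetric] algebra_simps)
  finally show ?case by (simp add: R_def algebra_simps)
qed (simp add: max_def)

lemma euler_moment_bound:
  assumes "k \<le> T * 2 ^ n"
  shows "(\<integral>\<omega>. norm (euler D E x n k \<omega>) ^ 4 \<partial>M) \<le> exp (2 * growth_const D E * real T) * norm x ^ 4"
proof -
  define u where "u k = (\<integral>\<omega>. norm (euler D E x n k \<omega>) ^ 4 \<partial>M)" for k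
  let ?a = "2 * growth_const D E / 2 ^ n"
  have "u k \<le> exp (?a * real k) * (max 0 (u 0) + 0 * real k)"
  proof (rule discrete_gronwall[where N = k])
    fix k
    show "u (Suc k) \<le> (1 + ?a) * u k + 0"
      using step_moment[OF euler_measurable[of D E x n k] euler_fourth_integrable euler_measurable[of D E x n k] euler_fourth_integrable, of D E]
      unfolding u_def euler.simps by (simp add: algebra_simps)
  qed (use growth_const_pos[of D E] in auto)
  also have "\<dots> \<le> exp (2 * growth_const D E * real T) * norm x ^ 4"
  proof -
    have "real k \<le> real (T * 2 ^ n)" using assms by (simp only: of_nat_le_iff)
    then have "real k / 2 ^ n \<le> real T" by (simp add: field_simps)
    then have "2 * growth_const D E * (real k / 2 ^ n) \<le> 2 * growth_const D E * real T"
      using growth_const_pos[of D E] by (intro mult_left_mono) auto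
    then show ?thesis by (simp add: u_def prob_space mult_right_mono)
  qed
  finally show ?thesis by (simp add: u_def)
qed

lemma euler_jump_bound:
  assumes "k \<le> T * 2 ^ n"
  shows "fourth_integrable M (\<lambda>\<omega>. euler D E x n (Suc k) \<omega> - euler D E x n k \<omega>)"
    and "(\<integral>\<omega>. norm (euler D E x n (Suc k) \<omega> - euler D E x n k \<omega>) ^ 4 \<partial>M)
      \<le> jump_const D E * (exp (2 * growth_const D E * real T) * norm x ^ 4) / 4 ^ n"
proof -
  let ?J = "\<lambda>\<omega>. euler_jump D E (real k / 2 ^ n) (real (Suc k) / 2 ^ n) (euler D E x n k \<omega>) \<omega>"
  have eq: "euler D E x n (Suc k) \<omega> - euler D E x n k \<omega> = ?J \<omega>" for \<omega> by simp
  have s: "0 \<le> real k / 2 ^ n" "real k / 2 ^ n \<le> real (Suc k) / 2 ^ n" "real (Suc k) / 2 ^ n \<le> real k / 2 ^ n + 1"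
    by (auto simp: field_simps)
  note J = euler_jump_moment[OF s euler_measurable[of D E x n k] euler_fourth_integrable, of D E]
  show "fourth_integrable M (\<lambda>\<omega>. euler D E x n (Suc k) \<omega> - euler D E x n k \<omega>)" unfolding eq by (rule J)
  have "(\<integral>\<omega>. norm (?J \<omega>) ^ 4 \<partial>M) \<le> jump_const D E * (1 / 2 ^ n)\<^sup>2 * (\<integral>\<omega>. norm (euler D E x n k \<omega>) ^ 4 \<partial>M)"
  proof -
    have "real (Suc k) / 2 ^ n - real k / 2 ^ n = 1 / 2 ^ n" by (simp add: diff_divide_distrib[symmetric])
    then show ?thesis using J(2) by metis
  qed
  also have "\<dots> \<le> jump_const D E * (1 / 2 ^ n)\<^sup>2 * (exp (2 * growth_const D E * real T) * norm x ^ 4)"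
    by (intro mult_left_mono euler_moment_bound assms) (simp add: jump_const_nonneg)
  also have "(1 / 2 ^ n)\<^sup>2 = (1 / 4 ^ n :: real)" by (simp add: power_divide power_mult[symmetric] mult.commute[of n] power_mult)
  finally show "(\<integral>\<omega>. norm (euler D E x n (Suc k) \<omega> - euler D E x n k \<omega>) ^ 4 \<partial>M)
      \<le> jump_const D E * (exp (2 * growth_const D E * real T) * norm x ^ 4) / 4 ^ n"
    unfolding eq by simp
qed

text \<open>
  Let the coarse scheme, interpolated with the Brownian path, run along the fine grid. Its distance
  \<open>e\<close> to the fine scheme is driven by \<open>e + p\<close>, where \<open>p\<close> is the
  motion of the interpolated coarse scheme since its last grid point, of fourth moment order
  \<open>1 / 4 ^ n\<close>. Gronwall's lemma then bounds \<open>e\<close>, hence also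
  \<open>v = e + p\<close>, by the same order.
\<close>

lemma euler_refinement_bound:
  fixes D E :: "real^'n^'n" and x :: "real^'n"
  assumes j: "j \<le> T * 2 ^ Suc n"
  defines "K \<equiv> exp (2 * growth_const D E * real T) * norm x ^ 4"
  shows "fourth_integrable M (\<lambda>\<omega>. euler D E x (Suc n) j \<omega> - euler D E x n (j div 2) \<omega>)"
    and "(\<integral>\<omega>. norm (euler D E x (Suc n) j \<omega> - euler D E x n (j div 2) \<omega>) ^ 4 \<partial>M)
      \<le> (8 * (exp (9 * growth_const D E * real T) * (8 * growth_const D E * jump_const D E * K * real T)) + 8 * (jump_const D E * K)) / 4 ^ n"
proof -
  define G where "G = growth_const D E"
  define J where "J = jump_const D E"
  have GJ: "0 < G" "0 \<le> J" "0 \<le> K" by (auto simp: G_def J_def growth_const_pos jump_const_nonneg K_def)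
  define N where "N = Suc n"
  define \<tau> where "\<tau> j = real j / 2 ^ N" for j
  define v where "v j \<omega> = euler D E x N j \<omega> - euler D E x n (j div 2) \<omega>" for j \<omega>
  \<comment> \<open>What the coarse scheme has already gained since its last grid point, if it is interpolated with \<open>W\<close>.\<close>
  define p where "p j \<omega> = (if even j then 0 else euler_jump D E (\<tau> (j - 1)) (\<tau> j) (euler D E x n (j div 2) \<omega>) \<omega>)" for j \<omega>
  define e where "e j \<omega> = v j \<omega> - p j \<omega>" for j \<omega>
  have \<tau>_Suc: "\<tau> (Suc j) = \<tau> j + 1 / 2 ^ N" for j unfolding \<tau>_def by (rule dyadic_step)
  have half: "real (j div 2) / 2 ^ n = \<tau> j" if "even j" for j
    using that by (auto simp: \<tau>_def N_def elim!: evenE)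
  have half_odd: "real (j div 2) / 2 ^ n = \<tau> (j - 1)" if "odd j" for j
    using that by (auto simp: \<tau>_def N_def elim!: oddE)
  have half_le: "real (j div 2) / 2 ^ n \<le> \<tau> j" for j
    using half[of j] half_odd[of j] by (cases "even j") (auto simp: \<tau>_def intro!: divide_right_mono)
  have \<tau>0: "0 \<le> \<tau> j" for j by (simp add: \<tau>_def)
  have vF: "v j \<in> borel_measurable (F (\<tau> j))" for j
    unfolding v_def \<tau>_def
    using euler_measurable[of D E x N j] measurable_F_mono[OF half_le[of j] euler_measurable[of D E x n "j div 2"]]
    by (simp add: \<tau>_def borel_measurable_diff)
  have v4: "fourth_integrable M (v j)" for j
    unfolding v_def by (intro fourth_integrable_diff euler_fourth_integrable)
  have p_odd: "p j \<in> borel_measurable (F (\<tau> j)) \<and> fourth_integrable M (p j) \<and>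
      (\<integral>\<omega>. norm (p j \<omega>) ^ 4 \<partial>M) \<le> J * K / 4 ^ N" if j: "j \<le> T * 2 ^ N" for j
  proof (cases "even j")
    case True
    then have "p j = (\<lambda>_. 0)" by (simp add: p_def fun_eq_iff)
    then show ?thesis using GJ by (simp add: fourth_integrable_def)
  next
    case False
    then have p: "p j = (\<lambda>\<omega>. euler_jump D E (\<tau> (j - 1)) (\<tau> j) (euler D E x n (j div 2) \<omega>) \<omega>)" by (simp add: p_def fun_eq_iff)
    have j1: "Suc (j - 1) = j" using False by (cases j) auto
    have st: "0 \<le> \<tau> (j - 1)" "\<tau> (j - 1) \<le> \<tau> j" "\<tau> j \<le> \<tau> (j - 1) + 1" and d: "\<tau> j - \<tau> (j - 1) = 1 / 2 ^ N"
    proof -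
      have "0 \<le> 1 / (2::real) ^ N" "1 / (2::real) ^ N \<le> 1" by auto
      then show "0 \<le> \<tau> (j - 1)" "\<tau> (j - 1) \<le> \<tau> j" "\<tau> j \<le> \<tau> (j - 1) + 1" "\<tau> j - \<tau> (j - 1) = 1 / 2 ^ N"
        using \<tau>_Suc[of "j - 1"] \<tau>0[of "j - 1"] unfolding j1 by linarith+
    qed
    have m: "euler D E x n (j div 2) \<in> borel_measurable (F (\<tau> (j - 1)))"
      using euler_measurable[of D E x n "j div 2"] half_odd[OF False] by simp
    note jm = euler_jump_moment[OF st m euler_fourth_integrable, of D E]
    have jle: "j div 2 \<le> T * 2 ^ n" using j by (simp add: N_def)
    have "(\<integral>\<omega>. norm (p j \<omega>) ^ 4 \<partial>M) \<le> J * (1 / 2 ^ N)\<^sup>2 * (\<integral>\<omega>. norm (euler D E x n (j div 2) \<omega>) ^ 4 \<partial>M)"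
      using jm(2) unfolding p d J_def .
    also have "\<dots> \<le> J * (1 / 2 ^ N)\<^sup>2 * K"
      unfolding K_def using GJ by (intro mult_left_mono euler_moment_bound jle) auto
    also have "(1 / 2 ^ N)\<^sup>2 = (1 / 4 ^ N :: real)" by (simp add: power_divide power_mult[symmetric] mult.commute[of N] power_mult)
    finally show ?thesis using euler_jump_measurable[OF m st(1,2)] jm(1) unfolding p by simp
  qed
  have rec: "e (Suc j) \<omega> = e j \<omega> + euler_jump D E (\<tau> j) (\<tau> (Suc j)) (v j \<omega>) \<omega>" for j \<omega>
  proof (cases "even j")
    case True
    then show ?thesis
      by (simp add: e_def p_def v_def \<tau>_def euler_jump_diff[symmetric])
  next
    case False
    then obtain k where k: "j = Suc (2 * k)" using oddE by (metis Suc_eq_plus1)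
    have t1: "real k / 2 ^ n = \<tau> (2 * k)" "real (Suc k) / 2 ^ n = \<tau> (Suc (Suc (2 * k)))"
      by (simp_all add: \<tau>_def N_def field_simps)
    have "euler D E x n (Suc k) \<omega> = euler D E x n k \<omega> + euler_jump D E (\<tau> (2 * k)) (\<tau> (Suc (2 * k))) (euler D E x n k \<omega>) \<omega>
      + euler_jump D E (\<tau> (Suc (2 * k))) (\<tau> (Suc (Suc (2 * k)))) (euler D E x n k \<omega>) \<omega>"
      unfolding euler.simps t1 by (simp add: euler_jump_add[symmetric] add.assoc)
    moreover have "euler D E x N (Suc j) \<omega> = euler D E x N j \<omega> + euler_jump D E (\<tau> j) (\<tau> (Suc j)) (euler D E x N j \<omega>) \<omega>"
      by (simp add: \<tau>_def)
    ultimately show ?thesis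
      unfolding e_def p_def v_def euler_jump_diff[symmetric] k by simp
  qed
  have eF: "e j \<in> borel_measurable (F (\<tau> j))" and e4: "fourth_integrable M (e j)" if "j \<le> T * 2 ^ N" for j
    using vF[of j] v4[of j] p_odd[OF that] unfolding e_def by (auto intro: fourth_integrable_diff borel_measurable_diff)
  define u where "u j = (\<integral>\<omega>. norm (e j \<omega>) ^ 4 \<partial>M)" for j
  have vu: "(\<integral>\<omega>. norm (v j \<omega>) ^ 4 \<partial>M) \<le> 8 * u j + 8 * (J * K / 4 ^ N)" if j: "j \<le> T * 2 ^ N" for j
  proof -
    have "v j \<omega> = e j \<omega> + p j \<omega>" for \<omega> by (simp add: e_def)
    then have "(\<integral>\<omega>. norm (v j \<omega>) ^ 4 \<partial>M) \<le> 8 * (u j + (\<integral>\<omega>. norm (p j \<omega>) ^ 4 \<partial>M))"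
      using fourth_integrable_add(2)[OF e4[OF j], of "p j"] p_odd[OF j] by (simp add: u_def)
    also have "\<dots> \<le> 8 * (u j + J * K / 4 ^ N)" using p_odd[OF j] by (intro mult_left_mono add_left_mono) auto
    finally show ?thesis by simp
  qed
  have u0: "u 0 = 0" by (simp add: u_def e_def v_def p_def)
  have "u j \<le> exp (9 * G / 2 ^ N * real j) * (max 0 (u 0) + 8 * G * J * K / (2 ^ N * 4 ^ N) * real j)" if j: "j \<le> T * 2 ^ N" for j
  proof (rule discrete_gronwall[where N = "T * 2 ^ N"])
    fix k assume k: "Suc k \<le> T * 2 ^ N"
    then have k': "k \<le> T * 2 ^ N" by simp
    have "u (Suc k) \<le> u k + G / 2 ^ N * (u k + (\<integral>\<omega>. norm (v k \<omega>) ^ 4 \<partial>M))"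
      using step_moment[of "e k" k N "v k" D E] eF[OF k'] e4[OF k'] vF[of k] v4[of k]
      unfolding u_def rec G_def \<tau>_def by simp
    also have "\<dots> \<le> u k + G / 2 ^ N * (u k + (8 * u k + 8 * (J * K / 4 ^ N)))"
      using vu[OF k'] GJ by (intro add_left_mono mult_left_mono) auto
    also have "\<dots> = (1 + 9 * G / 2 ^ N) * u k + 8 * G * J * K / (2 ^ N * 4 ^ N)"
      by (simp add: field_simps)
    finally show "u (Suc k) \<le> (1 + 9 * G / 2 ^ N) * u k + 8 * G * J * K / (2 ^ N * 4 ^ N)" .
  qed (use GJ j in auto)
  moreover have "exp (9 * G / 2 ^ N * real j) * (max 0 (u 0) + 8 * G * J * K / (2 ^ N * 4 ^ N) * real j)
     \<le> exp (9 * G * real T) * (8 * G * J * K * real T) / 4 ^ N" if j: "j \<le> T * 2 ^ N" for j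
  proof -
    have "real j \<le> real (T * 2 ^ N)" using j by (simp only: of_nat_le_iff)
    then have jT: "real j / 2 ^ N \<le> real T" by (simp add: field_simps)
    have 1: "exp (9 * G / 2 ^ N * real j) \<le> exp (9 * G * real T)"
      using mult_left_mono[OF jT, of "9 * G"] GJ by simp
    have 2: "8 * G * J * K / (2 ^ N * 4 ^ N) * real j \<le> 8 * G * J * K * real T / 4 ^ N"
      using mult_left_mono[OF jT, of "8 * G * J * K / 4 ^ N"] GJ by (simp add: field_simps)
    have "exp (9 * G / 2 ^ N * real j) * (max 0 (u 0) + 8 * G * J * K / (2 ^ N * 4 ^ N) * real j)
      \<le> exp (9 * G * real T) * (8 * G * J * K * real T / 4 ^ N)"
      unfolding u0 using 1 2 GJ by (intro mult_mono) auto
    then show ?thesis by simp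
  qed
  ultimately have ub: "u j \<le> exp (9 * G * real T) * (8 * G * J * K * real T) / 4 ^ N" using j by (force simp: N_def)
  have "(\<integral>\<omega>. norm (v j \<omega>) ^ 4 \<partial>M) \<le> 8 * (exp (9 * G * real T) * (8 * G * J * K * real T) / 4 ^ N) + 8 * (J * K / 4 ^ N)"
    using vu[of j] ub j by (simp add: N_def)
  also have "\<dots> = (8 * (exp (9 * G * real T) * (8 * G * J * K * real T)) + 8 * (J * K)) / 4 ^ N"
    by (simp add: add_divide_distrib)
  also have "\<dots> \<le> (8 * (exp (9 * G * real T) * (8 * G * J * K * real T)) + 8 * (J * K)) / 4 ^ n"
    using GJ by (intro divide_left_mono) (auto simp: N_def)
  finally show "(\<integral>\<omega>. norm (euler D E x (Suc n) j \<omega> - euler D E x n (j div 2) \<omega>) ^ 4 \<partial>M)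
      \<le> (8 * (exp (9 * growth_const D E * real T) * (8 * growth_const D E * jump_const D E * K * real T)) + 8 * (jump_const D E * K)) / 4 ^ n"
    by (simp add: v_def N_def G_def J_def)
  show "fourth_integrable M (\<lambda>\<omega>. euler D E x (Suc n) j \<omega> - euler D E x n (j div 2) \<omega>)"
    using v4[of j] by (simp add: v_def[abs_def] N_def)
qed

end

section \<open>Existence of solutions\<close>

lemma floor_dyadic_half:
  fixes t :: real
  assumes "0 \<le> t"
  shows "nat \<lfloor>t * 2 ^ Suc n\<rfloor> div 2 = nat \<lfloor>t * 2 ^ n\<rfloor>"
proof -
  have "\<lfloor>t * 2 ^ n\<rfloor> = \<lfloor>(t * 2 ^ Suc n) / real_of_int 2\<rfloor>" by simp
  also have "\<dots> = \<lfloor>t * 2 ^ Suc n\<rfloor> div 2" by (rule floor_divide_real_eq_div) simp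
  finally show ?thesis using assms by (simp add: nat_div_distrib)
qed

lemma floor_dyadic_le:
  assumes "0 \<le> t" "t \<le> real T"
  shows "nat \<lfloor>t * 2 ^ n\<rfloor> \<le> T * 2 ^ n"
proof -
  have "t * 2 ^ n \<le> real (T * 2 ^ n)" using assms by simp
  then have "\<lfloor>t * 2 ^ n\<rfloor> \<le> int (T * 2 ^ n)" by linarith
  then show ?thesis by linarith
qed

text \<open>
  The factor \<open>11\<close> is the sum of the geometric series with ratio \<open>10/11\<close>.
\<close>

lemma geometric_limit:
  fixes y :: "nat \<Rightarrow> 'b::banach"
  assumes y: "\<And>n. norm (y (Suc n) - y n) \<le> C * (10/11) ^ n"
  shows "y \<longlonglongrightarrow> lim y" "norm (lim y - y n) \<le> 11 * C * (10/11) ^ n"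
proof -
  have C: "0 \<le> C" using order_trans[OF norm_ge_zero y[of 0]] by simp
  have diff: "norm (y (n + k) - y n) \<le> 11 * C * ((10/11) ^ n - (10/11) ^ (n + k))" for n k
  proof (induction k)
    case (Suc k)
    have "norm (y (n + Suc k) - y n) \<le> norm (y (n + k) - y n) + norm (y (Suc (n + k)) - y (n + k))"
      using norm_triangle_ineq[of "y (n + k) - y n" "y (Suc (n + k)) - y (n + k)"] by simp
    also have "\<dots> \<le> 11 * C * ((10/11) ^ n - (10/11) ^ (n + k)) + C * (10/11) ^ (n + k)"
      by (intro add_mono Suc y)
    also have "\<dots> = 11 * C * ((10/11) ^ n - (10/11) ^ (n + Suc k))" by (simp add: algebra_simps)
    finally show ?case .
  qed simp
  have bound: "norm (y m - y n) \<le> 11 * C * (10/11) ^ n" if "n \<le> m" for m n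
  proof -
    have "norm (y m - y n) \<le> 11 * C * ((10/11) ^ n - (10/11) ^ m)" using diff[of n "m - n"] that by simp
    also have "\<dots> \<le> 11 * C * (10/11) ^ n" using C by (intro mult_left_mono) auto
    finally show ?thesis .
  qed
  have z: "(\<lambda>n. 11 * C * (10/11 :: real) ^ n) \<longlonglongrightarrow> 0"
    by (rule tendsto_mult_right_zero) (rule LIMSEQ_realpow_zero, auto)
  have "Cauchy y"
  proof (rule CauchyI')
    fix e :: real assume "e > 0"
    from order_tendstoD(2)[OF z this] obtain N where N: "\<And>n. n \<ge> N \<Longrightarrow> 11 * C * (10/11) ^ n < e"
      by (auto simp: eventually_sequentially)
    have "norm (y m - y n) < e" if "m \<ge> N" "n > m" for m n
      using bound[of m n] N[OF that(1)] that by (simp add: norm_minus_commute)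
    then show "\<exists>M. \<forall>m\<ge>M. \<forall>n>m. dist (y m) (y n) < e" by (auto simp: dist_norm)
  qed
  then have conv: "convergent y" by (simp add: Cauchy_convergent)
  then show l: "y \<longlonglongrightarrow> lim y" by (simp add: convergent_LIMSEQ_iff)
  show "norm (lim y - y n) \<le> 11 * C * (10/11) ^ n"
  proof (rule tendsto_upperbound)
    show "(\<lambda>m. norm (y m - y n)) \<longlonglongrightarrow> norm (lim y - y n)" by (intro tendsto_intros l)
    show "\<forall>\<^sub>F m in sequentially. norm (y m - y n) \<le> 11 * C * (10/11) ^ n"
      using eventually_ge_at_top[of n] by eventually_elim (rule bound)
  qed simp
qed

text \<open>
  Times closer than \<open>1 / 2 ^ n\<close> lie in the same or in neighbouring cells of the grid, and the
  jump between those is small.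
\<close>

lemma continuous_limit_of_steps:
  fixes y :: "nat \<Rightarrow> nat \<Rightarrow> 'b::real_normed_vector" and L :: "real \<Rightarrow> 'b"
  assumes jump: "\<And>n k. k \<le> T * 2 ^ n \<Longrightarrow> norm (y n (Suc k) - y n k) \<le> C * (10/11) ^ n"
    and lim: "\<And>n t. 0 \<le> t \<Longrightarrow> t \<le> real T \<Longrightarrow> norm (L t - y n (nat \<lfloor>t * 2 ^ n\<rfloor>)) \<le> C' * (10/11) ^ n"
  shows "continuous_on {0..real T} L"
  unfolding continuous_on_iff
proof (intro ballI allI impI)
  fix t e :: real assume t: "t \<in> {0..real T}" and e: "0 < e"
  have "(\<lambda>n. (2 * C' + C) * (10/11 :: real) ^ n) \<longlonglongrightarrow> 0"
    by (rule tendsto_mult_right_zero) (rule LIMSEQ_realpow_zero, auto)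
  from order_tendstoD(2)[OF this e] obtain n where n: "(2 * C' + C) * (10/11) ^ n < e"
    by (auto simp: eventually_sequentially)
  have C: "0 \<le> C * (10/11) ^ n" using jump[of 0 n] norm_ge_zero[of "y n (Suc 0) - y n 0"] by linarith
  have key: "norm (y n (nat \<lfloor>r * 2 ^ n\<rfloor>) - y n (nat \<lfloor>s * 2 ^ n\<rfloor>)) \<le> C * (10/11) ^ n"
    if "0 \<le> s" "s \<le> r" "r \<le> real T" "r - s < 1 / 2 ^ n" for r s
  proof -
    have s2: "0 \<le> s * 2 ^ n" "s * 2 ^ n \<le> r * 2 ^ n" using that by auto
    have "r * 2 ^ n < s * 2 ^ n + 1" using that by (simp add: field_simps)
    then have "\<lfloor>r * 2 ^ n\<rfloor> = \<lfloor>s * 2 ^ n\<rfloor> \<or> \<lfloor>r * 2 ^ n\<rfloor> = \<lfloor>s * 2 ^ n\<rfloor> + 1"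
      using s2 by linarith
    then have "nat \<lfloor>r * 2 ^ n\<rfloor> = nat \<lfloor>s * 2 ^ n\<rfloor> \<or> nat \<lfloor>r * 2 ^ n\<rfloor> = Suc (nat \<lfloor>s * 2 ^ n\<rfloor>)"
      using s2 by linarith
    moreover have "nat \<lfloor>s * 2 ^ n\<rfloor> \<le> T * 2 ^ n" using that by (intro floor_dyadic_le) auto
    ultimately show ?thesis using jump C by auto
  qed
  show "\<exists>d>0. \<forall>x'\<in>{0..real T}. dist x' t < d \<longrightarrow> dist (L x') (L t) < e"
  proof (intro exI[of _ "1 / 2 ^ n"] conjI ballI impI)
    fix s assume s: "s \<in> {0..real T}" and d: "dist s t < 1 / 2 ^ n"
    let ?Y = "\<lambda>r. y n (nat \<lfloor>r * 2 ^ n\<rfloor>)"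
    have Y: "norm (?Y s - ?Y t) \<le> C * (10/11) ^ n"
      using key[of s t] key[of t s] s t d by (cases "s \<le> t") (auto simp: dist_real_def norm_minus_commute)
    have "norm (L s - L t) = norm ((L s - ?Y s) + (?Y s - ?Y t) - (L t - ?Y t))" by simp
    also have "\<dots> \<le> norm (L s - ?Y s) + norm (?Y s - ?Y t) + norm (L t - ?Y t)"
      by (intro order_trans[OF norm_triangle_ineq4] add_right_mono norm_triangle_ineq)
    also have "\<dots> \<le> C' * (10/11) ^ n + C * (10/11) ^ n + C' * (10/11) ^ n"
      using s t by (intro add_mono lim Y) auto
    also have "\<dots> < e" using n by (simp add: algebra_simps)
    finally show "dist (L s) (L t) < e" by (simp add: dist_norm)
  qed simp
qed

text \<open>
  The weighted sum of the \<open>f i\<close> with weights \<open>(11/10) ^ (4 i)\<close> still has a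
  finite mean because \<open>(11/10) ^ 4 < 2\<close>, and it dominates every single term. Unlike a random
  constant from the Borel-Cantelli lemma, \<open>g\<close> is integrable. The exponent \<open>4 i\<close>
  leaves a geometric rate after taking fourth roots.
\<close>

lemma geometric_domination:
  fixes f :: "nat \<Rightarrow> 'a \<Rightarrow> real"
  assumes f: "\<And>i. f i \<in> borel_measurable N" "\<And>i \<omega>. 0 \<le> f i \<omega>" "\<And>i. integrable N (f i)"
    and K: "\<And>i. (\<integral>\<omega>. f i \<omega> \<partial>N) \<le> K / 2 ^ i"
  obtains g where "integrable N g" "\<And>\<omega>. 0 \<le> g \<omega>" "AE \<omega> in N. \<forall>i. f i \<omega> \<le> g \<omega> * (10/11) ^ (4 * i)"
proof -
  define c :: real where "c = (11/10) ^ 4"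
  have c: "0 < c" "c / 2 < 1" by (simp_all add: c_def power4_eq_xxxx)
  define H where "H \<omega> = (\<Sum>i. ennreal (c ^ i * f i \<omega>))" for \<omega>
  note [measurable] = f(1)
  have Hm [measurable]: "H \<in> borel_measurable N" unfolding H_def by measurable
  have K0: "0 \<le> K" using order_trans[OF Bochner_Integration.integral_nonneg[of N "f 0"] K[of 0]] f(2) by simp
  have nth: "(\<integral>\<^sup>+\<omega>. ennreal (c ^ i * f i \<omega>) \<partial>N) \<le> ennreal (K * (c / 2) ^ i)" for i
  proof -
    have "(\<integral>\<^sup>+\<omega>. ennreal (c ^ i * f i \<omega>) \<partial>N) = ennreal (\<integral>\<omega>. c ^ i * f i \<omega> \<partial>N)"
      using f c by (intro nn_integral_eq_integral) auto
    also have "(\<integral>\<omega>. c ^ i * f i \<omega> \<partial>N) \<le> c ^ i * (K / 2 ^ i)"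
      using K[of i] c by (simp add: mult_left_mono del: times_divide_eq_right)
    finally show ?thesis by (simp add: power_divide ennreal_leI mult.commute)
  qed
  have "(\<integral>\<^sup>+\<omega>. H \<omega> \<partial>N) = (\<Sum>i. \<integral>\<^sup>+\<omega>. ennreal (c ^ i * f i \<omega>) \<partial>N)"
    unfolding H_def by (rule nn_integral_suminf) measurable
  also have "\<dots> \<le> (\<Sum>i. ennreal (K * (c / 2) ^ i))" by (intro suminf_le nth) auto
  also have "\<dots> < \<infinity>"
  proof -
    have "summable (\<lambda>i. K * (c / 2) ^ i)" using c by (intro summable_mult summable_geometric) auto
    then show ?thesis using K0 c by (subst suminf_ennreal2) auto
  qed
  finally have fin: "(\<integral>\<^sup>+\<omega>. H \<omega> \<partial>N) < \<infinity>" .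
  then have ae: "AE \<omega> in N. H \<omega> \<noteq> \<infinity>" by (intro nn_integral_PInf_AE) auto
  define g where "g \<omega> = enn2real (H \<omega>)" for \<omega>
  have gm [measurable]: "g \<in> borel_measurable N" unfolding g_def by measurable
  have gH: "(\<integral>\<^sup>+\<omega>. ennreal (norm (g \<omega>)) \<partial>N) = (\<integral>\<^sup>+\<omega>. H \<omega> \<partial>N)"
    by (rule nn_integral_cong_AE) (use ae in \<open>eventually_elim, auto simp: g_def less_top\<close>)
  show thesis
  proof (rule that[of g])
    show "integrable N g" using fin gH by (intro integrableI_bounded gm) simp
    show "0 \<le> g \<omega>" for \<omega> by (simp add: g_def)
    show "AE \<omega> in N. \<forall>i. f i \<omega> \<le> g \<omega> * (10/11) ^ (4 * i)"
      using ae
    proof eventually_elim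
      case (elim \<omega>)
      show ?case
      proof
        fix i
        have "ennreal (c ^ i * f i \<omega>) \<le> H \<omega>" unfolding H_def
          using sum_le_suminf[of "\<lambda>i. ennreal (c ^ i * f i \<omega>)" "{i}"] by (auto simp: summableI)
        also have "H \<omega> = ennreal (g \<omega>)" using elim by (simp add: g_def less_top)
        finally have "c ^ i * f i \<omega> \<le> g \<omega>" by (subst (asm) ennreal_le_iff) (simp_all add: g_def)
        then have "f i \<omega> \<le> g \<omega> * (1 / c) ^ i" using c by (simp add: field_simps power_divide)
        also have "(1 / c) ^ i = (10/11) ^ (4 * i)" by (simp add: c_def power_mult power_divide)
        finally show "f i \<omega> \<le> g \<omega> * (10/11) ^ (4 * i)" .
      qed
    qed
  qed
qed

lemma fourth_root_bound:
  fixes a g q :: real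
  assumes "0 \<le> a" "0 \<le> g" "0 \<le> q" "a ^ 4 \<le> g * q ^ (4 * i)"
  shows "a \<le> sqrt (1 + g) * q ^ i"
proof -
  have "(a\<^sup>2)\<^sup>2 \<le> g * q ^ (4 * i)" using assms by simp
  also have "\<dots> \<le> (1 + g)\<^sup>2 * q ^ (4 * i)"
    using assms by (intro mult_right_mono) (auto simp: power2_eq_square algebra_simps)
  also have "\<dots> = ((1 + g) * q ^ (2 * i))\<^sup>2" by (simp add: power_mult_distrib power_mult[symmetric] mult.commute)
  finally have "a\<^sup>2 \<le> (1 + g) * q ^ (2 * i)" using assms by (intro power2_le_imp_le[of "a\<^sup>2"]) auto
  also have "\<dots> = (sqrt (1 + g) * q ^ i)\<^sup>2"
    using assms by (simp add: power_mult_distrib power_mult[symmetric] mult.commute)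
  finally show ?thesis using assms by (intro power2_le_imp_le[of a]) auto
qed

context brownian_motion
begin

definition euler_process :: "real^'n^'n \<Rightarrow> real^'n^'n \<Rightarrow> real^'n \<Rightarrow> nat \<Rightarrow> real \<Rightarrow> 'w \<Rightarrow> real^'n" where
  "euler_process D E x n t \<omega> = euler D E x n (nat \<lfloor>t * 2 ^ n\<rfloor>) \<omega>"

text \<open>
  Where the sequence diverges, \<open>lim\<close> is some fixed value. So the limit is measurable with
  respect to \<open>F t\<close> even if the filtration is not complete.
\<close>

definition euler_limit :: "real^'n^'n \<Rightarrow> real^'n^'n \<Rightarrow> real^'n \<Rightarrow> real \<Rightarrow> 'w \<Rightarrow> real^'n" where
  "euler_limit D E x t \<omega> = lim (\<lambda>n. euler_process D E x n t \<omega>)"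

text \<open>
  There are of the order of \<open>2 ^ n\<close> grid points and each fourth moment is of order
  \<open>1 / 4 ^ n\<close>; so even the sum over the grid, which dominates the maximum, has mean of order
  \<open>1 / 2 ^ n\<close>. Second moments, of order \<open>1 / 2 ^ n\<close>, would not leave room for
  summing over the grid.
\<close>

lemma euler_increments_dominated:
  fixes T :: nat and D E :: "real^'n^'n"
  obtains g where "integrable M g" "\<And>\<omega>. 0 \<le> g \<omega>"
    "AE \<omega> in M. (\<forall>n j. j \<le> T * 2 ^ Suc n \<longrightarrow> norm (euler D E x (Suc n) j \<omega> - euler D E x n (j div 2) \<omega>) \<le> sqrt (1 + g \<omega>) * (10/11) ^ n)
      \<and> (\<forall>n k. k \<le> T * 2 ^ n \<longrightarrow> norm (euler D E x n (Suc k) \<omega> - euler D E x n k \<omega>) \<le> sqrt (1 + g \<omega>) * (10/11) ^ n)"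
proof -
  define v where "v n j \<omega> = norm (euler D E x (Suc n) j \<omega> - euler D E x n (j div 2) \<omega>) ^ 4" for n j \<omega>
  define w where "w n k \<omega> = norm (euler D E x n (Suc k) \<omega> - euler D E x n k \<omega>) ^ 4" for n k \<omega>
  obtain K1 where K1: "\<And>n j. j \<le> T * 2 ^ Suc n \<Longrightarrow> integrable M (v n j) \<and> (\<integral>\<omega>. v n j \<omega> \<partial>M) \<le> K1 / 4 ^ n"
    using euler_refinement_bound[of _ T _ D E x] unfolding fourth_integrable_def v_def[abs_def] by blast
  obtain K2 where K2: "\<And>n k. k \<le> T * 2 ^ n \<Longrightarrow> integrable M (w n k) \<and> (\<integral>\<omega>. w n k \<omega> \<partial>M) \<le> K2 / 4 ^ n"
    using euler_jump_bound[of _ T _ D E x] unfolding fourth_integrable_def w_def[abs_def] by blast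
  define f where "f n \<omega> = (\<Sum>j\<le>T * 2 ^ Suc n. v n j \<omega>) + (\<Sum>k\<le>T * 2 ^ n. w n k \<omega>)" for n \<omega>
  define K where "K = real (2 * T + 1) * K1 + real (T + 1) * K2"
  have vw0: "0 \<le> v n j \<omega>" "0 \<le> w n j \<omega>" for n j \<omega> by (simp_all add: v_def w_def)
  have K0: "0 \<le> K1" "0 \<le> K2"
    using K1[of 0 0] K2[of 0 0] order_trans[OF Bochner_Integration.integral_nonneg[of M "v 0 0"], of K1]
      order_trans[OF Bochner_Integration.integral_nonneg[of M "w 0 0"], of K2] vw0 by auto
  have fi: "integrable M (f n)" for n
    unfolding f_def using K1 K2 by (intro Bochner_Integration.integrable_add Bochner_Integration.integrable_sum) auto
  have fK: "(\<integral>\<omega>. f n \<omega> \<partial>M) \<le> K / 2 ^ n" for n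
  proof -
    have p: "1 \<le> (2::real) ^ n" by simp
    have "(\<integral>\<omega>. f n \<omega> \<partial>M) = (\<Sum>j\<le>T * 2 ^ Suc n. \<integral>\<omega>. v n j \<omega> \<partial>M) + (\<Sum>k\<le>T * 2 ^ n. \<integral>\<omega>. w n k \<omega> \<partial>M)"
    proof -
      have "integrable M (\<lambda>\<omega>. \<Sum>j\<le>T * 2 ^ Suc n. v n j \<omega>)" "integrable M (\<lambda>\<omega>. \<Sum>k\<le>T * 2 ^ n. w n k \<omega>)"
        using K1 K2 by (intro Bochner_Integration.integrable_sum; simp)+
      moreover have "(\<integral>\<omega>. (\<Sum>j\<le>T * 2 ^ Suc n. v n j \<omega>) \<partial>M) = (\<Sum>j\<le>T * 2 ^ Suc n. \<integral>\<omega>. v n j \<omega> \<partial>M)"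
        using K1 by (intro Bochner_Integration.integral_sum) simp
      moreover have "(\<integral>\<omega>. (\<Sum>k\<le>T * 2 ^ n. w n k \<omega>) \<partial>M) = (\<Sum>k\<le>T * 2 ^ n. \<integral>\<omega>. w n k \<omega> \<partial>M)"
        using K2 by (intro Bochner_Integration.integral_sum) simp
      ultimately show ?thesis unfolding f_def by (simp only: Bochner_Integration.integral_add)
    qed
    also have "\<dots> \<le> (\<Sum>j\<le>T * 2 ^ Suc n. K1 / 4 ^ n) + (\<Sum>k\<le>T * 2 ^ n. K2 / 4 ^ n)"
      using K1 K2 by (intro add_mono sum_mono) auto
    also have "\<dots> = (real T * 2 * 2 ^ n + 1) * (K1 / 4 ^ n) + (real T * 2 ^ n + 1) * (K2 / 4 ^ n)"
      by (simp add: algebra_simps add_divide_distrib)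
    also have "\<dots> \<le> (real (2 * T + 1) * 2 ^ n) * (K1 / 4 ^ n) + (real (T + 1) * 2 ^ n) * (K2 / 4 ^ n)"
      using K0 p by (intro add_mono mult_right_mono) (auto simp: algebra_simps)
    also have "\<dots> = K * (2 ^ n / 4 ^ n)" by (simp add: K_def algebra_simps add_divide_distrib)
    also have "(2 ^ n / 4 ^ n :: real) = 1 / 2 ^ n"
      using power_divide[of "2::real" 4 n] power_divide[of "1::real" 2 n] by simp
    finally show ?thesis by simp
  qed
  obtain g where g: "integrable M g" "\<And>\<omega>. 0 \<le> g \<omega>" "AE \<omega> in M. \<forall>i. f i \<omega> \<le> g \<omega> * (10/11) ^ (4 * i)"
    by (rule geometric_domination[of f M K])
      (use fi fK vw0 borel_measurable_integrable[OF fi] in \<open>auto simp: f_def intro!: add_nonneg_nonneg sum_nonneg\<close>)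
  show thesis
  proof (rule that[OF g(1,2)])
    show "AE \<omega> in M. (\<forall>n j. j \<le> T * 2 ^ Suc n \<longrightarrow> norm (euler D E x (Suc n) j \<omega> - euler D E x n (j div 2) \<omega>) \<le> sqrt (1 + g \<omega>) * (10/11) ^ n)
      \<and> (\<forall>n k. k \<le> T * 2 ^ n \<longrightarrow> norm (euler D E x n (Suc k) \<omega> - euler D E x n k \<omega>) \<le> sqrt (1 + g \<omega>) * (10/11) ^ n)"
      using g(3)
    proof eventually_elim
      case (elim \<omega>)
      have v: "v n j \<omega> \<le> g \<omega> * (10/11) ^ (4 * n)" if "j \<le> T * 2 ^ Suc n" for n j
      proof -
        have "v n j \<omega> \<le> (\<Sum>j\<le>T * 2 ^ Suc n. v n j \<omega>)" using that vw0 by (intro member_le_sum) auto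
        moreover have "0 \<le> (\<Sum>k\<le>T * 2 ^ n. w n k \<omega>)" by (intro sum_nonneg vw0)
        ultimately have "v n j \<omega> \<le> f n \<omega>" by (simp add: f_def)
        then show ?thesis using elim order_trans by blast
      qed
      have w: "w n k \<omega> \<le> g \<omega> * (10/11) ^ (4 * n)" if "k \<le> T * 2 ^ n" for n k
      proof -
        have "w n k \<omega> \<le> (\<Sum>k\<le>T * 2 ^ n. w n k \<omega>)" using that vw0 by (intro member_le_sum) auto
        moreover have "0 \<le> (\<Sum>j\<le>T * 2 ^ Suc n. v n j \<omega>)" by (intro sum_nonneg vw0)
        ultimately have "w n k \<omega> \<le> f n \<omega>" by (simp add: f_def)
        then show ?thesis using elim order_trans by blast
      qed
      show ?case
        by (intro conjI allI impI fourth_root_bound v[unfolded v_def] w[unfolded w_def] g(2)) auto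
    qed
  qed
qed

text \<open>
  One integrable random constant controls the distance to all schemes at all times up to \<open>T\<close>,
  which reduces all later mean-square estimates to integrating it.
\<close>

lemma euler_limit_bound:
  fixes T :: nat and D E :: "real^'n^'n"
  obtains G where "integrable M G" "\<And>\<omega>. 0 \<le> G \<omega>"
    "AE \<omega> in M. continuous_on {0..real T} (\<lambda>t. euler_limit D E x t \<omega>) \<and>
      (\<forall>n t. 0 \<le> t \<longrightarrow> t \<le> real T \<longrightarrow> (norm (euler_limit D E x t \<omega> - euler_process D E x n t \<omega>))\<^sup>2 \<le> G \<omega> * (100/121) ^ n)"
proof -
  obtain g where g: "integrable M g" "\<And>\<omega>. 0 \<le> g \<omega>"
    "AE \<omega> in M. (\<forall>n j. j \<le> T * 2 ^ Suc n \<longrightarrow> norm (euler D E x (Suc n) j \<omega> - euler D E x n (j div 2) \<omega>) \<le> sqrt (1 + g \<omega>) * (10/11) ^ n)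
      \<and> (\<forall>n k. k \<le> T * 2 ^ n \<longrightarrow> norm (euler D E x n (Suc k) \<omega> - euler D E x n k \<omega>) \<le> sqrt (1 + g \<omega>) * (10/11) ^ n)"
    by (rule euler_increments_dominated[of T D E x]) (rule that)
  define G where "G \<omega> = 121 * (1 + g \<omega>)" for \<omega>
  show thesis
  proof (rule that[of G])
    show "integrable M G" unfolding G_def using g(1) by simp
    show "0 \<le> G \<omega>" for \<omega> using g(2) by (simp add: G_def)
    show "AE \<omega> in M. continuous_on {0..real T} (\<lambda>t. euler_limit D E x t \<omega>) \<and>
      (\<forall>n t. 0 \<le> t \<longrightarrow> t \<le> real T \<longrightarrow> (norm (euler_limit D E x t \<omega> - euler_process D E x n t \<omega>))\<^sup>2 \<le> G \<omega> * (100/121) ^ n)"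
      using g(3)
    proof eventually_elim
      case (elim \<omega>)
      define C where "C = sqrt (1 + g \<omega>)"
      have step: "norm (euler_process D E x (Suc n) t \<omega> - euler_process D E x n t \<omega>) \<le> C * (10/11) ^ n"
        if t: "0 \<le> t" "t \<le> real T" for n t
      proof -
        have "euler_process D E x n t \<omega> = euler D E x n (nat \<lfloor>t * 2 ^ Suc n\<rfloor> div 2) \<omega>"
          unfolding euler_process_def floor_dyadic_half[OF t(1)] ..
        moreover have "nat \<lfloor>t * 2 ^ Suc n\<rfloor> \<le> T * 2 ^ Suc n" by (rule floor_dyadic_le[OF t])
        ultimately show ?thesis using elim by (simp only: euler_process_def C_def)
      qed
      have lim: "norm (euler_limit D E x t \<omega> - euler_process D E x n t \<omega>) \<le> 11 * C * (10/11) ^ n"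
        if t: "0 \<le> t" "t \<le> real T" for n t
        unfolding euler_limit_def by (rule geometric_limit(2)) (rule step[OF t])
      have "continuous_on {0..real T} (\<lambda>t. euler_limit D E x t \<omega>)"
        by (rule continuous_limit_of_steps[where y = "\<lambda>n k. euler D E x n k \<omega>" and C = C and C' = "11 * C"])
          (use elim lim in \<open>auto simp: C_def euler_process_def\<close>)
      moreover have "(norm (euler_limit D E x t \<omega> - euler_process D E x n t \<omega>))\<^sup>2 \<le> G \<omega> * (100/121) ^ n"
        if t: "0 \<le> t" "t \<le> real T" for n t
      proof -
        have "(norm (euler_limit D E x t \<omega> - euler_process D E x n t \<omega>))\<^sup>2 \<le> (11 * C * (10/11) ^ n)\<^sup>2"
          by (intro power_mono lim t) simp
        also have "\<dots> = 121 * C\<^sup>2 * (((10/11) ^ n)\<^sup>2)" by (simp add: power_mult_distrib)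
        also have "((10/11 :: real) ^ n)\<^sup>2 = ((10/11)\<^sup>2) ^ n"
          unfolding power_mult[symmetric] by (simp only: mult.commute)
        also have "(10/11 :: real)\<^sup>2 = 100/121" by (simp add: power2_eq_square)
        also have "121 * C\<^sup>2 = G \<omega>" using g(2)[of \<omega>] by (simp add: C_def G_def)
        finally show ?thesis .
      qed
      ultimately show ?case by blast
    qed
  qed
qed

lemma euler_process_measurable:
  assumes "0 \<le> t"
  shows "euler_process D E x n t \<in> borel_measurable (F t)"
proof -
  have "real (nat \<lfloor>t * 2 ^ n\<rfloor>) \<le> t * 2 ^ n" using assms by simp
  then have "real (nat \<lfloor>t * 2 ^ n\<rfloor>) / 2 ^ n \<le> t" by (simp add: field_simps)
  from measurable_F_mono[OF this euler_measurable] show ?thesis unfolding euler_process_def[abs_def] .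
qed

lemma euler_process_jointly_measurable:
  "(\<lambda>z. euler_process D E x n (fst z) (snd z)) \<in> borel_measurable (borel \<Otimes>\<^sub>M M)"
proof -
  have "(\<lambda>z :: real \<times> 'w. euler D E x n (nat \<lfloor>fst z * 2 ^ n\<rfloor>) (snd z)) \<in> borel_measurable (borel \<Otimes>\<^sub>M M)"
  proof (rule measurable_compose_countable)
    fix k
    have [measurable]: "euler D E x n k \<in> borel_measurable M" by (rule measurable_F_M[OF euler_measurable])
    show "(\<lambda>z :: real \<times> 'w. euler D E x n k (snd z)) \<in> borel_measurable (borel \<Otimes>\<^sub>M M)" by measurable
  next
    have 1: "(\<lambda>z :: real \<times> 'w. fst z * 2 ^ n) \<in> borel_measurable (borel \<Otimes>\<^sub>M M)" by measurable
    have 2: "(floor :: real \<Rightarrow> int) \<in> measurable borel (count_space UNIV)" by (rule measurable_real_floor)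
    have 3: "nat \<in> measurable (count_space UNIV) (count_space UNIV)" by simp
    show "(\<lambda>z :: real \<times> 'w. nat \<lfloor>fst z * 2 ^ n\<rfloor>) \<in> measurable (borel \<Otimes>\<^sub>M M) (count_space UNIV)"
      by (rule measurable_compose[OF measurable_compose[OF 1 2] 3])
  qed
  then show ?thesis by (simp add: euler_process_def)
qed

lemma euler_limit_jointly_measurable:
  "(\<lambda>z. euler_limit D E x (fst z) (snd z)) \<in> borel_measurable (borel \<Otimes>\<^sub>M M)"
  unfolding euler_limit_def by (intro borel_measurable_lim_metric euler_process_jointly_measurable)

lemma adapted_measurable_euler_limit: "adapted_measurable M F {0..} (euler_limit D E x)"
  unfolding adapted_measurable_def
proof (intro conjI ballI)
  fix s :: real assume "s \<in> {0..}"
  then show "euler_limit D E x s \<in> borel_measurable (F s)"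
    unfolding euler_limit_def[abs_def] by (intro borel_measurable_lim_metric euler_process_measurable) simp
next
  have "(\<lambda>z. (fst z, snd z)) \<in> measurable (restrict_space borel {0..} \<Otimes>\<^sub>M M) (borel \<Otimes>\<^sub>M M)"
    by (intro measurable_Pair measurable_compose[OF measurable_fst] measurable_snd measurable_restrict_space1) simp
  from measurable_compose[OF this euler_limit_jointly_measurable]
  show "(\<lambda>(s, \<omega>). euler_limit D E x s \<omega>) \<in> borel_measurable (restrict_space borel {0..} \<Otimes>\<^sub>M M)"
    by (simp add: split_beta')
qed

lemma continuous_paths_euler_limit: "AE \<omega> in M. continuous_on {0..} (\<lambda>t. euler_limit D E x t \<omega>)"
proof -
  have "AE \<omega> in M. continuous_on {0..real T} (\<lambda>t. euler_limit D E x t \<omega>)" for T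
    by (rule euler_limit_bound[of T D E x]) (auto elim: eventually_mono)
  then have "AE \<omega> in M. \<forall>T. continuous_on {0..real T} (\<lambda>t. euler_limit D E x t \<omega>)"
    by (simp add: AE_all_countable)
  then show ?thesis
  proof eventually_elim
    case (elim \<omega>)
    show ?case unfolding continuous_on_eq_continuous_within
    proof
      fix t :: real assume t: "t \<in> {0..}"
      obtain T :: nat where T: "t < real T" using reals_Archimedean2 by blast
      have "continuous (at t within {0..real T}) (\<lambda>t. euler_limit D E x t \<omega>)"
        using elim t T by (auto simp: continuous_on_eq_continuous_within)
      moreover have "at t within {0..real T} = at t within {0..}"
        by (rule at_within_nhd[of t "{..<real T}"]) (use T in auto)
      ultimately show "continuous (at t within {0..}) (\<lambda>t. euler_limit D E x t \<omega>)" by simp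
    qed
  qed
qed

end

text \<open>
  The dyadic grid of level \<open>n\<close>, stopped at \<open>t\<close>, as the partition of
  \<open>[0, t]\<close> for the simple integrands.
\<close>

definition dyadic_stop :: "real \<Rightarrow> nat \<Rightarrow> nat \<Rightarrow> real" where
  "dyadic_stop t n i = min t (real i / 2 ^ n)"

lemma dyadic_stop_props:
  assumes t: "0 \<le> t"
  shows "dyadic_stop t n 0 = 0" "dyadic_stop t n i \<le> dyadic_stop t n (Suc i)" "0 \<le> dyadic_stop t n i" "dyadic_stop t n i \<le> t"
    "dyadic_stop t n (Suc (nat \<lfloor>t * 2 ^ n\<rfloor>)) = t"
    "i \<le> nat \<lfloor>t * 2 ^ n\<rfloor> \<Longrightarrow> dyadic_stop t n i = real i / 2 ^ n"
proof -
  show "dyadic_stop t n 0 = 0" "0 \<le> dyadic_stop t n i" "dyadic_stop t n i \<le> t" using t by (auto simp: dyadic_stop_def)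
  show "dyadic_stop t n i \<le> dyadic_stop t n (Suc i)"
    unfolding dyadic_stop_def by (intro min.mono divide_right_mono) auto
  have "0 \<le> t * 2 ^ n" using t by simp
  then have "t * 2 ^ n \<le> real (Suc (nat \<lfloor>t * 2 ^ n\<rfloor>))" by linarith
  then have "t \<le> real (Suc (nat \<lfloor>t * 2 ^ n\<rfloor>)) / 2 ^ n" by (simp add: pos_le_divide_eq)
  then show "dyadic_stop t n (Suc (nat \<lfloor>t * 2 ^ n\<rfloor>)) = t" unfolding dyadic_stop_def by (rule min_absorb1)
  assume "i \<le> nat \<lfloor>t * 2 ^ n\<rfloor>"
  then have "real i \<le> real (nat \<lfloor>t * 2 ^ n\<rfloor>)" by simp
  also have "\<dots> \<le> t * 2 ^ n" using t by simp
  finally have "real i / 2 ^ n \<le> t" by (simp add: pos_divide_le_eq)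
  then show "dyadic_stop t n i = real i / 2 ^ n" unfolding dyadic_stop_def by (rule min_absorb2)
qed

text \<open>
  Step processes are constant on intervals that are open on the left, the Euler processes on intervals that are
  open on the right; the two differ at grid points only.
\<close>

lemma step_sum_dyadic:
  fixes y :: "nat \<Rightarrow> 'b::real_vector"
  assumes t: "0 \<le> t" and s: "s * 2 ^ n \<notin> \<int>"
  shows "(\<Sum>i<Suc (nat \<lfloor>t * 2 ^ n\<rfloor>). indicator {dyadic_stop t n i<..dyadic_stop t n (Suc i)} s *\<^sub>R y i)
    = indicator {0..t} s *\<^sub>R y (nat \<lfloor>s * 2 ^ n\<rfloor>)"
proof (cases "s \<in> {0..t}")
  case False
  have "s \<notin> {dyadic_stop t n i<..dyadic_stop t n (Suc i)}" for i
    using False dyadic_stop_props(3)[OF t, of n i] dyadic_stop_props(4)[OF t, of n "Suc i"] by auto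
  then show ?thesis using False by simp
next
  case True
  define m where "m = nat \<lfloor>s * 2 ^ n\<rfloor>"
  have s0: "0 \<le> s * 2 ^ n" using True by simp
  have ne: "s * 2 ^ n \<noteq> real m" using s by (metis Ints_of_nat)
  have m1: "real m < s * 2 ^ n" using s0 ne unfolding m_def by linarith
  have m2: "s * 2 ^ n < real m + 1" using s0 unfolding m_def by linarith
  have m3: "m \<le> nat \<lfloor>t * 2 ^ n\<rfloor>"
    unfolding m_def using True by (intro nat_mono floor_mono mult_right_mono) auto
  have ind: "(indicator {dyadic_stop t n i<..dyadic_stop t n (Suc i)} s :: real) = (if i = m then 1 else 0)" for i
  proof -
    have "(dyadic_stop t n i < s \<and> s \<le> dyadic_stop t n (Suc i)) \<longleftrightarrow> i = m"
    proof -
      have a: "dyadic_stop t n i < s \<longleftrightarrow> i \<le> m"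
      proof
        assume "dyadic_stop t n i < s"
        then have "real i / 2 ^ n < s" using True by (auto simp: dyadic_stop_def)
        then have "real i < s * 2 ^ n" by (simp add: pos_divide_less_eq)
        then show "i \<le> m" using m2 by linarith
      next
        assume "i \<le> m"
        then have "real i < s * 2 ^ n" using m1 by linarith
        then have "real i / 2 ^ n < s" by (simp add: pos_divide_less_eq)
        then show "dyadic_stop t n i < s" by (simp add: dyadic_stop_def)
      qed
      have b: "s \<le> dyadic_stop t n (Suc i) \<longleftrightarrow> m \<le> i"
      proof
        assume "s \<le> dyadic_stop t n (Suc i)"
        then have "s \<le> real (Suc i) / 2 ^ n" by (simp add: dyadic_stop_def)
        then have "s * 2 ^ n \<le> real (Suc i)" by (simp add: pos_le_divide_eq)
        then show "m \<le> i" using m1 by linarith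
      next
        assume "m \<le> i"
        then have "s * 2 ^ n \<le> real (Suc i)" using m2 by simp
        then have "s \<le> real (Suc i) / 2 ^ n" by (simp add: pos_le_divide_eq)
        then show "s \<le> dyadic_stop t n (Suc i)" using True by (simp add: dyadic_stop_def)
      qed
      show ?thesis unfolding a b by auto
    qed
    then show ?thesis by (auto split: split_indicator)
  qed
  have "(\<Sum>i<Suc (nat \<lfloor>t * 2 ^ n\<rfloor>). indicator {dyadic_stop t n i<..dyadic_stop t n (Suc i)} s *\<^sub>R y i)
    = (\<Sum>i<Suc (nat \<lfloor>t * 2 ^ n\<rfloor>). if m = i then y i else 0)"
    unfolding ind by (intro sum.cong) auto
  also have "\<dots> = y m" using m3 by (subst sum.delta') auto
  finally show ?thesis using True by (simp add: m_def)
qed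

lemma AE_not_dyadic: "AE s :: real in lborel. s * 2 ^ n \<notin> \<int>"
proof -
  have "{s :: real. s * 2 ^ n \<in> \<int>} \<subseteq> (\<lambda>z. of_int z / 2 ^ n) ` (UNIV :: int set)"
  proof
    fix s :: real assume "s \<in> {s. s * 2 ^ n \<in> \<int>}"
    then obtain z where "s * 2 ^ n = of_int z" by (auto elim: Ints_cases)
    then have "s = of_int z / 2 ^ n" by (simp add: eq_divide_eq)
    then show "s \<in> (\<lambda>z. of_int z / 2 ^ n) ` (UNIV :: int set)" by blast
  qed
  then have "countable {s :: real. s * 2 ^ n \<in> \<int>}" by (rule countable_subset) auto
  then have "{s :: real. s * 2 ^ n \<in> \<int>} \<in> null_sets lborel" by (rule countable_imp_null_set_lborel)
  from AE_not_in[OF this] show ?thesis by simp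
qed

context brownian_motion
begin

lemma fourth_imp_square_integrable:
  assumes "fourth_integrable M f" and "0 < (r::real)"
  shows "square_integrable M f" "(\<integral>\<omega>. (norm (f \<omega>))\<^sup>2 \<partial>M) \<le> (r + (\<integral>\<omega>. norm (f \<omega>) ^ 4 \<partial>M) / r) / 2"
proof -
  have [measurable]: "f \<in> borel_measurable M" and i: "integrable M (\<lambda>\<omega>. norm (f \<omega>) ^ 4)"
    using assms by (auto simp: fourth_integrable_def)
  have le: "(norm (f \<omega>))\<^sup>2 \<le> (r + norm (f \<omega>) ^ 4 / r) / 2" for \<omega>
  proof -
    have "0 \<le> ((norm (f \<omega>))\<^sup>2 - r)\<^sup>2 / r" using assms by simp
    also have "\<dots> = norm (f \<omega>) ^ 4 / r + r - 2 * (norm (f \<omega>))\<^sup>2"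
      using assms by (simp add: power2_eq_square power4_eq_xxxx field_simps)
    finally show ?thesis by simp
  qed
  have j: "integrable M (\<lambda>\<omega>. (norm (f \<omega>))\<^sup>2)"
  proof (rule Bochner_Integration.integrable_bound)
    show "integrable M (\<lambda>\<omega>. (r + norm (f \<omega>) ^ 4 / r) / 2)" using i by simp
    show "AE \<omega> in M. norm ((norm (f \<omega>))\<^sup>2) \<le> norm ((r + norm (f \<omega>) ^ 4 / r) / 2)"
      using le assms by (intro AE_I2) (auto intro: order_trans[OF le])
  qed measurable
  then show "square_integrable M f" by (simp add: square_integrable_def)
  have "(\<integral>\<omega>. (norm (f \<omega>))\<^sup>2 \<partial>M) \<le> (\<integral>\<omega>. (r + norm (f \<omega>) ^ 4 / r) / 2 \<partial>M)"
    using i j le by (intro integral_mono) auto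
  then show "(\<integral>\<omega>. (norm (f \<omega>))\<^sup>2 \<partial>M) \<le> (r + (\<integral>\<omega>. norm (f \<omega>) ^ 4 \<partial>M) / r) / 2" using i by (simp add: prob_space)
qed

lemma euler_limit_energy:
  assumes t: "0 \<le> t"
  shows "(\<integral>\<^sup>+\<omega>. (\<integral>\<^sup>+s\<in>{0..t}. ennreal ((norm (euler_limit D E x s \<omega>))\<^sup>2) \<partial>lborel) \<partial>M) < \<infinity>"
proof -
  obtain T :: nat where T: "t \<le> real T" using real_arch_simple by blast
  obtain G where G: "integrable M G" "\<And>\<omega>. 0 \<le> G \<omega>"
    "AE \<omega> in M. continuous_on {0..real T} (\<lambda>t. euler_limit D E x t \<omega>) \<and>
      (\<forall>n t. 0 \<le> t \<longrightarrow> t \<le> real T \<longrightarrow> (norm (euler_limit D E x t \<omega> - euler_process D E x n t \<omega>))\<^sup>2 \<le> G \<omega> * (100/121) ^ n)"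
    by (rule euler_limit_bound[of T D E x]) (rule that)
  define S where "S \<omega> = (\<Sum>k\<le>T. (norm (euler D E x 0 k \<omega>))\<^sup>2)" for \<omega>
  have S: "integrable M S" unfolding S_def
    using fourth_imp_square_integrable(1)[OF euler_fourth_integrable[of D E x 0], of 1]
    by (intro Bochner_Integration.integrable_sum) (auto simp: square_integrable_def)
  have S0: "0 \<le> S \<omega>" for \<omega> unfolding S_def by (intro sum_nonneg) auto
  have "(\<integral>\<^sup>+\<omega>. (\<integral>\<^sup>+s\<in>{0..t}. ennreal ((norm (euler_limit D E x s \<omega>))\<^sup>2) \<partial>lborel) \<partial>M)
    \<le> (\<integral>\<^sup>+\<omega>. (\<integral>\<^sup>+s\<in>{0..t}. ennreal (2 * G \<omega> + 2 * S \<omega>) \<partial>lborel) \<partial>M)"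
  proof (rule nn_integral_mono_AE)
    show "AE \<omega> in M. (\<integral>\<^sup>+s\<in>{0..t}. ennreal ((norm (euler_limit D E x s \<omega>))\<^sup>2) \<partial>lborel)
      \<le> (\<integral>\<^sup>+s\<in>{0..t}. ennreal (2 * G \<omega> + 2 * S \<omega>) \<partial>lborel)"
      using G(3)
    proof eventually_elim
      case (elim \<omega>)
      show ?case
      proof (rule nn_integral_mono)
        fix s :: real
        show "ennreal ((norm (euler_limit D E x s \<omega>))\<^sup>2) * indicator {0..t} s \<le> ennreal (2 * G \<omega> + 2 * S \<omega>) * indicator {0..t} s"
        proof (cases "s \<in> {0..t}")
          case True
          let ?Y = "euler_process D E x 0 s \<omega>"
          have "ennreal ((norm (euler_limit D E x s \<omega>))\<^sup>2) \<le> 2 * ennreal ((norm (euler_limit D E x s \<omega> - ?Y))\<^sup>2) + 2 * ennreal ((norm ?Y)\<^sup>2)"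
            using ennreal_norm_add_sq[of "euler_limit D E x s \<omega> - ?Y" ?Y] by simp
          also have "\<dots> = ennreal (2 * (norm (euler_limit D E x s \<omega> - ?Y))\<^sup>2 + 2 * (norm ?Y)\<^sup>2)"
            by (simp add: ennreal_plus ennreal_mult)
          also have "\<dots> \<le> ennreal (2 * G \<omega> + 2 * S \<omega>)"
          proof (intro ennreal_leI add_mono mult_left_mono)
            show "(norm (euler_limit D E x s \<omega> - ?Y))\<^sup>2 \<le> G \<omega>"
              using spec[OF conjunct2[OF elim], of 0] True T by simp
            have "nat \<lfloor>s * 2 ^ 0\<rfloor> \<le> T * 2 ^ 0" using True T by (intro floor_dyadic_le) auto
            then show "(norm ?Y)\<^sup>2 \<le> S \<omega>" unfolding S_def euler_process_def
              by (intro member_le_sum[of "nat \<lfloor>s * 2 ^ 0\<rfloor>" _ "\<lambda>k. (norm (euler D E x 0 k \<omega>))\<^sup>2"]) auto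
          qed auto
          finally show ?thesis by (rule mult_right_mono) simp
        qed simp
      qed
    qed
  qed
  also have "\<dots> = (\<integral>\<^sup>+\<omega>. ennreal (2 * G \<omega> + 2 * S \<omega>) * ennreal t \<partial>M)"
    using t by (simp add: nn_integral_cmult)
  also have "\<dots> = (\<integral>\<^sup>+\<omega>. ennreal (2 * G \<omega> + 2 * S \<omega>) \<partial>M) * ennreal t"
    using G(1) S by (intro nn_integral_multc) auto
  also have "(\<integral>\<^sup>+\<omega>. ennreal (2 * G \<omega> + 2 * S \<omega>) \<partial>M) = ennreal (\<integral>\<omega>. 2 * G \<omega> + 2 * S \<omega> \<partial>M)"
    using G S S0 by (intro nn_integral_eq_integral) auto
  also have "\<dots> * ennreal t < \<infinity>" by (simp add: ennreal_mult_less_top)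
  finally show ?thesis .
qed

lemma adapted_measurable_matrix_limit:
  assumes "0 \<le> t"
  shows "adapted_measurable M F {0..t} (\<lambda>s \<omega>. E *v euler_limit D E x s \<omega>)"
  unfolding adapted_measurable_def
proof (intro conjI ballI)
  fix s :: real assume "s \<in> {0..t}"
  then show "(\<lambda>\<omega>. E *v euler_limit D E x s \<omega>) \<in> borel_measurable (F s)"
    using adapted_measurable_euler_limit[of D E x]
    by (intro measurable_matrix_vector_mult) (auto simp: adapted_measurable_def)
next
  have "(\<lambda>z. (fst z, snd z)) \<in> measurable (restrict_space borel {0..t} \<Otimes>\<^sub>M M) (borel \<Otimes>\<^sub>M M)"
    by (intro measurable_Pair measurable_compose[OF measurable_fst] measurable_snd measurable_restrict_space1) simp
  from measurable_matrix_vector_mult[OF measurable_compose[OF this euler_limit_jointly_measurable]]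
  show "(\<lambda>(s, \<omega>). E *v euler_limit D E x s \<omega>) \<in> borel_measurable (restrict_space borel {0..t} \<Otimes>\<^sub>M M)"
    by (simp add: split_beta')
qed

lemma simple_integrand_euler:
  assumes t: "0 \<le> t"
  shows "simple_integrand M F t (Suc (nat \<lfloor>t * 2 ^ n\<rfloor>)) (dyadic_stop t n) (\<lambda>i \<omega>. E *v euler D E x n i \<omega>)"
  unfolding simple_integrand_def
proof (intro conjI allI impI dyadic_stop_props[OF t])
  fix i assume i: "i < Suc (nat \<lfloor>t * 2 ^ n\<rfloor>)"
  have "dyadic_stop t n i = real i / 2 ^ n" using i by (intro dyadic_stop_props(6)[OF t]) simp
  then show "(\<lambda>\<omega>. E *v euler D E x n i \<omega>) \<in> borel_measurable (F (dyadic_stop t n i))"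
    using measurable_matrix_vector_mult[OF euler_measurable] by simp
  have "square_integrable M (\<lambda>\<omega>. E *v euler D E x n i \<omega>)"
    by (intro square_integrable_linear[OF matrix_vector_mul_bounded_linear]
        fourth_imp_square_integrable(1)[OF euler_fourth_integrable, of 1]) simp
  then show "integrable M (\<lambda>\<omega>. (norm (E *v euler D E x n i \<omega>))\<^sup>2)" by (simp add: square_integrable_def)
qed

text \<open>
  The sum runs over one step more than the scheme at time \<open>t\<close> has made: the last, incomplete
  cell is the extra term on the right.
\<close>

lemma euler_telescope:
  fixes n :: nat
  assumes t: "0 \<le> t"
  defines "m \<equiv> nat \<lfloor>t * 2 ^ n\<rfloor>"
  shows "(\<Sum>i<Suc m. euler_jump D E (dyadic_stop t n i) (dyadic_stop t n (Suc i)) (euler D E x n i \<omega>) \<omega>)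
    = euler_process D E x n t \<omega> - x + euler_jump D E (real m / 2 ^ n) t (euler D E x n m \<omega>) \<omega>"
proof -
  have d: "dyadic_stop t n i = real i / 2 ^ n" if "i \<le> m" for i
    using dyadic_stop_props(6)[OF t] that by (simp add: m_def)
  have "(\<Sum>i<Suc m. euler_jump D E (dyadic_stop t n i) (dyadic_stop t n (Suc i)) (euler D E x n i \<omega>) \<omega>)
    = (\<Sum>i<m. euler_jump D E (dyadic_stop t n i) (dyadic_stop t n (Suc i)) (euler D E x n i \<omega>) \<omega>)
      + euler_jump D E (dyadic_stop t n m) (dyadic_stop t n (Suc m)) (euler D E x n m \<omega>) \<omega>" by simp
  also have "(\<Sum>i<m. euler_jump D E (dyadic_stop t n i) (dyadic_stop t n (Suc i)) (euler D E x n i \<omega>) \<omega>)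
    = (\<Sum>i<m. euler D E x n (Suc i) \<omega> - euler D E x n i \<omega>)"
    by (intro sum.cong refl) (simp add: d del: of_nat_Suc)
  also have "\<dots> = euler D E x n m \<omega> - x"
    using sum_lessThan_telescope[of "\<lambda>i. euler D E x n i \<omega>" m] by simp
  also have "dyadic_stop t n (Suc m) = t" unfolding m_def by (rule dyadic_stop_props(5)[OF t])
  finally show ?thesis by (simp add: d m_def euler_process_def)
qed

lemma euler_drift_integral:
  fixes n :: nat
  assumes t: "0 \<le> t"
  defines "m \<equiv> nat \<lfloor>t * 2 ^ n\<rfloor>"
  shows "integrable lborel (\<lambda>s. indicator {0..t} s *\<^sub>R (D *v euler_process D E x n s \<omega>))"
    and "(\<integral>s. indicator {0..t} s *\<^sub>R (D *v euler_process D E x n s \<omega>) \<partial>lborel)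
      = (\<Sum>i<Suc m. (dyadic_stop t n (Suc i) - dyadic_stop t n i) *\<^sub>R (D *v euler D E x n i \<omega>))"
proof -
  define S where "S s = (\<Sum>i<Suc m. indicator {dyadic_stop t n i<..dyadic_stop t n (Suc i)} s *\<^sub>R (D *v euler D E x n i \<omega>))" for s
  have ae: "AE s in lborel. S s = indicator {0..t} s *\<^sub>R (D *v euler_process D E x n s \<omega>)"
    using AE_not_dyadic[of n]
  proof eventually_elim
    case (elim s)
    show ?case using step_sum_dyadic[OF t elim, of "\<lambda>i. D *v euler D E x n i \<omega>"]
      by (simp add: S_def m_def euler_process_def)
  qed
  have le: "dyadic_stop t n i \<le> dyadic_stop t n (Suc i)" for i by (rule dyadic_stop_props(2)[OF t])
  have i1: "integrable lborel (\<lambda>s. indicator {dyadic_stop t n i<..dyadic_stop t n (Suc i)} s *\<^sub>R (D *v euler D E x n i \<omega>))" for i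
    using le[of i] by (intro integrable_scaleR_left) (auto intro!: integrable_real_indicator)
  have iS: "integrable lborel S" unfolding S_def by (intro Bochner_Integration.integrable_sum i1)
  have "(\<lambda>s::real. euler D E x n (nat \<lfloor>s * 2 ^ n\<rfloor>) \<omega>) \<in> borel_measurable lborel"
  proof (rule measurable_compose_countable[where f = "\<lambda>k s. euler D E x n k \<omega>"])
    have 1: "(\<lambda>s::real. s * 2 ^ n) \<in> borel_measurable lborel" by measurable
    have 3: "nat \<in> measurable (count_space UNIV) (count_space UNIV)" by simp
    show "(\<lambda>s::real. nat \<lfloor>s * 2 ^ n\<rfloor>) \<in> measurable lborel (count_space UNIV)"
      by (rule measurable_compose[OF measurable_compose[OF 1 measurable_real_floor] 3])
  qed simp
  then have "(\<lambda>s. D *v euler_process D E x n s \<omega>) \<in> borel_measurable lborel"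
    unfolding euler_process_def by (rule measurable_matrix_vector_mult)
  then have m: "(\<lambda>s. indicator {0..t} s *\<^sub>R (D *v euler_process D E x n s \<omega>)) \<in> borel_measurable lborel" by measurable
  show "integrable lborel (\<lambda>s. indicator {0..t} s *\<^sub>R (D *v euler_process D E x n s \<omega>))"
    by (rule integrable_cong_AE_imp[OF iS m ae])
  have "(\<integral>s. indicator {0..t} s *\<^sub>R (D *v euler_process D E x n s \<omega>) \<partial>lborel) = (\<integral>s. S s \<partial>lborel)"
    by (rule integral_cong_AE[OF borel_measurable_integrable[OF iS] m ae, symmetric])
  also have "\<dots> = (\<Sum>i<Suc m. \<integral>s. indicator {dyadic_stop t n i<..dyadic_stop t n (Suc i)} s *\<^sub>R (D *v euler D E x n i \<omega>) \<partial>lborel)"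
    unfolding S_def by (rule Bochner_Integration.integral_sum) (rule i1)
  also have "\<dots> = (\<Sum>i<Suc m. (dyadic_stop t n (Suc i) - dyadic_stop t n i) *\<^sub>R (D *v euler D E x n i \<omega>))"
  proof (intro sum.cong refl)
    fix i
    have "integrable lborel (indicator {dyadic_stop t n i<..dyadic_stop t n (Suc i)} :: real \<Rightarrow> real)"
      using le[of i] by (auto intro!: integrable_real_indicator)
    then show "(\<integral>s. indicator {dyadic_stop t n i<..dyadic_stop t n (Suc i)} s *\<^sub>R (D *v euler D E x n i \<omega>) \<partial>lborel)
      = (dyadic_stop t n (Suc i) - dyadic_stop t n i) *\<^sub>R (D *v euler D E x n i \<omega>)"
      using le[of i] by (subst integral_scaleR_left) auto
  qed
  finally show "(\<integral>s. indicator {0..t} s *\<^sub>R (D *v euler_process D E x n s \<omega>) \<partial>lborel)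
      = (\<Sum>i<Suc m. (dyadic_stop t n (Suc i) - dyadic_stop t n i) *\<^sub>R (D *v euler D E x n i \<omega>))" .
qed

lemma nn_integral_geometric_bound:
  assumes "integrable M G" "\<And>\<omega>. 0 \<le> G \<omega>" "0 \<le> c"
  shows "(\<integral>\<^sup>+\<omega>. ennreal (c * G \<omega> * (100/121) ^ n) \<partial>M) = ennreal (c * (\<integral>\<omega>. G \<omega> \<partial>M) * (100/121) ^ n)"
proof -
  have "(\<integral>\<^sup>+\<omega>. ennreal (c * G \<omega> * (100/121) ^ n) \<partial>M) = ennreal (\<integral>\<omega>. c * G \<omega> * (100/121) ^ n \<partial>M)"
    using assms by (intro nn_integral_eq_integral) auto
  then show ?thesis by simp
qed

lemma geometric_tendsto_ennreal: "(\<lambda>n. ennreal (c * (100/121) ^ n)) \<longlonglongrightarrow> 0"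
proof -
  have "(\<lambda>n. c * (100/121 :: real) ^ n) \<longlonglongrightarrow> 0"
    by (rule tendsto_mult_right_zero) (rule LIMSEQ_realpow_zero, auto)
  from tendsto_ennrealI[OF this] show ?thesis by simp
qed

lemma euler_integrand_error:
  assumes t: "0 \<le> t" and G: "0 \<le> G \<omega>"
    "\<And>s. 0 \<le> s \<Longrightarrow> s \<le> t \<Longrightarrow> (norm (euler_limit D E x s \<omega> - euler_process D E x n s \<omega>))\<^sup>2 \<le> G \<omega> * (100/121) ^ n"
  shows "(\<integral>\<^sup>+s\<in>{0..t}. ennreal ((norm (E *v euler_limit D E x s \<omega>
      - simple_process (Suc (nat \<lfloor>t * 2 ^ n\<rfloor>)) (dyadic_stop t n) (\<lambda>i \<omega>. E *v euler D E x n i \<omega>) s \<omega>))\<^sup>2) \<partial>lborel)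
    \<le> ennreal (((onorm ((*v) E))\<^sup>2 * t) * G \<omega> * (100/121) ^ n)"
proof -
  have "(\<integral>\<^sup>+s\<in>{0..t}. ennreal ((norm (E *v euler_limit D E x s \<omega>
      - simple_process (Suc (nat \<lfloor>t * 2 ^ n\<rfloor>)) (dyadic_stop t n) (\<lambda>i \<omega>. E *v euler D E x n i \<omega>) s \<omega>))\<^sup>2) \<partial>lborel)
    \<le> (\<integral>\<^sup>+s. ennreal ((onorm ((*v) E))\<^sup>2 * (G \<omega> * (100/121) ^ n)) * indicator {0..t} s \<partial>lborel)"
  proof (rule nn_integral_mono_AE)
    show "AE s in lborel. ennreal ((norm (E *v euler_limit D E x s \<omega>
      - simple_process (Suc (nat \<lfloor>t * 2 ^ n\<rfloor>)) (dyadic_stop t n) (\<lambda>i \<omega>. E *v euler D E x n i \<omega>) s \<omega>))\<^sup>2) * indicator {0..t} s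
      \<le> ennreal ((onorm ((*v) E))\<^sup>2 * (G \<omega> * (100/121) ^ n)) * indicator {0..t} s"
      using AE_not_dyadic[of n]
    proof eventually_elim
      case (elim s)
      show ?case
      proof (cases "s \<in> {0..t}")
        case True
        have "simple_process (Suc (nat \<lfloor>t * 2 ^ n\<rfloor>)) (dyadic_stop t n) (\<lambda>i \<omega>. E *v euler D E x n i \<omega>) s \<omega> = E *v euler_process D E x n s \<omega>"
          using step_sum_dyadic[OF t elim, of "\<lambda>i. E *v euler D E x n i \<omega>"] True
          by (simp add: simple_process_def euler_process_def)
        then have eq: "E *v euler_limit D E x s \<omega> - simple_process (Suc (nat \<lfloor>t * 2 ^ n\<rfloor>)) (dyadic_stop t n) (\<lambda>i \<omega>. E *v euler D E x n i \<omega>) s \<omega>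
          = E *v (euler_limit D E x s \<omega> - euler_process D E x n s \<omega>)"
          by (simp add: matrix_vector_mult_diff_distrib)
        have "(norm (E *v (euler_limit D E x s \<omega> - euler_process D E x n s \<omega>)))\<^sup>2
          \<le> (onorm ((*v) E) * norm (euler_limit D E x s \<omega> - euler_process D E x n s \<omega>))\<^sup>2"
          by (intro power_mono onorm_matrix) simp
        also have "\<dots> = (onorm ((*v) E))\<^sup>2 * (norm (euler_limit D E x s \<omega> - euler_process D E x n s \<omega>))\<^sup>2"
          by (rule power_mult_distrib)
        also have "\<dots> \<le> (onorm ((*v) E))\<^sup>2 * (G \<omega> * (100/121) ^ n)"
          using True by (intro mult_left_mono G) auto
        finally show ?thesis unfolding eq by (intro mult_right_mono ennreal_leI) auto
      qed simp
    qed
  qed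
  also have "\<dots> = ennreal ((onorm ((*v) E))\<^sup>2 * (G \<omega> * (100/121) ^ n)) * ennreal t"
    using t by (simp add: nn_integral_cmult)
  also have "\<dots> = ennreal (((onorm ((*v) E))\<^sup>2 * t) * G \<omega> * (100/121) ^ n)"
    using t G by (subst ennreal_mult[symmetric]) (auto simp: mult_ac)
  finally show ?thesis .
qed

text \<open>
  Subtracting the telescoped scheme from the limit splits the error of the Ito integral into the distance
  of the two processes at time \<open>t\<close>, the integral of the distance of their drifts, and the
  incomplete last step.
\<close>

lemma euler_integral_error:
  fixes n :: nat
  assumes t: "0 \<le> t" and cont: "continuous_on {0..t} (\<lambda>s. euler_limit D E x s \<omega>)"
    and G: "0 \<le> G \<omega>"
    "\<And>s. 0 \<le> s \<Longrightarrow> s \<le> t \<Longrightarrow> (norm (euler_limit D E x s \<omega> - euler_process D E x n s \<omega>))\<^sup>2 \<le> G \<omega> * (100/121) ^ n"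
  defines "m \<equiv> nat \<lfloor>t * 2 ^ n\<rfloor>"
  shows "ennreal ((norm (noise_part D x (euler_limit D E x) t \<omega>
      - simple_integral W (Suc m) (dyadic_stop t n) (\<lambda>i \<omega>. E *v euler D E x n i \<omega>) \<omega>))\<^sup>2)
    \<le> ennreal ((4 + 4 * (t\<^sup>2 * (onorm ((*v) D))\<^sup>2)) * G \<omega> * (100/121) ^ n)
      + 2 * ennreal ((norm (euler_jump D E (real m / 2 ^ n) t (euler D E x n m \<omega>) \<omega>))\<^sup>2)"
proof -
  let ?X = "euler_limit D E x" and ?Y = "euler_process D E x n"
  define rem where "rem = euler_jump D E (real m / 2 ^ n) t (euler D E x n m \<omega>) \<omega>"
  define f where "f s = indicator {0..t} s *\<^sub>R (D *v (?X s \<omega> - ?Y s \<omega>))" for s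
  have iX: "integrable lborel (\<lambda>s. indicator {0..t} s *\<^sub>R (D *v ?X s \<omega>))"
  proof -
    have "continuous_on {0..t} (\<lambda>s. D *v ?X s \<omega>)"
      by (intro bounded_linear.continuous_on[OF matrix_vector_mul_bounded_linear] cont)
    from borel_integrable_atLeastAtMost'[OF this] show ?thesis by (simp add: set_integrable_def)
  qed
  note iY = euler_drift_integral[OF t, where n = n and D = D and E = E and x = x and \<omega> = \<omega>]
  have fdiff: "f = (\<lambda>s. indicator {0..t} s *\<^sub>R (D *v ?X s \<omega>) - indicator {0..t} s *\<^sub>R (D *v ?Y s \<omega>))"
    by (simp add: f_def fun_eq_iff matrix_vector_mult_diff_distrib scaleR_right_diff_distrib)
  have fi: "integrable lborel f" unfolding fdiff by (rule Bochner_Integration.integrable_diff[OF iX iY(1)])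
  have fint: "(\<integral>s. f s \<partial>lborel) = drift_part D ?X t \<omega> - (\<Sum>i<Suc m. (dyadic_stop t n (Suc i) - dyadic_stop t n i) *\<^sub>R (D *v euler D E x n i \<omega>))"
    unfolding fdiff Bochner_Integration.integral_diff[OF iX iY(1)] iY(2) m_def
    by (simp add: drift_part_def set_lebesgue_integral_def)
  have tele: "(\<Sum>i<Suc m. (dyadic_stop t n (Suc i) - dyadic_stop t n i) *\<^sub>R (D *v euler D E x n i \<omega>))
      + simple_integral W (Suc m) (dyadic_stop t n) (\<lambda>i \<omega>. E *v euler D E x n i \<omega>) \<omega> = ?Y t \<omega> - x + rem"
    using euler_telescope[OF t, where n = n and D = D and E = E and x = x and \<omega> = \<omega>]
    unfolding euler_jump_def sum.distrib simple_integral_def rem_def m_def[symmetric] .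
  have eq: "noise_part D x ?X t \<omega> - simple_integral W (Suc m) (dyadic_stop t n) (\<lambda>i \<omega>. E *v euler D E x n i \<omega>) \<omega>
    = ((?X t \<omega> - ?Y t \<omega>) + - (\<integral>s. f s \<partial>lborel)) + - rem"
    unfolding fint noise_part_def using tele by (simp add: algebra_simps)
  have A: "ennreal ((norm (?X t \<omega> - ?Y t \<omega>))\<^sup>2) \<le> ennreal (G \<omega> * (100/121) ^ n)"
    by (intro ennreal_leI G t) simp
  have B: "ennreal ((norm (- (\<integral>s. f s \<partial>lborel)))\<^sup>2) \<le> ennreal (t\<^sup>2 * (onorm ((*v) D))\<^sup>2 * (G \<omega> * (100/121) ^ n))"
  proof -
    have "ennreal ((norm (\<integral>s. f s \<partial>lborel))\<^sup>2) \<le> ennreal t * (\<integral>\<^sup>+s. ennreal ((norm (f s))\<^sup>2) \<partial>lborel)"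
      by (rule norm_integral_sq_le) (use fi t in \<open>auto simp: f_def[abs_def]\<close>)
    also have "(\<integral>\<^sup>+s. ennreal ((norm (f s))\<^sup>2) \<partial>lborel) \<le> (\<integral>\<^sup>+s. ennreal ((onorm ((*v) D))\<^sup>2 * (G \<omega> * (100/121) ^ n)) * indicator {0..t} s \<partial>lborel)"
    proof (rule nn_integral_mono)
      fix s
      show "ennreal ((norm (f s))\<^sup>2) \<le> ennreal ((onorm ((*v) D))\<^sup>2 * (G \<omega> * (100/121) ^ n)) * indicator {0..t} s"
      proof (cases "s \<in> {0..t}")
        case True
        have "(norm (D *v (?X s \<omega> - ?Y s \<omega>)))\<^sup>2 \<le> (onorm ((*v) D) * norm (?X s \<omega> - ?Y s \<omega>))\<^sup>2"
          by (intro power_mono onorm_matrix) simp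
        also have "\<dots> = (onorm ((*v) D))\<^sup>2 * (norm (?X s \<omega> - ?Y s \<omega>))\<^sup>2" by (rule power_mult_distrib)
        also have "\<dots> \<le> (onorm ((*v) D))\<^sup>2 * (G \<omega> * (100/121) ^ n)" using True by (intro mult_left_mono G) auto
        finally show ?thesis using True by (simp add: f_def ennreal_leI)
      qed (simp add: f_def)
    qed
    also have "\<dots> = ennreal ((onorm ((*v) D))\<^sup>2 * (G \<omega> * (100/121) ^ n)) * ennreal t"
      using t by (simp add: nn_integral_cmult)
    finally have "ennreal ((norm (\<integral>s. f s \<partial>lborel))\<^sup>2) \<le> ennreal t * (ennreal ((onorm ((*v) D))\<^sup>2 * (G \<omega> * (100/121) ^ n)) * ennreal t)"
      by (simp add: mult_left_mono)
    also have "\<dots> = ennreal (t\<^sup>2 * (onorm ((*v) D))\<^sup>2 * (G \<omega> * (100/121) ^ n))"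
    proof -
      define a where "a = (onorm ((*v) D))\<^sup>2 * (G \<omega> * (100/121) ^ n)"
      have "0 \<le> a" using G by (simp add: a_def)
      then have "ennreal t * (ennreal a * ennreal t) = ennreal (t * (a * t))" using t by (simp add: ennreal_mult)
      then show ?thesis by (simp add: a_def power2_eq_square mult_ac)
    qed
    finally show ?thesis by simp
  qed
  have "ennreal ((norm (((?X t \<omega> - ?Y t \<omega>) + - (\<integral>s. f s \<partial>lborel)) + - rem))\<^sup>2)
    \<le> 2 * ennreal ((norm ((?X t \<omega> - ?Y t \<omega>) + - (\<integral>s. f s \<partial>lborel)))\<^sup>2) + 2 * ennreal ((norm (- rem))\<^sup>2)"
    by (rule ennreal_norm_add_sq)
  also have "\<dots> \<le> 2 * (2 * ennreal (G \<omega> * (100/121) ^ n) + 2 * ennreal (t\<^sup>2 * (onorm ((*v) D))\<^sup>2 * (G \<omega> * (100/121) ^ n)))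
      + 2 * ennreal ((norm (- rem))\<^sup>2)"
    by (intro add_right_mono mult_left_mono order_trans[OF ennreal_norm_add_sq] add_mono A B) auto
  also have "2 * (2 * ennreal (G \<omega> * (100/121) ^ n) + 2 * ennreal (t\<^sup>2 * (onorm ((*v) D))\<^sup>2 * (G \<omega> * (100/121) ^ n)))
    = ennreal ((4 + 4 * (t\<^sup>2 * (onorm ((*v) D))\<^sup>2)) * G \<omega> * (100/121) ^ n)"
  proof -
    have two: "2 * ennreal r = ennreal (2 * r)" if "0 \<le> r" for r using that by (simp add: ennreal_mult)
    have n: "0 \<le> G \<omega> * (100/121) ^ n" "0 \<le> t\<^sup>2 * (onorm ((*v) D))\<^sup>2 * (G \<omega> * (100/121) ^ n)" using G by auto
    show ?thesis
      using n by (simp add: two ennreal_plus[symmetric] del: ennreal_plus) (simp add: algebra_simps)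
  qed
  finally show ?thesis unfolding eq by (simp add: rem_def)
qed

lemma euler_remainder_bound:
  fixes n :: nat and T :: nat
  assumes t: "0 \<le> t" "t \<le> real T"
  defines "m \<equiv> nat \<lfloor>t * 2 ^ n\<rfloor>"
  shows "(\<integral>\<^sup>+\<omega>. ennreal ((norm (euler_jump D E (real m / 2 ^ n) t (euler D E x n m \<omega>) \<omega>))\<^sup>2) \<partial>M)
    \<le> ennreal ((1 + jump_const D E * (exp (2 * growth_const D E * real T) * norm x ^ 4)) * (1/2) ^ n)"
proof -
  define K where "K = exp (2 * growth_const D E * real T) * norm x ^ 4"
  define s where "s = real m / 2 ^ n"
  have K0: "0 \<le> K" by (simp add: K_def)
  have mt: "real m \<le> t * 2 ^ n" "t * 2 ^ n < real m + 1"
    using t by (simp_all add: m_def)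
  have "t \<le> (real m + 1) / 2 ^ n" using mt(2) by (simp add: pos_le_divide_eq)
  moreover have "real m / 2 ^ n \<le> t" using mt(1) by (simp add: pos_divide_le_eq)
  ultimately have st: "0 \<le> s" "s \<le> t" "t - s \<le> 1 / 2 ^ n"
    by (auto simp: s_def add_divide_distrib)
  have "1 / 2 ^ n \<le> (1::real)" by simp
  then have st1: "t \<le> s + 1" using st by linarith
  have m1: "euler D E x n m \<in> borel_measurable (F s)" unfolding s_def by (rule euler_measurable)
  note jm = euler_jump_moment[OF st(1,2) st1 m1 euler_fourth_integrable, of D E]
  have mT: "m \<le> T * 2 ^ n" unfolding m_def by (rule floor_dyadic_le[OF t])
  have "(\<integral>\<omega>. norm (euler_jump D E s t (euler D E x n m \<omega>) \<omega>) ^ 4 \<partial>M) \<le> jump_const D E * (t - s)\<^sup>2 * K"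
    by (rule order_trans[OF jm(2)]) (intro mult_left_mono, auto simp: K_def jump_const_nonneg intro!: euler_moment_bound mT)
  also have "\<dots> \<le> jump_const D E * (1 / 2 ^ n)\<^sup>2 * K"
    using st K0 by (intro mult_right_mono mult_left_mono power_mono) (auto simp: jump_const_nonneg)
  finally have b4: "(\<integral>\<omega>. norm (euler_jump D E s t (euler D E x n m \<omega>) \<omega>) ^ 4 \<partial>M) \<le> jump_const D E * (1 / 2 ^ n)\<^sup>2 * K" .
  have p: "0 < (1 / 2 ^ n :: real)" by simp
  note sq = fourth_imp_square_integrable[OF jm(1) p]
  have "(\<integral>\<omega>. (norm (euler_jump D E s t (euler D E x n m \<omega>) \<omega>))\<^sup>2 \<partial>M)
    \<le> (1 / 2 ^ n + (jump_const D E * (1 / 2 ^ n)\<^sup>2 * K) / (1 / 2 ^ n)) / 2"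
    by (rule order_trans[OF sq(2)]) (intro divide_right_mono add_left_mono b4, auto)
  also have "(jump_const D E * (1 / 2 ^ n)\<^sup>2 * K) / (1 / 2 ^ n) = jump_const D E * K * (1 / 2 ^ n)"
    by (simp add: power2_eq_square)
  also have "(1 / 2 ^ n + jump_const D E * K * (1 / 2 ^ n)) / 2 \<le> (1 + jump_const D E * K) * (1/2) ^ n"
  proof -
    have eq: "(1 / 2 ^ n + jump_const D E * K * (1 / 2 ^ n)) = (1 + jump_const D E * K) * (1/2) ^ n"
      by (simp add: power_divide add_divide_distrib)
    have nn: "0 \<le> (1 + jump_const D E * K) * (1/2) ^ n"
      using K0 jump_const_nonneg[of D E] by (intro mult_nonneg_nonneg add_nonneg_nonneg) auto
    have half: "r / 2 \<le> r" if "0 \<le> r" for r :: real using that by simp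
    show ?thesis unfolding eq by (rule half[OF nn])
  qed
  finally have "(\<integral>\<omega>. (norm (euler_jump D E s t (euler D E x n m \<omega>) \<omega>))\<^sup>2 \<partial>M) \<le> (1 + jump_const D E * K) * (1/2) ^ n" .
  moreover have "(\<integral>\<^sup>+\<omega>. ennreal ((norm (euler_jump D E s t (euler D E x n m \<omega>) \<omega>))\<^sup>2) \<partial>M)
    = ennreal (\<integral>\<omega>. (norm (euler_jump D E s t (euler D E x n m \<omega>) \<omega>))\<^sup>2 \<partial>M)"
    using sq(1) by (intro nn_integral_eq_integral) (auto simp: square_integrable_def)
  ultimately show ?thesis unfolding s_def K_def by (simp add: ennreal_leI)
qed

text \<open>
  The integrands of the Euler schemes are simple and approximate \<open>E X\<close>; their integrals
  converge to what the limit process has gained beyond its drift.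
\<close>

lemma has_ito_integral_euler_limit:
  assumes t: "0 \<le> t"
  shows "has_ito_integral M F W (\<lambda>s \<omega>. E *v euler_limit D E x s \<omega>) t (noise_part D x (euler_limit D E x) t)"
proof -
  let ?X = "euler_limit D E x"
  obtain T :: nat where T: "t \<le> real T" using real_arch_simple by blast
  obtain G where G: "integrable M G" "\<And>\<omega>. 0 \<le> G \<omega>"
    "AE \<omega> in M. continuous_on {0..real T} (\<lambda>t. ?X t \<omega>) \<and>
      (\<forall>n t. 0 \<le> t \<longrightarrow> t \<le> real T \<longrightarrow> (norm (?X t \<omega> - euler_process D E x n t \<omega>))\<^sup>2 \<le> G \<omega> * (100/121) ^ n)"
    by (rule euler_limit_bound[of T D E x]) (rule that)
  note Gm [measurable] = borel_measurable_integrable[OF G(1)]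
  have ae: "AE \<omega> in M. continuous_on {0..t} (\<lambda>t. ?X t \<omega>) \<and>
      (\<forall>n s. 0 \<le> s \<longrightarrow> s \<le> t \<longrightarrow> (norm (?X s \<omega> - euler_process D E x n s \<omega>))\<^sup>2 \<le> G \<omega> * (100/121) ^ n)"
    using G(3)
  proof eventually_elim
    case (elim \<omega>)
    then show ?case using T by (auto intro: continuous_on_subset)
  qed
  define g0 where "g0 = (\<integral>\<omega>. G \<omega> \<partial>M)"
  define N where "N n = Suc (nat \<lfloor>t * 2 ^ n\<rfloor>)" for n
  define \<xi> where "\<xi> n i \<omega> = E *v euler D E x n i \<omega>" for n i \<omega>
  define c1 where "c1 = (onorm ((*v) E))\<^sup>2 * t"
  define c2 where "c2 = 4 + 4 * (t\<^sup>2 * (onorm ((*v) D))\<^sup>2)"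
  define c3 where "c3 = 1 + jump_const D E * (exp (2 * growth_const D E * real T) * norm x ^ 4)"
  have c: "0 \<le> c1" "0 \<le> c2" using t by (auto simp: c1_def c2_def)
  have Xm [measurable]: "?X t \<in> borel_measurable M"
    using adapted_measurable_euler_limit[of D E x] t measurable_F_M by (auto simp: adapted_measurable_def)
  have [measurable]: "drift_part D ?X t \<in> borel_measurable M" by (rule drift_part_measurable_M[OF adapted_measurable_euler_limit])
  have nm: "noise_part D x ?X t \<in> borel_measurable M" unfolding noise_part_def[abs_def] by measurable
  have err1: "(\<integral>\<^sup>+\<omega>. (\<integral>\<^sup>+s\<in>{0..t}. ennreal ((norm (E *v ?X s \<omega> - simple_process (N n) (dyadic_stop t n) (\<xi> n) s \<omega>))\<^sup>2) \<partial>lborel) \<partial>M)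
      \<le> ennreal ((c1 * g0) * (100/121) ^ n)" for n
  proof -
    have "(\<integral>\<^sup>+\<omega>. (\<integral>\<^sup>+s\<in>{0..t}. ennreal ((norm (E *v ?X s \<omega> - simple_process (N n) (dyadic_stop t n) (\<xi> n) s \<omega>))\<^sup>2) \<partial>lborel) \<partial>M)
      \<le> (\<integral>\<^sup>+\<omega>. ennreal (c1 * G \<omega> * (100/121) ^ n) \<partial>M)"
    proof (rule nn_integral_mono_AE)
      show "AE \<omega> in M. (\<integral>\<^sup>+s\<in>{0..t}. ennreal ((norm (E *v ?X s \<omega> - simple_process (N n) (dyadic_stop t n) (\<xi> n) s \<omega>))\<^sup>2) \<partial>lborel)
        \<le> ennreal (c1 * G \<omega> * (100/121) ^ n)"
        using ae
      proof eventually_elim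
        case (elim \<omega>)
        show ?case unfolding N_def \<xi>_def[abs_def] c1_def
          by (rule euler_integrand_error[OF t G(2)]) (use elim in \<open>simp\<close>)
      qed
    qed
    also have "\<dots> = ennreal ((c1 * g0) * (100/121) ^ n)"
      unfolding g0_def by (rule nn_integral_geometric_bound[OF G(1,2) c(1)])
    finally show ?thesis .
  qed
  have err2: "(\<integral>\<^sup>+\<omega>. ennreal ((norm (noise_part D x ?X t \<omega> - simple_integral W (N n) (dyadic_stop t n) (\<xi> n) \<omega>))\<^sup>2) \<partial>M)
      \<le> ennreal ((c2 * g0) * (100/121) ^ n) + 2 * ennreal (c3 * (1/2) ^ n)" for n
  proof -
    define m where "m = nat \<lfloor>t * 2 ^ n\<rfloor>"
    let ?r = "\<lambda>\<omega>. euler_jump D E (real m / 2 ^ n) t (euler D E x n m \<omega>) \<omega>"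
    have "real m / 2 ^ n \<le> t" using t by (simp add: m_def field_simps)
    then have rm [measurable]: "?r \<in> borel_measurable M"
      by (intro measurable_F_M[OF euler_jump_measurable[OF euler_measurable]]) simp
    have "(\<integral>\<^sup>+\<omega>. ennreal ((norm (noise_part D x ?X t \<omega> - simple_integral W (N n) (dyadic_stop t n) (\<xi> n) \<omega>))\<^sup>2) \<partial>M)
      \<le> (\<integral>\<^sup>+\<omega>. ennreal (c2 * G \<omega> * (100/121) ^ n) + 2 * ennreal ((norm (?r \<omega>))\<^sup>2) \<partial>M)"
    proof (rule nn_integral_mono_AE)
      show "AE \<omega> in M. ennreal ((norm (noise_part D x ?X t \<omega> - simple_integral W (N n) (dyadic_stop t n) (\<xi> n) \<omega>))\<^sup>2)
        \<le> ennreal (c2 * G \<omega> * (100/121) ^ n) + 2 * ennreal ((norm (?r \<omega>))\<^sup>2)"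
        using ae
      proof eventually_elim
        case (elim \<omega>)
        show ?case unfolding N_def \<xi>_def[abs_def] c2_def m_def
          by (rule euler_integral_error[OF t _ G(2)]) (use elim in blast)+
      qed
    qed
    also have "\<dots> = (\<integral>\<^sup>+\<omega>. ennreal (c2 * G \<omega> * (100/121) ^ n) \<partial>M) + 2 * (\<integral>\<^sup>+\<omega>. ennreal ((norm (?r \<omega>))\<^sup>2) \<partial>M)"
      by (simp add: nn_integral_add nn_integral_cmult)
    also have "(\<integral>\<^sup>+\<omega>. ennreal (c2 * G \<omega> * (100/121) ^ n) \<partial>M) = ennreal ((c2 * g0) * (100/121) ^ n)"
      unfolding g0_def by (rule nn_integral_geometric_bound[OF G(1,2) c(2)])
    also have "ennreal ((c2 * g0) * (100/121) ^ n) + 2 * (\<integral>\<^sup>+\<omega>. ennreal ((norm (?r \<omega>))\<^sup>2) \<partial>M)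
      \<le> ennreal ((c2 * g0) * (100/121) ^ n) + 2 * ennreal (c3 * (1/2) ^ n)"
      unfolding m_def c3_def by (intro add_left_mono mult_left_mono euler_remainder_bound[OF t T]) simp
    finally show ?thesis .
  qed
  have lim2: "(\<lambda>n. ennreal ((c2 * g0) * (100/121) ^ n) + 2 * ennreal (c3 * (1/2) ^ n)) \<longlonglongrightarrow> 0"
  proof -
    have "(\<lambda>n. c3 * (1/2 :: real) ^ n) \<longlonglongrightarrow> 0"
      by (rule tendsto_mult_right_zero) (rule LIMSEQ_realpow_zero, auto)
    from tendsto_ennrealI[OF this] have "(\<lambda>n. ennreal (c3 * (1/2) ^ n)) \<longlonglongrightarrow> 0" by simp
    then have "(\<lambda>n. ennreal ((c2 * g0) * (100/121) ^ n) + 2 * ennreal (c3 * (1/2) ^ n)) \<longlonglongrightarrow> 0 + 2 * 0"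
      by (intro tendsto_add geometric_tendsto_ennreal tendsto_mult_ennreal tendsto_const) auto
    then show ?thesis by simp
  qed
  show ?thesis unfolding has_ito_integral_def
  proof (intro conjI nm adapted_measurable_matrix_limit[OF t] exI[of _ N] exI[of _ "dyadic_stop t"] exI[of _ \<xi>] allI)
    show "simple_integrand M F t (N j) (dyadic_stop t j) (\<xi> j)" for j
      unfolding N_def \<xi>_def[abs_def] by (rule simple_integrand_euler[OF t])
    show "(\<lambda>j. \<integral>\<^sup>+\<omega>. (\<integral>\<^sup>+s\<in>{0..t}. ennreal ((norm (E *v ?X s \<omega> - simple_process (N j) (dyadic_stop t j) (\<xi> j) s \<omega>))\<^sup>2) \<partial>lborel) \<partial>M) \<longlonglongrightarrow> 0"
      by (rule tendsto_sandwich[OF _ _ tendsto_const geometric_tendsto_ennreal[of "c1 * g0"]])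
        (auto intro!: always_eventually err1)
    show "(\<lambda>j. \<integral>\<^sup>+\<omega>. ennreal ((norm (noise_part D x ?X t \<omega> - simple_integral W (N j) (dyadic_stop t j) (\<xi> j) \<omega>))\<^sup>2) \<partial>M) \<longlonglongrightarrow> 0"
      by (rule tendsto_sandwich[OF _ _ tendsto_const lim2]) (auto intro!: always_eventually err2)
  qed
qed

lemma sde_solution_exists: "sde_solution M F W D E x (euler_limit D E x)"
  unfolding sde_solution_def
proof (intro conjI adapted_measurable_euler_limit continuous_paths_euler_limit allI impI euler_limit_energy)
  fix t :: real assume t: "0 \<le> t"
  show "\<exists>I. has_ito_integral M F W (\<lambda>s \<omega>. E *v euler_limit D E x s \<omega>) t I \<and>
      (AE \<omega> in M. euler_limit D E x t \<omega> = x + (LINT s:{0..t}|lborel. D *v euler_limit D E x s \<omega>) + I \<omega>)"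
    by (intro exI[of _ "noise_part D x (euler_limit D E x) t"] conjI has_ito_integral_euler_limit t)
      (simp add: noise_part_def drift_part_def)
qed

lemma L2_stable_iff_lyapunov: "L2_stable M F W D E \<longleftrightarrow> lyapunov_stable D E"
proof
  assume "lyapunov_stable D E"
  then show "L2_stable M F W D E"
    unfolding L2_stable_def using sde_solution_exists lyapunov_imp_energy by blast
qed (rule L2_stable_imp_lyapunov)

lemma stabilizable_iff_lmi: "stabilizable M F W A B C \<longleftrightarrow> lmi_feasible A B C"
  unfolding stabilizable_def L2_stable_iff_lyapunov lmi_feasible_iff ..

lemma noise_stabilizable_iff_lmi: "noise_stabilizable M F W A C \<longleftrightarrow> lmi_feasible A (0 :: real^'m^'n) C"
  unfolding noise_stabilizable_def L2_stable_iff_lyapunov lmi_feasible_iff by simp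

end

section \<open>Stabilizability of the controlled system and of its uncontrolled block\<close>

theorem proposition4p5:
  fixes M :: "'w measure" and F :: "real \<Rightarrow> 'w measure" and W :: "real \<Rightarrow> 'w \<Rightarrow> real"
    and A C P :: "real^('k::finite + 'l::finite)^('k + 'l)"
    and B :: "real^'m::finite^('k + 'l)"
    and A11 C11 :: "real^'k^'k" and A12 C12 :: "real^'l^'k" and A22 C22 :: "real^'l^'l"
    and B1 :: "real^'m^'k"
  assumes "brownian_motion M F W"
    and "dim (word_span (CARD('k + 'l) - 1) A C B) = CARD('k)"
    and "orthogonal_matrix P"
    and "transpose P ** A ** P = block_matrix A11 A12 0 A22"
    and "transpose P ** C ** P = block_matrix C11 C12 0 C22"
    and "transpose P ** B = block_column B1 0"
    and "dim (word_span (CARD('k + 'l) - 1) A11 C11 B1) = CARD('k)"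
  shows "stabilizable M F W A B C \<longleftrightarrow> noise_stabilizable M F W A22 C22"
proof -
  interpret brownian_motion M F W by (rule assms(1))
  have "stabilizable M F W A B C \<longleftrightarrow> lmi_feasible A B C" by (rule stabilizable_iff_lmi)
  also have "\<dots> \<longleftrightarrow> lmi_feasible A22 (0 :: real^'m^'l) C22"
    by (rule lmi_feasible_decomposition[OF assms(3-7)])
  also have "\<dots> \<longleftrightarrow> noise_stabilizable M F W A22 C22" by (rule noise_stabilizable_iff_lmi[symmetric])
  finally show ?thesis .
qed

end
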